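(* Let $N\ge2$, let $M$ be a (nonempty) smooth manifold of dimension $2N+2$, and let $k$ be an integer with $0\le k\le N$ and $k\equiv N\pmod2$. The open relation $\mathfrak R_k$, consisting of the $1$-jets of rank $2N$ distributions on $M$ for which the Pfaffian of the associated pencil of skew-symmetric forms has exactly $k$ real roots, all simple, is not ample.
   Context: Let $\pi\colon X=\mathrm{Gr}_{2N}(TM)\to M$, whose sections are the rank $2N$ (corank two) distributions on $M$, and let $X^{(1)}$ be the bundle of $1$-jets of local sections of $X$. For a local distribution $D$ near $q$, let $D^\perp(q)\subset T_q^*M$ be the annihilator of $D(q)$ and $L_q\colon D^\perp(q)\to\bigwedge^2D(q)^*$ the dual Levi map $\alpha\mapsto d\tilde\alpha|_{D(q)}$, with $\tilde\alpha$ any local $1$-form with $\tilde\alpha|_D=0$, $\tilde\alpha(q)=\alpha$; it depends only on the $1$-jet of $D$ at $q$. For a basis $p_1,p_2$ of $D^\perp(q)$ put $\omega_i=L_q(p_i)$ and $P(\mu,\lambda)=\operatorname{Pf}(\mu\omega_1+\lambda\omega_2)$ (with respect to a basis of $D(q)$), a real binary form of degree $N$, determined up to a nonzero scalar and a linear change of $(\mu,\lambda)$. $\mathfrak R_k\subset X^{(1)}$ is the set of $1$-jets for which $P\not\equiv0$ and $P$ has exactly $k$ real roots (roots in $\mathbb{RP}^1$), each of them simple; for $k=0$ this says that $P$ is definite. Ampleness. Let $V_x$ be the vertical tangent space of $X\to M$ at $x$, and fix a connection on $X$, i.e. a projection $\mathbb A\colon TX\to V$ onto the vertical distribution; it identifies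 $X^{(1)}|_x$ with $\mathrm{Hom}(T_{\pi(x)}M,V_x)$ via $J^1f(\pi(x))\mapsto\mathbb A_x\circ df_{\pi(x)}$. For a hyperplane $\tau\subset T_{\pi(x)}M$ and linear $\ell\colon\tau\to V_x$, the principal subspace is $P^\ell_\tau=\{L\in\mathrm{Hom}(T_{\pi(x)}M,V_x):L|_\tau=\ell\}$. A relation $\mathcal R\subset X^{(1)}$ is ample if for all $x,\tau,\ell$ either $\mathcal R\cap P^\ell_\tau=\emptyset$ or the convex hull of every connected component of $\mathcal R\cap P^\ell_\tau$ equals $P^\ell_\tau$. *)

theory Defs
  imports "HOL-Analysis.Analysis" "HOL-Library.Function_Algebras"
begin

section \<open>Functions as a real vector space\<close>

text \<open>Tangent vectors and linear maps are modelled below as functions. They carry the pointwise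
  vector operations and the topology of pointwise convergence, which on a finite-dimensional
  subspace is the usual one.\<close>

instantiation "fun" :: (type, scaleR) scaleR
begin

definition scaleR_fun_def: "r *\<^sub>R f = (\<lambda>x. r *\<^sub>R f x)"
instance ..

end

lemma scaleR_fun_apply [simp]: "(r *\<^sub>R f) x = r *\<^sub>R f x"
  by (simp add: scaleR_fun_def)

instance "fun" :: (type, real_vector) real_vector
  by standard (simp_all add: fun_eq_iff algebra_simps)

definition lin_on :: "'v::real_vector set \<Rightarrow> ('v \<Rightarrow> 'w::real_vector) \<Rightarrow> bool" where
  "lin_on S f \<longleftrightarrow>
     (\<forall>u\<in>S. \<forall>v\<in>S. f (u + v) = f u + f v) \<and> (\<forall>a. \<forall>v\<in>S. f (a *\<^sub>R v) = a *\<^sub>R f v)"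

text \<open>Linear maps between the subspaces \<open>S\<close> and \<open>W\<close>; the value \<open>0\<close> outside \<open>S\<close>
  makes the representing function unique.\<close>

definition Hom_on :: "'v::real_vector set \<Rightarrow> 'w::real_vector set \<Rightarrow> ('v \<Rightarrow> 'w) set" where
  "Hom_on S W = {L. lin_on S L \<and> L ` S \<subseteq> W \<and> (\<forall>v. v \<notin> S \<longrightarrow> L v = 0)}"

definition ordered_basis :: "nat \<Rightarrow> (nat \<Rightarrow> 'v::real_vector) \<Rightarrow> 'v set \<Rightarrow> bool" where
  "ordered_basis n b S \<longleftrightarrow>
     inj_on b {..<n} \<and> independent (b ` {..<n}) \<and> span (b ` {..<n}) = S"


section \<open>Smooth manifolds\<close>

text \<open>Both are meant for open sets.\<close>

primrec C_on :: "nat \<Rightarrow> 'v::real_normed_vector set \<Rightarrow> ('v \<Rightarrow> 'w::real_normed_vector) \<Rightarrow> bool" where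
  "C_on 0 S f \<longleftrightarrow> continuous_on S f"
| "C_on (Suc r) S f \<longleftrightarrow>
     f differentiable_on S \<and> (\<forall>v. C_on r S (\<lambda>x. frechet_derivative f (at x) v))"

definition smooth_on :: "'v::real_normed_vector set \<Rightarrow> ('v \<Rightarrow> 'w::real_normed_vector) \<Rightarrow> bool" where
  "smooth_on S f \<longleftrightarrow> (\<forall>r. C_on r S f)"

type_synonym ('a, 'e) chart = "'a set \<times> ('a \<Rightarrow> 'e)"

abbreviation chart_dom :: "('a, 'e) chart \<Rightarrow> 'a set" where "chart_dom c \<equiv> fst c"
abbreviation chart_map :: "('a, 'e) chart \<Rightarrow> 'a \<Rightarrow> 'e" where "chart_map c \<equiv> snd c"

definition chart_inv :: "('a, 'e) chart \<Rightarrow> 'e \<Rightarrow> 'a" where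
  "chart_inv c = inv_into (chart_dom c) (chart_map c)"

definition smooth_manifold :: "'a topology \<Rightarrow> ('a, 'e::euclidean_space) chart set \<Rightarrow> bool" where
  "smooth_manifold T A \<longleftrightarrow>
     Hausdorff_space T \<and> second_countable T \<and>
     \<Union>(chart_dom ` A) = topspace T \<and>
     (\<forall>c\<in>A. openin T (chart_dom c) \<and> open (chart_map c ` chart_dom c) \<and>
        homeomorphic_map (subtopology T (chart_dom c))
          (top_of_set (chart_map c ` chart_dom c)) (chart_map c)) \<and>
     (\<forall>c\<in>A. \<forall>c'\<in>A. smooth_on (chart_map c ` (chart_dom c \<inter> chart_dom c'))
        (chart_map c' \<circ> chart_inv c))"

definition chart_at :: "('a, 'e) chart set \<Rightarrow> 'a \<Rightarrow> ('a, 'e) chart" where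
  "chart_at A q = (SOME c. c \<in> A \<and> q \<in> chart_dom c)"

definition smooth_map_at ::
  "('a, 'e::real_normed_vector) chart set \<Rightarrow> ('b, 'f::real_normed_vector) chart set
     \<Rightarrow> ('a \<Rightarrow> 'b) \<Rightarrow> 'a \<Rightarrow> bool" where
  "smooth_map_at A B f q \<longleftrightarrow>
     (\<exists>c\<in>A. \<exists>c'\<in>B. \<exists>W. q \<in> W \<and> W \<subseteq> chart_dom c \<and> open (chart_map c ` W) \<and>
        f ` W \<subseteq> chart_dom c' \<and> smooth_on (chart_map c ` W) (chart_map c' \<circ> f \<circ> chart_inv c))"


section \<open>Tangent spaces and differentials\<close>

text \<open>A tangent vector at \<open>q\<close> is the family of its coordinate vectors in all charts around \<open>q\<close>,
  related by the derivatives of the transition maps (and \<open>0\<close> at the remaining charts).\<close>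

type_synonym ('a, 'e) tvec = "('a, 'e) chart \<Rightarrow> 'e"

definition tangent_space :: "('a, 'e::real_normed_vector) chart set \<Rightarrow> 'a \<Rightarrow> ('a, 'e) tvec set" where
  "tangent_space A q =
     {v. (\<forall>c\<in>A. \<forall>c'\<in>A. q \<in> chart_dom c \<and> q \<in> chart_dom c' \<longrightarrow>
            v c' = frechet_derivative (chart_map c' \<circ> chart_inv c) (at (chart_map c q)) (v c)) \<and>
         (\<forall>c. \<not> (c \<in> A \<and> q \<in> chart_dom c) \<longrightarrow> v c = 0)}"

definition tangent_vec ::
  "('a, 'e::real_normed_vector) chart set \<Rightarrow> ('a, 'e) chart \<Rightarrow> 'a \<Rightarrow> 'e \<Rightarrow> ('a, 'e) tvec" where
  "tangent_vec A c q w =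
     (\<lambda>c'. if c' \<in> A \<and> q \<in> chart_dom c'
           then frechet_derivative (chart_map c' \<circ> chart_inv c) (at (chart_map c q)) w else 0)"

definition differential ::
  "('a, 'e::real_normed_vector) chart set \<Rightarrow> ('b, 'f::real_normed_vector) chart set
     \<Rightarrow> ('a \<Rightarrow> 'b) \<Rightarrow> 'a \<Rightarrow> ('a, 'e) tvec \<Rightarrow> ('b, 'f) tvec" where
  "differential A B f q v =
     (if v \<in> tangent_space A q then
        (let c = chart_at A q; c' = chart_at B (f q)
         in tangent_vec B c' (f q)
              (frechet_derivative (chart_map c' \<circ> f \<circ> chart_inv c) (at (chart_map c q)) (v c)))
      else 0)"


section \<open>Bundles, 1-jets, connections and ampleness\<close>

text \<open>A bundle \<open>\<pi> : X \<rightarrow> M\<close> is given by the set \<open>X\<close>, an atlas \<open>B\<close> of \<open>X\<close> and the map \<open>\<pi>\<close>;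
  \<open>T\<close> and \<open>A\<close> are the topology and an atlas of \<open>M\<close>.\<close>

definition local_section ::
  "'a topology \<Rightarrow> ('a, 'e::real_normed_vector) chart set \<Rightarrow> ('x, 'f::real_normed_vector) chart set
     \<Rightarrow> 'x set \<Rightarrow> ('x \<Rightarrow> 'a) \<Rightarrow> 'a set \<Rightarrow> ('a \<Rightarrow> 'x) \<Rightarrow> bool" where
  "local_section T A B X \<pi> U f \<longleftrightarrow>
     openin T U \<and> (\<forall>p\<in>U. f p \<in> X \<and> \<pi> (f p) = p \<and> smooth_map_at A B f p)"

text \<open>The 1-jet at \<open>q\<close> of a section \<open>f\<close>, represented by its value and its differential.\<close>

type_synonym ('a, 'e, 'x, 'f) jet = "'x \<times> (('a, 'e) tvec \<Rightarrow> ('x, 'f) tvec)"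

definition jet1 ::
  "('a, 'e::real_normed_vector) chart set \<Rightarrow> ('x, 'f::real_normed_vector) chart set
     \<Rightarrow> ('a \<Rightarrow> 'x) \<Rightarrow> 'a \<Rightarrow> ('a, 'e, 'x, 'f) jet" where
  "jet1 A B f q = (f q, differential A B f q)"

definition vertical_space ::
  "('a, 'e::real_normed_vector) chart set \<Rightarrow> ('x, 'f::real_normed_vector) chart set
     \<Rightarrow> ('x \<Rightarrow> 'a) \<Rightarrow> 'x \<Rightarrow> ('x, 'f) tvec set" where
  "vertical_space A B \<pi> x = {v \<in> tangent_space B x. differential B A \<pi> x v = 0}"

definition is_connection ::
  "('a, 'e::real_normed_vector) chart set \<Rightarrow> ('x, 'f::real_normed_vector) chart set \<Rightarrow> 'x set
     \<Rightarrow> ('x \<Rightarrow> 'a) \<Rightarrow> ('x \<Rightarrow> ('x, 'f) tvec \<Rightarrow> ('x, 'f) tvec) \<Rightarrow> bool" where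
  "is_connection A B X \<pi> \<Gamma> \<longleftrightarrow>
     (\<forall>x\<in>X. lin_on (tangent_space B x) (\<Gamma> x) \<and>
        \<Gamma> x ` tangent_space B x \<subseteq> vertical_space A B \<pi> x \<and>
        (\<forall>v \<in> vertical_space A B \<pi> x. \<Gamma> x v = v)) \<and>
     (\<forall>c\<in>B. \<forall>w. smooth_on (chart_map c ` chart_dom c)
        (\<lambda>y. \<Gamma> (chart_inv c y) (tangent_vec B c (chart_inv c y) w) c))"

text \<open>The fibre of a relation \<open>R\<close> over \<open>x\<close>, seen in \<open>Hom(T M, V)\<close> by means of the connection.\<close>

definition relation_fibre ::
  "('x \<Rightarrow> ('x, 'f) tvec \<Rightarrow> ('x, 'f) tvec) \<Rightarrow> ('a, 'e, 'x, 'f) jet set \<Rightarrow> 'x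
     \<Rightarrow> (('a, 'e) tvec \<Rightarrow> ('x, 'f) tvec) set" where
  "relation_fibre \<Gamma> R x = {\<Gamma> x \<circ> L | L. (x, L) \<in> R}"

definition hyperplane_of :: "'v::real_vector set \<Rightarrow> 'v set \<Rightarrow> bool" where
  "hyperplane_of S \<tau> \<longleftrightarrow> subspace \<tau> \<and> \<tau> \<subseteq> S \<and> dim \<tau> + 1 = dim S"

definition principal_subspace ::
  "'v::real_vector set \<Rightarrow> 'w::real_vector set \<Rightarrow> 'v set \<Rightarrow> ('v \<Rightarrow> 'w) \<Rightarrow> ('v \<Rightarrow> 'w) set" where
  "principal_subspace S V \<tau> l = {L \<in> Hom_on S V. \<forall>v\<in>\<tau>. L v = l v}"

definition ample ::
  "('a, 'e::real_normed_vector) chart set \<Rightarrow> ('x, 'f::real_normed_vector) chart set \<Rightarrow> 'x set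
     \<Rightarrow> ('x \<Rightarrow> 'a) \<Rightarrow> ('x \<Rightarrow> ('x, 'f) tvec \<Rightarrow> ('x, 'f) tvec) \<Rightarrow> ('a, 'e, 'x, 'f) jet set \<Rightarrow> bool" where
  "ample A B X \<pi> \<Gamma> R \<longleftrightarrow>
     (\<forall>x\<in>X. \<forall>\<tau> l.
        hyperplane_of (tangent_space A (\<pi> x)) \<tau> \<and> l \<in> Hom_on \<tau> (vertical_space A B \<pi> x) \<longrightarrow>
        (let P = principal_subspace (tangent_space A (\<pi> x)) (vertical_space A B \<pi> x) \<tau> l;
             S = relation_fibre \<Gamma> R x \<inter> P
         in S = {} \<or> (\<forall>C \<in> components S. convex hull C = P)))"


section \<open>The Grassmannian bundle of corank two distributions\<close>

type_synonym ('a, 'e) gr_point = "'a \<times> ('a, 'e) tvec set"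

definition gr_bundle ::
  "'a topology \<Rightarrow> ('a, 'e::real_normed_vector) chart set \<Rightarrow> nat \<Rightarrow> ('a, 'e) gr_point set" where
  "gr_bundle T A r =
     {(q, D). q \<in> topspace T \<and> subspace D \<and> D \<subseteq> tangent_space A q \<and> dim D = r}"

text \<open>The standard charts: in the coordinates of \<open>c\<close>, followed by a linear isomorphism \<open>g\<close> of the
  model space with \<open>\<real>\<^sup>d \<times> \<real>\<^sup>2\<close>, the plane is the graph of a \<open>2 \<times> d\<close> matrix.\<close>

definition gr_graph ::
  "('a, 'e::real_normed_vector) chart \<Rightarrow> ('e \<Rightarrow> (real^'d) \<times> (real^2)) \<Rightarrow> ('a, 'e) tvec set
     \<Rightarrow> real^'d^2 \<Rightarrow> bool" where
  "gr_graph c g D G \<longleftrightarrow> (\<lambda>v. v c) ` D = {w. snd (g w) = G *v fst (g w)}"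

definition gr_chart ::
  "'a topology \<Rightarrow> ('a, 'e::real_normed_vector) chart set \<Rightarrow> ('a, 'e) chart
     \<Rightarrow> ('e \<Rightarrow> (real^'d) \<times> (real^2)) \<Rightarrow> (('a, 'e) gr_point, 'e \<times> (real^'d^2)) chart" where
  "gr_chart T A c g =
     ({(q, D). (q, D) \<in> gr_bundle T A CARD('d) \<and> q \<in> chart_dom c \<and> (\<exists>G. gr_graph c g D G)},
      \<lambda>(q, D). (chart_map c q, THE G. gr_graph c g D G))"

definition gr_atlas ::
  "'a topology \<Rightarrow> ('a, 'e::real_normed_vector) chart set
     \<Rightarrow> (('a, 'e) gr_point, 'e \<times> (real^'d^2)) chart set" where
  "gr_atlas T A = {gr_chart T A c g | c g. c \<in> A \<and> linear g \<and> bij g}"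


section \<open>The dual Levi map\<close>

definition one_form_on ::
  "('a, 'e::real_normed_vector) chart set \<Rightarrow> 'a set \<Rightarrow> ('a \<Rightarrow> ('a, 'e) tvec \<Rightarrow> real) \<Rightarrow> bool" where
  "one_form_on A U \<alpha> \<longleftrightarrow>
     (\<forall>p\<in>U. \<alpha> p \<in> Hom_on (tangent_space A p) UNIV) \<and>
     (\<forall>c\<in>A. \<forall>w. smooth_on (chart_map c ` (U \<inter> chart_dom c))
        (\<lambda>y. \<alpha> (chart_inv c y) (tangent_vec A c (chart_inv c y) w)))"

text \<open>In coordinates, \<open>d\<alpha>(u,v) = \<partial>\<^sub>u (\<alpha>(v)) - \<partial>\<^sub>v (\<alpha>(u))\<close> for constant \<open>u\<close>, \<open>v\<close>;
  the result does not depend on the chart.\<close>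

definition ext_deriv ::
  "('a, 'e::real_normed_vector) chart set \<Rightarrow> ('a \<Rightarrow> ('a, 'e) tvec \<Rightarrow> real) \<Rightarrow> 'a
     \<Rightarrow> ('a, 'e) tvec \<Rightarrow> ('a, 'e) tvec \<Rightarrow> real" where
  "ext_deriv A \<alpha> q u v =
     (let c = chart_at A q;
          a = (\<lambda>w y. \<alpha> (chart_inv c y) (tangent_vec A c (chart_inv c y) w))
      in frechet_derivative (a (v c)) (at (chart_map c q)) (u c)
         - frechet_derivative (a (u c)) (at (chart_map c q)) (v c))"

definition annihilator ::
  "('a, 'e::real_normed_vector) chart set \<Rightarrow> 'a \<Rightarrow> ('a, 'e) tvec set \<Rightarrow> (('a, 'e) tvec \<Rightarrow> real) set"
  where
  "annihilator A q D = {\<alpha> \<in> Hom_on (tangent_space A q) UNIV. \<forall>v\<in>D. \<alpha> v = 0}"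

definition annihilating_extension ::
  "'a topology \<Rightarrow> ('a, 'e::real_normed_vector) chart set \<Rightarrow> ('a \<Rightarrow> ('a, 'e) tvec set) \<Rightarrow> 'a
     \<Rightarrow> (('a, 'e) tvec \<Rightarrow> real) \<Rightarrow> ('a \<Rightarrow> ('a, 'e) tvec \<Rightarrow> real) \<Rightarrow> bool" where
  "annihilating_extension T A D q \<alpha> \<alpha>' \<longleftrightarrow>
     \<alpha>' q = \<alpha> \<and>
     (\<exists>U. openin T U \<and> q \<in> U \<and> one_form_on A U \<alpha>' \<and> (\<forall>p\<in>U. \<forall>v\<in>D p. \<alpha>' p v = 0))"

text \<open>The value on \<open>D q\<close> does not depend on the extension chosen.\<close>

definition dual_levi ::
  "'a topology \<Rightarrow> ('a, 'e::real_normed_vector) chart set \<Rightarrow> ('a \<Rightarrow> ('a, 'e) tvec set) \<Rightarrow> 'a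
     \<Rightarrow> (('a, 'e) tvec \<Rightarrow> real) \<Rightarrow> ('a, 'e) tvec \<Rightarrow> ('a, 'e) tvec \<Rightarrow> real" where
  "dual_levi T A D q \<alpha> = ext_deriv A (SOME \<alpha>'. annihilating_extension T A D q \<alpha> \<alpha>') q"


section \<open>Pfaffians and real roots of binary forms\<close>

definition pfaffian :: "nat \<Rightarrow> (nat \<Rightarrow> nat \<Rightarrow> real) \<Rightarrow> real" where
  "pfaffian N a =
     (\<Sum>\<sigma> | \<sigma> permutes {..<2*N}. of_int (sign \<sigma>) * (\<Prod>i<N. a (\<sigma> (2*i)) (\<sigma> (2*i+1))))
     / (2 ^ N * fact N)"

definition binary_form :: "nat \<Rightarrow> (real \<Rightarrow> real \<Rightarrow> real) \<Rightarrow> bool" where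
  "binary_form d P \<longleftrightarrow> (\<exists>c. \<forall>\<mu> \<nu>. P \<mu> \<nu> = (\<Sum>j\<le>d. c j * \<mu> ^ j * \<nu> ^ (d - j)))"

text \<open>Points of the real projective line are the lines through the origin of the plane.\<close>

definition real_roots :: "(real \<Rightarrow> real \<Rightarrow> real) \<Rightarrow> (real \<times> real) set set" where
  "real_roots P = {l. subspace l \<and> dim l = 1 \<and> (\<forall>(a, b)\<in>l. P a b = 0)}"

text \<open>For a form \<open>P\<close> of degree \<open>d\<close>: the linear form vanishing on \<open>l\<close> divides \<open>P\<close> exactly once.\<close>

definition simple_root :: "nat \<Rightarrow> (real \<Rightarrow> real \<Rightarrow> real) \<Rightarrow> (real \<times> real) set \<Rightarrow> bool" where
  "simple_root d P l \<longleftrightarrow>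
     (\<exists>a b Q. (a, b) \<in> l \<and> (a, b) \<noteq> (0, 0) \<and> binary_form (d - 1) Q \<and>
        (\<forall>\<mu> \<nu>. P \<mu> \<nu> = (b * \<mu> - a * \<nu>) * Q \<mu> \<nu>) \<and> Q a b \<noteq> 0)"

definition exactly_simple_real_roots :: "nat \<Rightarrow> nat \<Rightarrow> (real \<Rightarrow> real \<Rightarrow> real) \<Rightarrow> bool" where
  "exactly_simple_real_roots d k P \<longleftrightarrow>
     (\<exists>\<mu> \<nu>. P \<mu> \<nu> \<noteq> 0) \<and> finite (real_roots P) \<and> card (real_roots P) = k \<and>
     (\<forall>l \<in> real_roots P. simple_root d P l)"


section \<open>The relation\<close>

definition pencil_pfaffian ::
  "'a topology \<Rightarrow> ('a, 'e::real_normed_vector) chart set \<Rightarrow> nat \<Rightarrow> ('a \<Rightarrow> ('a, 'e) tvec set) \<Rightarrow> 'a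
     \<Rightarrow> (nat \<Rightarrow> ('a, 'e) tvec \<Rightarrow> real) \<Rightarrow> (nat \<Rightarrow> ('a, 'e) tvec) \<Rightarrow> real \<Rightarrow> real \<Rightarrow> real" where
  "pencil_pfaffian T A N D q p b \<mu> \<nu> =
     pfaffian N (\<lambda>i j. \<mu> * dual_levi T A D q (p 0) (b i) (b j)
                      + \<nu> * dual_levi T A D q (p 1) (b i) (b j))"

text \<open>The condition depends neither on the representative \<open>f\<close> of the jet nor on the bases \<open>p\<close> of
  the annihilator and \<open>b\<close> of the plane.\<close>

definition pfaffian_root_relation ::
  "'a topology \<Rightarrow> ('a, 'e::real_normed_vector) chart set \<Rightarrow> nat \<Rightarrow> nat
     \<Rightarrow> ('a, 'e, ('a, 'e) gr_point, 'e \<times> (real^'d^2)) jet set" where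
  "pfaffian_root_relation T A N k =
     {jet1 A (gr_atlas T A) f q | f q.
        (\<exists>U. q \<in> U \<and> local_section T A (gr_atlas T A :: (_, 'e \<times> (real^'d^2)) chart set)
                      (gr_bundle T A (2*N)) fst U f) \<and>
        (\<exists>p b. ordered_basis 2 p (annihilator A q (snd (f q))) \<and>
               ordered_basis (2*N) b (snd (f q)) \<and>
               exactly_simple_real_roots N k (pencil_pfaffian T A N (\<lambda>q. snd (f q)) q p b))}"

end

theory Submission
  imports Defs "Jordan_Normal_Form.Determinant"
begin

text \<open>Let D be a plane of corank two in the tangent space at q, and let \<tau> be a hyperplane that does not contain
D. Take coordinates (u, y) in which D is y = 0. A distribution near q is then the graph of a matrix-valued function G
with G(q) = 0, its 1-jet is the derivative \<Lambda> of G, and the dual Levi forms are the two components of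
\<open>(u, v) \<mapsto> \<Lambda>(v) u - \<Lambda>(u) v\<close> (\<open>dual_levi_formula\<close>). In a principal subspace over \<tau>, \<Lambda> is prescribed on \<tau>
and arbitrary in one transversal direction, which may be chosen in D. So the pencil of skew forms is prescribed on the
hyperplane \<open>\<tau> \<inter> D\<close> of D, and its remaining row is arbitrary.

The pencil on that hyperplane is chosen degenerate (\<open>obstructing_pencil\<close>), so that whatever the free row is, the Pfaffian
has the form F R with a fixed form R and a quadratic form F. If \<open>k \<le> N - 2\<close>,
then R has k simple real roots and F is an arbitrary quadratic form, so F has to be definite. If \<open>k = N\<close>, then R has N - 2
simple real roots and F is the product of \<nu> with an arbitrary linear form, which must not vanish at (1, 0). In both
cases one affine coordinate of the principal subspace cannot vanish on the relation: without it, counting roots gives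
more than k of them, or fewer. The convex hull of a component lies on one side of the zero set of this coordinate, and so
it is not the whole principal subspace (\<open>component_hull_misses_zero\<close>).

The number of roots is compared between arbitrary bases and the standard ones by the transformation law of the Pfaffian
(\<open>pfaffian_congruence\<close>, \<open>pencil_has_root_count\<close>); the Pfaffian of the special pencils is the determinant of half of their
matrix (\<open>pfaffian_isotropic_half\<close>). On the geometric side, jets of sections are read in an arbitrary chart of the
Grassmannian bundle, which rests on the differentiability of its transition maps (\<open>gr_transition\<close>), and the
connection acts on the difference of two jets over the same point as the identity, because this difference is vertical
(\<open>vertical_iff\<close>).\<close>

section \<open>Pfaffians\<close>

abbreviation det_fn :: "nat \<Rightarrow> (nat \<Rightarrow> nat \<Rightarrow> real) \<Rightarrow> real" where
  "det_fn n a \<equiv> Determinant.det (mat n n (\<lambda>(i, j). a i j))"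

lemma det_fn_eq: "det_fn n a = (\<Sum>\<sigma> | \<sigma> permutes {..<n}. of_int (sign \<sigma>) * (\<Prod>j<n. a j (\<sigma> j)))"
proof -
  have "det_fn n a = (\<Sum>\<sigma> | \<sigma> permutes {0..<n}. of_int (sign \<sigma>) *
          (\<Prod>j=0..<n. mat n n (\<lambda>(i, j). a i j) $$ (j, \<sigma> j)))"
    by (subst det_def'[of _ n]) simp_all
  also have "\<dots> = (\<Sum>\<sigma> | \<sigma> permutes {0..<n}. of_int (sign \<sigma>) * (\<Prod>j=0..<n. a j (\<sigma> j)))"
  proof (rule sum.cong[OF refl])
    fix \<sigma> assume "\<sigma> \<in> {\<sigma>. \<sigma> permutes {0..<n}}"
    then have "\<sigma> j < n" if "j < n" for j
      using that permutes_in_image[of \<sigma> "{0..<n}" j] by auto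
    then show "of_int (sign \<sigma>) * (\<Prod>j=0..<n. mat n n (\<lambda>(i, j). a i j) $$ (j, \<sigma> j))
        = of_int (sign \<sigma>) * (\<Prod>j=0..<n. a j (\<sigma> j))" by simp
  qed
  finally show ?thesis by (simp add: atLeast0LessThan)
qed

lemma det_fn_rows_not_inj:
  assumes "f ` {..<n} \<subseteq> {..<n}" "\<not> inj_on f {..<n}"
  shows "det_fn n (\<lambda>i j. a (f i) j) = 0"
proof -
  obtain i j where ij: "i < n" "j < n" "i \<noteq> j" "f i = f j"
    using assms(2) by (auto simp: inj_on_def)
  show ?thesis
    by (rule det_identical_rows[of _ n i j]) (use ij in \<open>auto intro!: eq_vecI\<close>)
qed

lemma det_fn_rows_permute:
  assumes "p permutes {..<n}"
  shows "det_fn n (\<lambda>i j. a (p i) j) = of_int (sign p) * det_fn n a"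
proof -
  have p: "p permutes {0..<n}" using assms by (simp add: atLeast0LessThan)
  have lt: "p i < n" if "i < n" for i
    using that permutes_in_image[of p "{0..<n}" i] p by auto
  have "mat n n (\<lambda>(i, j). a (p i) j) = mat n n (\<lambda>(i, j). mat n n (\<lambda>(i, j). a i j) $$ (p i, j))"
    by (rule eq_matI) (auto simp: lt)
  then show ?thesis
    using det_permute_rows[of "mat n n (\<lambda>(i, j). a i j)" n p, OF _ p] by simp
qed

lemma prod_pairs: "(\<Prod>j<2 * N. h j) = (\<Prod>i<N. h (2 * i) * h (2 * i + 1))"
  for h :: "nat \<Rightarrow> 'a::comm_monoid_mult"
  by (induction N) (simp_all add: mult.assoc)

lemma sum_pairs: "(\<Sum>j<2 * N. h j) = (\<Sum>i<N. h (2 * i) + h (2 * i + 1))"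
  for h :: "nat \<Rightarrow> 'a::comm_monoid_add"
  by (induction N) (simp_all add: add.assoc)

text \<open>Expanding the product over the pairs of \<open>B\<^sup>t a B\<close> yields a sum over maps that pick a row of \<open>B\<close> for
  every index; the sum over the permutations is then a determinant of these rows, which
  vanishes unless the map is itself a permutation.\<close>

lemma pfaffian_congruence:
  assumes "\<And>i j. i < 2 * N \<Longrightarrow> j < 2 * N \<Longrightarrow>
      a' i j = (\<Sum>k<2 * N. \<Sum>l<2 * N. B k i * B l j * a k l)"
  shows "pfaffian N a' = det_fn (2 * N) B * pfaffian N a"
proof -
  define I where "I = {..<2 * N}"
  define G where "G = {..<N} \<rightarrow>\<^sub>E I \<times> I"
  define F :: "(nat \<Rightarrow> nat \<times> nat) \<Rightarrow> nat \<Rightarrow> nat" where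
    "F g j = (if j < 2 * N then (if even j then fst (g (j div 2)) else snd (g (j div 2))) else j)" for g j
  define S where "S = {\<sigma>. \<sigma> permutes I}"
  define gs :: "(nat \<Rightarrow> nat) \<Rightarrow> nat \<Rightarrow> nat \<times> nat" where
    "gs \<sigma> = (\<lambda>i\<in>{..<N}. (\<sigma> (2 * i), \<sigma> (2 * i + 1)))" for \<sigma>
  have lt: "\<sigma> j < 2 * N" if "\<sigma> \<in> S" "j < 2 * N" for \<sigma> j
    using that permutes_in_image[of \<sigma> I j] by (auto simp: S_def I_def)
  have F_gs: "F (gs \<sigma>) = \<sigma>" if "\<sigma> \<in> S" for \<sigma>
  proof
    fix j
    have "\<sigma> j = j" if "\<not> j < 2 * N"
      using that \<open>\<sigma> \<in> S\<close> by (auto simp: S_def I_def permutes_def)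
    then show "F (gs \<sigma>) j = \<sigma> j"
      by (cases "even j") (auto simp: F_def gs_def less_mult_imp_div_less mult.commute)
  qed
  have finG: "finite G" by (auto simp: G_def I_def intro!: finite_PiE)
  have F_img: "F g ` I \<subseteq> I" if "g \<in> G" for g
  proof
    fix y assume "y \<in> F g ` I"
    then obtain j where j: "j < 2 * N" "y = F g j" by (auto simp: I_def)
    then have "g (j div 2) \<in> I \<times> I" using that by (auto simp: G_def PiE_def Pi_def)
    then show "y \<in> I" using j by (auto simp: F_def)
  qed
  have gsG: "gs \<sigma> \<in> G" if "\<sigma> \<in> S" for \<sigma>
    using lt[OF that] by (auto simp: gs_def G_def I_def)
  have gs_img: "gs ` S = {g \<in> G. inj_on (F g) I}"
  proof (intro equalityI subsetI)
    fix g assume "g \<in> gs ` S"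
    then show "g \<in> {g \<in> G. inj_on (F g) I}"
      using gsG F_gs by (auto simp: S_def intro: permutes_inj_on)
  next
    fix g assume g: "g \<in> {g \<in> G. inj_on (F g) I}"
    then have "F g ` I = I"
      by (intro endo_inj_surj F_img) (auto simp: I_def)
    then have "bij_betw (F g) I I" using g by (simp add: bij_betw_def)
    then have "F g permutes I"
      by (rule bij_imp_permutes) (auto simp: F_def I_def)
    moreover have "gs (F g) = g"
    proof
      fix i
      show "gs (F g) i = g i"
        using g by (auto simp: gs_def F_def G_def PiE_def extensional_def)
    qed
    ultimately show "g \<in> gs ` S" by (metis S_def image_eqI mem_Collect_eq)
  qed
  have inj_gs: "inj_on gs S" by (metis F_gs inj_onI)
  have term_eq: "(\<Prod>i<N. a' (\<sigma> (2 * i)) (\<sigma> (2 * i + 1))) =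
      (\<Sum>g\<in>G. (\<Prod>i<N. a (fst (g i)) (snd (g i))) * (\<Prod>j<2 * N. B (F g j) (\<sigma> j)))"
    if \<sigma>: "\<sigma> \<in> S" for \<sigma>
  proof -
    have "(\<Prod>i<N. a' (\<sigma> (2 * i)) (\<sigma> (2 * i + 1))) =
       (\<Prod>i<N. \<Sum>kl\<in>I \<times> I. B (fst kl) (\<sigma> (2 * i)) * B (snd kl) (\<sigma> (2 * i + 1)) * a (fst kl) (snd kl))"
    proof (rule prod.cong[OF refl])
      fix i assume "i \<in> {..<N}"
      then have "\<sigma> (2 * i) < 2 * N" "\<sigma> (2 * i + 1) < 2 * N" using lt[OF \<sigma>] by auto
      then show "a' (\<sigma> (2 * i)) (\<sigma> (2 * i + 1)) = (\<Sum>kl\<in>I \<times> I.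
          B (fst kl) (\<sigma> (2 * i)) * B (snd kl) (\<sigma> (2 * i + 1)) * a (fst kl) (snd kl))"
        by (simp add: assms sum.cartesian_product I_def split_def)
    qed
    also have "\<dots> = (\<Sum>g\<in>G. \<Prod>i<N. B (fst (g i)) (\<sigma> (2 * i)) * B (snd (g i)) (\<sigma> (2 * i + 1)) *
                       a (fst (g i)) (snd (g i)))"
      unfolding G_def by (rule prod_sum_PiE) (auto simp: I_def)
    also have "\<dots> = (\<Sum>g\<in>G. (\<Prod>i<N. a (fst (g i)) (snd (g i))) * (\<Prod>j<2 * N. B (F g j) (\<sigma> j)))"
    proof (rule sum.cong[OF refl])
      fix g
      have "(\<Prod>j<2 * N. B (F g j) (\<sigma> j)) =
          (\<Prod>i<N. B (fst (g i)) (\<sigma> (2 * i)) * B (snd (g i)) (\<sigma> (2 * i + 1)))"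
        unfolding prod_pairs by (rule prod.cong) (auto simp: F_def)
      then show "(\<Prod>i<N. B (fst (g i)) (\<sigma> (2 * i)) * B (snd (g i)) (\<sigma> (2 * i + 1)) *
            a (fst (g i)) (snd (g i))) =
          (\<Prod>i<N. a (fst (g i)) (snd (g i))) * (\<Prod>j<2 * N. B (F g j) (\<sigma> j))"
        by (simp add: prod.distrib mult_ac)
    qed
    finally show ?thesis .
  qed
  have "(\<Sum>\<sigma>\<in>S. of_int (sign \<sigma>) * (\<Prod>i<N. a' (\<sigma> (2 * i)) (\<sigma> (2 * i + 1)))) =
     (\<Sum>\<sigma>\<in>S. \<Sum>g\<in>G. (\<Prod>i<N. a (fst (g i)) (snd (g i))) *
        (of_int (sign \<sigma>) * (\<Prod>j<2 * N. B (F g j) (\<sigma> j))))"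
    by (rule sum.cong[OF refl], subst term_eq) (simp_all add: sum_distrib_left mult.left_commute)
  also have "\<dots> = (\<Sum>g\<in>G. (\<Prod>i<N. a (fst (g i)) (snd (g i))) * det_fn (2 * N) (\<lambda>i j. B (F g i) j))"
    by (subst sum.swap) (simp add: det_fn_eq S_def I_def sum_distrib_left)
  also have "\<dots> = (\<Sum>g\<in>gs ` S. (\<Prod>i<N. a (fst (g i)) (snd (g i))) * det_fn (2 * N) (\<lambda>i j. B (F g i) j))"
  proof (rule sum.mono_neutral_right[OF finG])
    show "gs ` S \<subseteq> G" using gsG by auto
    show "\<forall>g\<in>G - gs ` S. (\<Prod>i<N. a (fst (g i)) (snd (g i))) * det_fn (2 * N) (\<lambda>i j. B (F g i) j) = 0"
    proof
      fix g assume g: "g \<in> G - gs ` S"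
      then have "\<not> inj_on (F g) {..<2 * N}" "F g ` {..<2 * N} \<subseteq> {..<2 * N}"
        using gs_img F_img by (auto simp: I_def)
      then have "det_fn (2 * N) (\<lambda>i j. B (F g i) j) = 0"
        using det_fn_rows_not_inj by blast
      then show "(\<Prod>i<N. a (fst (g i)) (snd (g i))) * det_fn (2 * N) (\<lambda>i j. B (F g i) j) = 0"
        by simp
    qed
  qed
  also have "\<dots> = (\<Sum>\<sigma>\<in>S. (\<Prod>i<N. a (\<sigma> (2 * i)) (\<sigma> (2 * i + 1))) * det_fn (2 * N) (\<lambda>i j. B (\<sigma> i) j))"
    by (subst sum.reindex[OF inj_gs]) (rule sum.cong, simp_all add: F_gs, simp add: gs_def)
  also have "\<dots> = (\<Sum>\<sigma>\<in>S. det_fn (2 * N) B *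
       (of_int (sign \<sigma>) * (\<Prod>i<N. a (\<sigma> (2 * i)) (\<sigma> (2 * i + 1)))))"
    by (rule sum.cong) (simp_all add: S_def I_def det_fn_rows_permute mult_ac)
  finally show ?thesis
    by (simp add: pfaffian_def S_def I_def sum_distrib_left)
qed

definition paired_skew :: "nat \<Rightarrow> nat \<Rightarrow> real" where
  "paired_skew k l = (if even k \<and> l = k + 1 then 1 else if even l \<and> k = l + 1 then -1 else 0)"

lemma paired_skew_nonzeroD:
  "paired_skew k l \<noteq> 0 \<Longrightarrow> even k \<and> l = k + 1 \<or> even l \<and> k = l + 1"
  by (auto simp: paired_skew_def split: if_splits)

lemma paired_skew_swap: "paired_skew l k = - paired_skew k l"
  by (auto simp: paired_skew_def)

lemma paired_skew_transpose_pairs: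
  assumes "even a" "even b"
  defines "t \<equiv> Transposition.transpose a b \<circ> Transposition.transpose (a + 1) (b + 1)"
  shows "paired_skew (t k) (t l) = paired_skew k l"
proof -
  have ne: "a \<noteq> b + 1" "b \<noteq> a + 1" using assms by auto
  have t: "t m = (if m = a then b else if m = a + 1 then b + 1 else if m = b then a
             else if m = b + 1 then a + 1 else m)" for m
    using ne by (auto simp: t_def Transposition.transpose_def)
  have even_t: "even (t m) = even m" for m using assms(1,2) by (auto simp: t)
  have inj: "t m = t n \<longleftrightarrow> m = n" for m n
    unfolding t_def by (metis comp_apply transpose_involutory)
  have t_Suc: "t (m + 1) = t m + 1" if "even m" for m
    using that assms(1,2) by (auto simp: t)
  have "t n = t m + 1 \<longleftrightarrow> n = m + 1" if "even m" for m n
    using inj[of n "m + 1"] t_Suc[OF that] by simp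
  then show ?thesis
    unfolding paired_skew_def even_t by (simp cong: conj_cong)
qed

text \<open>A permutation that maps each pair \<open>{2 * i, 2 * i + 1}\<close> onto a pair is brought to the identity by moving
whole pairs, which is even, and by flipping pairs, where sign and product change together. The induction moves the last
pair home.\<close>

lemma sign_pair_preserving:
  assumes "\<sigma> permutes {..<2 * N}" "\<And>i. i < N \<Longrightarrow> paired_skew (\<sigma> (2 * i)) (\<sigma> (2 * i + 1)) \<noteq> 0"
  shows "of_int (sign \<sigma>) * (\<Prod>i<N. paired_skew (\<sigma> (2 * i)) (\<sigma> (2 * i + 1))) = 1"
  using assms
proof (induction N arbitrary: \<sigma>)
  case 0
  then have "\<sigma> = id" by (simp add: permutes_empty)
  then show ?case by (simp add: sign_id)
next
  case (Suc N)
  have ordered: "of_int (sign \<sigma>) * (\<Prod>i<Suc N. paired_skew (\<sigma> (2 * i)) (\<sigma> (2 * i + 1))) = 1"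
    if \<sigma>: "\<sigma> permutes {..<2 * Suc N}"
      and nz: "\<And>i. i < Suc N \<Longrightarrow> paired_skew (\<sigma> (2 * i)) (\<sigma> (2 * i + 1)) \<noteq> 0"
      and a: "even (\<sigma> (2 * N))" "\<sigma> (2 * N + 1) = \<sigma> (2 * N) + 1" for \<sigma>
  proof -
    define a where "a = \<sigma> (2 * N)"
    define t where "t = Transposition.transpose a (2 * N) \<circ> Transposition.transpose (a + 1) (2 * N + 1)"
    define \<rho> where "\<rho> = t \<circ> \<sigma>"
    have lt: "a < 2 * Suc N" "a + 1 < 2 * Suc N"
      using permutes_in_image[OF \<sigma>, of "2 * N"] permutes_in_image[OF \<sigma>, of "2 * N + 1"] a
      by (auto simp: a_def)
    have t_perm: "t permutes {..<2 * Suc N}"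
      unfolding t_def by (intro permutes_compose permutes_swap_id) (use lt in auto)
    have sign_t: "sign t = 1"
      unfolding t_def
      by (subst sign_compose) (auto simp: sign_swap_id permutation_swap_id)
    have \<rho>_perm: "\<rho> permutes {..<2 * Suc N}"
      unfolding \<rho>_def by (rule permutes_compose[OF \<sigma> t_perm])
    have odd_ne: "Suc (2 * N) \<noteq> \<sigma> (2 * N)" using a(1) by (metis even_Suc dvd_triv_left)
    have fix_last: "\<rho> (2 * N) = 2 * N" "\<rho> (2 * N + 1) = 2 * N + 1"
      using a odd_ne by (auto simp: \<rho>_def t_def a_def Transposition.transpose_def)
    have \<rho>: "\<rho> permutes {..<2 * N}"
    proof (rule permutes_superset[OF \<rho>_perm])
      fix x assume "x \<in> {..<2 * Suc N} - {..<2 * N}"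
      then have "x = 2 * N \<or> x = 2 * N + 1" by auto
      then show "\<rho> x = x" using fix_last by auto
    qed
    have skew_\<rho>: "paired_skew (\<rho> k) (\<rho> l) = paired_skew (\<sigma> k) (\<sigma> l)" for k l
      unfolding \<rho>_def t_def o_apply
      using paired_skew_transpose_pairs[of a "2 * N"] a by (simp add: a_def)
    have "of_int (sign \<rho>) * (\<Prod>i<N. paired_skew (\<rho> (2 * i)) (\<rho> (2 * i + 1))) = 1"
      by (rule Suc.IH[OF \<rho>]) (use nz in \<open>simp add: skew_\<rho>\<close>)
    moreover have "sign \<rho> = sign \<sigma>"
      unfolding \<rho>_def using sign_compose[of t \<sigma>] sign_t t_perm \<sigma>
      by (metis finite_lessThan mult_1 permutation_permutes)
    moreover have "paired_skew (\<sigma> (2 * N)) (\<sigma> (2 * N + 1)) = 1"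
      using a by (simp add: paired_skew_def)
    ultimately show ?thesis by (simp add: skew_\<rho>)
  qed
  from Suc.prems(2)[of N] consider
      "even (\<sigma> (2 * N))" "\<sigma> (2 * N + 1) = \<sigma> (2 * N) + 1"
    | "even (\<sigma> (2 * N + 1))" "\<sigma> (2 * N) = \<sigma> (2 * N + 1) + 1"
    using paired_skew_nonzeroD by (metis lessI)
  then show ?case
  proof cases
    case 1
    show ?thesis by (rule ordered[OF Suc.prems(1) Suc.prems(2) 1])
  next
    case 2
    define s where "s = Transposition.transpose (2 * N) (2 * N + 1)"
    have s_perm: "s permutes {..<2 * Suc N}"
      unfolding s_def by (rule permutes_swap_id) auto
    have s_fix: "s (2 * i) = 2 * i" "s (2 * i + 1) = 2 * i + 1" if "i < N" for i
      using that by (auto simp: s_def Transposition.transpose_def)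
    have s_last: "s (2 * N) = 2 * N + 1" "s (2 * N + 1) = 2 * N"
      by (auto simp: s_def)
    have "of_int (sign (\<sigma> \<circ> s)) *
        (\<Prod>i<Suc N. paired_skew ((\<sigma> \<circ> s) (2 * i)) ((\<sigma> \<circ> s) (2 * i + 1))) = 1"
    proof (rule ordered)
      show "\<sigma> \<circ> s permutes {..<2 * Suc N}" by (rule permutes_compose[OF s_perm Suc.prems(1)])
      show "paired_skew ((\<sigma> \<circ> s) (2 * i)) ((\<sigma> \<circ> s) (2 * i + 1)) \<noteq> 0" if "i < Suc N" for i
      proof (cases "i = N")
        case True
        then show ?thesis using Suc.prems(2)[of N] s_last by (simp add: paired_skew_swap[of "\<sigma> (Suc (2 * N))"])
      next
        case False
        then show ?thesis using Suc.prems(2)[of i] s_fix[of i] that by simp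
      qed
    qed (use 2 s_last in auto)
    moreover have "sign (\<sigma> \<circ> s) = - sign \<sigma>"
    proof -
      have "sign (\<sigma> \<circ> s) = sign \<sigma> * sign s"
        using Suc.prems(1) s_perm by (metis finite_lessThan permutation_permutes sign_compose)
      then show ?thesis by (simp add: s_def sign_swap_id)
    qed
    ultimately show ?thesis
      using s_fix s_last by (simp add: paired_skew_swap[of "\<sigma> (Suc (2 * N))"])
  qed
qed

text \<open>Every nonzero term of the defining sum is 1. Only the sign of the value matters here, so it is not
normalised.\<close>

lemma pfaffian_paired_skew_pos: "pfaffian N paired_skew > 0"
proof -
  let ?h = "\<lambda>\<sigma>. of_int (sign \<sigma>) * (\<Prod>i<N. paired_skew (\<sigma> (2 * i)) (\<sigma> (2 * i + 1)))"
  have "?h \<sigma> \<ge> 0" if "\<sigma> permutes {..<2 * N}" for \<sigma>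
  proof (cases "\<forall>i<N. paired_skew (\<sigma> (2 * i)) (\<sigma> (2 * i + 1)) \<noteq> 0")
    case True
    then show ?thesis using sign_pair_preserving[OF that] by simp
  next
    case False
    then have "(\<Prod>i<N. paired_skew (\<sigma> (2 * i)) (\<sigma> (2 * i + 1))) = 0" by auto
    then show ?thesis by (simp only: mult_zero_right order_refl)
  qed
  moreover have "?h id = 1"
    by (simp add: paired_skew_def sign_id)
  ultimately have "sum ?h {\<sigma>. \<sigma> permutes {..<2 * N}} > 0"
    by (intro sum_pos2[where i = id]) (auto simp: permutes_id finite_permutations)
  then show ?thesis by (simp add: pfaffian_def)
qed

definition split_skew :: "nat \<Rightarrow> nat \<Rightarrow> nat \<Rightarrow> real" where
  "split_skew N k l = (if k < N \<and> l = N + k then 1 else if l < N \<and> k = N + l then -1 else 0)"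

lemma pfaffian_split_skew_nonzero: "pfaffian N (split_skew N) \<noteq> 0"
proof -
  define z where "z k = (if even k then k div 2 else N + k div 2)" for k
  define B where "B i j = (if i = z j then 1 else 0 :: real)" for i j
  have z: "z k < 2 * N" if "k < 2 * N" for k
  proof -
    have "k div 2 < N" using that by (simp add: less_mult_imp_div_less mult.commute)
    then show ?thesis by (simp add: z_def)
  qed
  have "paired_skew i j = (\<Sum>k<2 * N. \<Sum>l<2 * N. B k i * B l j * split_skew N k l)"
    if ij: "i < 2 * N" "j < 2 * N" for i j
  proof -
    have inner: "(\<Sum>l<2 * N. B k i * B l j * split_skew N k l) = B k i * split_skew N k (z j)" for k
    proof -
      have "(\<Sum>l<2 * N. B k i * B l j * split_skew N k l) =
          (\<Sum>l<2 * N. if l = z j then B k i * split_skew N k l else 0)"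
        by (rule sum.cong) (simp_all add: B_def[of _ j])
      then show ?thesis using z ij by (simp add: sum.delta)
    qed
    have "(\<Sum>k<2 * N. \<Sum>l<2 * N. B k i * B l j * split_skew N k l) =
        (\<Sum>k<2 * N. if k = z i then split_skew N k (z j) else 0)"
      unfolding inner by (rule sum.cong) (simp_all add: B_def)
    also have "\<dots> = split_skew N (z i) (z j)" using z ij by (simp add: sum.delta)
    also have "\<dots> = paired_skew i j"
    proof -
      obtain p q where "i = 2 * p \<or> i = 2 * p + 1" "j = 2 * q \<or> j = 2 * q + 1"
        by (metis oddE evenE)
      then show ?thesis
        using ij unfolding split_skew_def paired_skew_def z_def
        by (elim disjE) (simp_all, presburger+)
    qed
    finally show ?thesis by simp
  qed
  then have "pfaffian N paired_skew = det_fn (2 * N) B * pfaffian N (split_skew N)"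
    by (rule pfaffian_congruence)
  then show ?thesis using pfaffian_paired_skew_pos[of N] by auto
qed

section \<open>Pencils of determinants\<close>

lemma sum_lessThan_add: "(\<Sum>k<m + n. f k) = (\<Sum>k<m. f k) + (\<Sum>k<n. f (m + k))"
  for f :: "nat \<Rightarrow> 'a::comm_monoid_add"
  by (induction n) (simp_all add: add.assoc)

lemma sum_split_skew:
  "(\<Sum>k<2 * N. \<Sum>l<2 * N. x k * y l * split_skew N k l) =
   (\<Sum>k<N. x k * y (N + k) - x (N + k) * y k)"
proof -
  have 1: "(\<Sum>l<N + N. x k * y l * split_skew N k l) = x k * y (N + k)" if "k < N" for k
  proof -
    have "(\<Sum>l<N + N. x k * y l * split_skew N k l) =
        (\<Sum>l<N + N. if l = N + k then x k * y l else 0)"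
      using that by (intro sum.cong) (auto simp: split_skew_def)
    then show ?thesis using that by (simp add: sum.delta)
  qed
  have 2: "(\<Sum>l<N + N. x (N + k) * y l * split_skew N (N + k) l) = - (x (N + k) * y k)"
    if "k < N" for k
  proof -
    have "(\<Sum>l<N + N. x (N + k) * y l * split_skew N (N + k) l) =
        (\<Sum>l<N + N. if l = k then - (x (N + k) * y l) else 0)"
      using that by (intro sum.cong) (auto simp: split_skew_def)
    then show ?thesis using that by (simp add: sum.delta)
  qed
  have "(\<Sum>k<N + N. \<Sum>l<N + N. x k * y l * split_skew N k l) =
      (\<Sum>k<N. \<Sum>l<N + N. x k * y l * split_skew N k l) +
      (\<Sum>k<N. \<Sum>l<N + N. x (N + k) * y l * split_skew N (N + k) l)"
    by (rule sum_lessThan_add)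
  then show ?thesis
    by (simp add: mult_2 1 2 sum_subtractf sum_negf)
qed

lemma det_fn_block:
  assumes "\<And>i j. i < n \<Longrightarrow> j < r \<Longrightarrow> a (r + i) j = 0"
  shows "det_fn (r + n) a = det_fn r a * det_fn n (\<lambda>i j. a (r + i) (r + j))"
proof -
  have "mat (r + n) (r + n) (\<lambda>(i, j). a i j) =
      four_block_mat (mat r r (\<lambda>(i, j). a i j)) (mat r n (\<lambda>(i, j). a i (r + j)))
        (0\<^sub>m n r) (mat n n (\<lambda>(i, j). a (r + i) (r + j)))"
  proof (rule eq_matI)
    fix i j assume "i < dim_row (four_block_mat (mat r r (\<lambda>(i, j). a i j)) (mat r n (\<lambda>(i, j). a i (r + j)))
        (0\<^sub>m n r) (mat n n (\<lambda>(i, j). a (r + i) (r + j))))"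
      "j < dim_col (four_block_mat (mat r r (\<lambda>(i, j). a i j)) (mat r n (\<lambda>(i, j). a i (r + j)))
        (0\<^sub>m n r) (mat n n (\<lambda>(i, j). a (r + i) (r + j))))"
    then have "i < r + n" "j < r + n" by auto
    then show "mat (r + n) (r + n) (\<lambda>(i, j). a i j) $$ (i, j) =
        four_block_mat (mat r r (\<lambda>(i, j). a i j)) (mat r n (\<lambda>(i, j). a i (r + j)))
          (0\<^sub>m n r) (mat n n (\<lambda>(i, j). a (r + i) (r + j))) $$ (i, j)"
      using assms[of "i - r" j] by (auto simp: not_less)
  qed auto
  then show ?thesis
    using det_four_block_mat_lower_left_zero[of "mat r r (\<lambda>(i, j). a i j)" r
        "mat r n (\<lambda>(i, j). a i (r + j))" n "0\<^sub>m n r" "mat n n (\<lambda>(i, j). a (r + i) (r + j))"]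
    by simp
qed

lemma det_fn_1: "det_fn (Suc 0) a = a 0 0"
  by (simp add: det_single[of _] )

lemma det_fn_2: "det_fn 2 a = a 0 0 * a 1 1 - a 0 1 * a 1 0"
proof -
  have f: "finite {1::nat}" "(0::nat) \<notin> {1}" by auto
  have s: "{..<2} = {0, 1::nat}" by auto
  show ?thesis
    unfolding det_fn_eq s unfolding sum_over_permutations_insert[OF f] unfolding permutes_sing
    by (simp add: sign_swap_id sign_id)
qed

text \<open>With a totally isotropic half of the basis, a pair inside the other half forces, by counting, a
  pair inside the isotropic one. Hence the values on the other half do not matter, and the
  remaining matrix is congruent to the standard one.\<close>

lemma pfaffian_isotropic_half:
  assumes skew: "\<And>i j. i < 2 * N \<Longrightarrow> j < 2 * N \<Longrightarrow> a j i = - a i j"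
    and zero: "\<And>i j. i < N \<Longrightarrow> j < N \<Longrightarrow> a (N + i) (N + j) = 0"
  shows "pfaffian N a = pfaffian N (split_skew N) * det_fn N (\<lambda>i j. a i (N + j))"
proof -
  define a' where "a' i j = (if i < N \<and> j < N then 0 else a i j)" for i j
  have zero': "a i j = 0" if "\<not> i < N" "\<not> j < N" "i < 2 * N" "j < 2 * N" for i j
    using zero[of "i - N" "j - N"] that by auto
  have prod_eq: "(\<Prod>i<N. a (\<sigma> (2 * i)) (\<sigma> (2 * i + 1))) = (\<Prod>i<N. a' (\<sigma> (2 * i)) (\<sigma> (2 * i + 1)))"
    if \<sigma>: "\<sigma> permutes {..<2 * N}" for \<sigma>
  proof -
    have lt: "\<sigma> j < 2 * N" if "j < 2 * N" for j
      using permutes_in_image[OF \<sigma>, of j] that by auto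
    show ?thesis
    proof (cases "\<exists>i<N. \<not> \<sigma> (2 * i) < N \<and> \<not> \<sigma> (2 * i + 1) < N")
      case True
      then obtain i where i: "i < N" "\<not> \<sigma> (2 * i) < N" "\<not> \<sigma> (2 * i + 1) < N" by auto
      then have "a (\<sigma> (2 * i)) (\<sigma> (2 * i + 1)) = 0"
        using lt[of "2 * i"] lt[of "2 * i + 1"] by (intro zero') auto
      moreover from this have "a' (\<sigma> (2 * i)) (\<sigma> (2 * i + 1)) = 0" by (simp add: a'_def)
      ultimately have "(\<Prod>i<N. a (\<sigma> (2 * i)) (\<sigma> (2 * i + 1))) = 0"
        "(\<Prod>i<N. a' (\<sigma> (2 * i)) (\<sigma> (2 * i + 1))) = 0"
        using i(1) by (metis finite_lessThan lessThan_iff prod_zero)+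
      then show ?thesis by (simp only:)
    next
      case False
      define c where "c j = (if j < N then 1 else 0 :: nat)" for j
      have "(\<Sum>i<N. c (\<sigma> (2 * i)) + c (\<sigma> (2 * i + 1))) = (\<Sum>j<2 * N. c (\<sigma> j))"
        by (simp add: sum_pairs)
      also have "\<dots> = (\<Sum>j<2 * N. c j)"
        using sum.permute[OF \<sigma>, of c] by (simp add: o_def)
      also have "\<dots> = N" unfolding mult_2 sum_lessThan_add by (simp add: c_def)
      finally have total: "(\<Sum>i<N. c (\<sigma> (2 * i)) + c (\<sigma> (2 * i + 1))) = N" .
      have "\<not> (\<sigma> (2 * i) < N \<and> \<sigma> (2 * i + 1) < N)" if "i < N" for i
      proof
        assume "\<sigma> (2 * i) < N \<and> \<sigma> (2 * i + 1) < N"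
        then have "(\<Sum>i<N. 1) < (\<Sum>i<N. c (\<sigma> (2 * i)) + c (\<sigma> (2 * i + 1)))"
          using False that by (intro sum_strict_mono_ex1) (auto simp: c_def)
        then show False using total by simp
      qed
      then show ?thesis by (intro prod.cong) (auto simp: a'_def)
    qed
  qed
  define B where "B i j = (if i < N then if j = i then 1 else 0
      else if j < N then 0 else a (i - N) j)" for i j
  have "a' i j = (\<Sum>k<2 * N. \<Sum>l<2 * N. B k i * B l j * split_skew N k l)"
    if ij: "i < 2 * N" "j < 2 * N" for i j
  proof -
    have "(\<Sum>k<N. B k i * B (N + k) j) = (if i < N then B (N + i) j else 0)" if "i < 2 * N" for i j
    proof -
      have "(\<Sum>k<N. B k i * B (N + k) j) = (\<Sum>k<N. if k = i then B (N + k) j else 0)"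
        by (rule sum.cong) (auto simp: B_def)
      then show ?thesis by (simp add: sum.delta)
    qed
    from this[of i j] this[of j i]
    have "(\<Sum>k<2 * N. \<Sum>l<2 * N. B k i * B l j * split_skew N k l) =
        (if i < N then B (N + i) j else 0) - (if j < N then B (N + j) i else 0)"
      using ij unfolding sum_split_skew sum_subtractf by (simp add: mult.commute)
    then show ?thesis
      using ij zero'[of i j] skew[of i j] by (auto simp: B_def a'_def)
  qed
  then have "pfaffian N a' = det_fn (2 * N) B * pfaffian N (split_skew N)"
    by (rule pfaffian_congruence)
  moreover have "det_fn (2 * N) B = det_fn N (\<lambda>i j. a i (N + j))"
  proof -
    have "det_fn (N + N) B = det_fn N B * det_fn N (\<lambda>i j. B (N + i) (N + j))"
      by (rule det_fn_block) (auto simp: B_def)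
    moreover have "mat N N (\<lambda>(i, j). B i j) = 1\<^sub>m N"
      by (rule eq_matI) (auto simp: B_def)
    moreover have "mat N N (\<lambda>(i, j). B (N + i) (N + j)) = mat N N (\<lambda>(i, j). a i (N + j))"
      by (rule eq_matI) (auto simp: B_def)
    ultimately show ?thesis by (simp add: mult_2)
  qed
  moreover have "pfaffian N a = pfaffian N a'"
    unfolding pfaffian_def
    by (intro arg_cong2[where f = "(/)"] sum.cong refl arg_cong2[where f = "(*)"] prod_eq) simp
  ultimately show ?thesis by simp
qed

text \<open>A diagonal matrix gives the linear factors, and the rotation-dilation blocks with rows \<open>(\<mu>, \<nu>)\<close> and
\<open>(- \<nu>, \<mu>)\<close> give the definite ones.\<close>

lemma det_pencil_exists:
  "\<exists>U V. \<forall>\<mu> \<nu>. det_fn (k + 2 * m) (\<lambda>i j. \<mu> * U i j + \<nu> * V i j) =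
     (\<Prod>i<k. \<nu> - real (Suc i) * \<mu>) * (\<mu>\<^sup>2 + \<nu>\<^sup>2) ^ m"
proof (induction m)
  case 0
  show ?case
  proof (induction k)
    case 0
    show ?case by (simp add: det_dim_zero)
  next
    case (Suc k)
    then obtain U V where UV: "\<And>\<mu> \<nu>. det_fn k (\<lambda>i j. \<mu> * U i j + \<nu> * V i j) =
        (\<Prod>i<k. \<nu> - real (Suc i) * \<mu>)" by auto
    let ?U = "\<lambda>i j. if i = 0 then if j = 0 then - real (Suc k) else 0 else if j = 0 then 0 else U (i - 1) (j - 1)"
    let ?V = "\<lambda>i j. if i = 0 then if j = 0 then 1 else 0 else if j = 0 then 0 else V (i - 1) (j - 1)"
    have "det_fn (Suc k) (\<lambda>i j. \<mu> * ?U i j + \<nu> * ?V i j) = (\<Prod>i<Suc k. \<nu> - real (Suc i) * \<mu>)" for \<mu> \<nu>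
      using det_fn_block[of k 1 "\<lambda>i j. \<mu> * ?U i j + \<nu> * ?V i j"] UV[of \<mu> \<nu>]
      by (simp add: det_fn_1 algebra_simps)
    then show ?case by (intro exI[of _ ?U] exI[of _ ?V]) simp
  qed
next
  case (Suc m)
  then obtain U V where UV: "\<And>\<mu> \<nu>. det_fn (k + 2 * m) (\<lambda>i j. \<mu> * U i j + \<nu> * V i j) =
        (\<Prod>i<k. \<nu> - real (Suc i) * \<mu>) * (\<mu>\<^sup>2 + \<nu>\<^sup>2) ^ m" by auto
  let ?U = "\<lambda>i j. if i < 2 \<or> j < 2 then if i = j then 1 else 0 else U (i - 2) (j - 2)"
  let ?V = "\<lambda>i j. if i < 2 \<or> j < 2 then if i = 0 \<and> j = 1 then 1 else if i = 1 \<and> j = 0 then -1 else 0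
     else V (i - 2) (j - 2)"
  have block: "det_fn (k + 2 * Suc m) (\<lambda>i j. \<mu> * ?U i j + \<nu> * ?V i j) =
      (\<Prod>i<k. \<nu> - real (Suc i) * \<mu>) * (\<mu>\<^sup>2 + \<nu>\<^sup>2) ^ Suc m" for \<mu> \<nu>
    using det_fn_block[of "k + 2 * m" 2 "\<lambda>i j. \<mu> * ?U i j + \<nu> * ?V i j"] UV[of \<mu> \<nu>]
    by (simp add: det_fn_2 power2_eq_square)
  show ?case by (rule exI[of _ ?U], rule exI[of _ ?V]) (intro allI block)
qed

section \<open>Real roots of binary forms\<close>

text \<open>The obstruction only needs the number of roots; simplicity is needed once, for the pencil that shows the
relation to be nonempty.\<close>

definition has_root_count :: "nat \<Rightarrow> (real \<Rightarrow> real \<Rightarrow> real) \<Rightarrow> bool" where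
  "has_root_count k P \<longleftrightarrow> (\<exists>\<mu> \<nu>. P \<mu> \<nu> \<noteq> 0) \<and> finite (real_roots P) \<and> card (real_roots P) = k"

lemma has_root_count_if_simple: "exactly_simple_real_roots N k P \<Longrightarrow> has_root_count k P"
  by (auto simp: exactly_simple_real_roots_def has_root_count_def)

lemma binary_form_const: "binary_form 0 (\<lambda>\<mu> \<nu>. c)"
  unfolding binary_form_def by (rule exI[of _ "\<lambda>_. c"]) simp

lemma binary_form_add:
  "binary_form d P \<Longrightarrow> binary_form d Q \<Longrightarrow> binary_form d (\<lambda>\<mu> \<nu>. P \<mu> \<nu> + Q \<mu> \<nu>)"
  unfolding binary_form_def
proof (elim exE)
  fix c e assume "\<forall>\<mu> \<nu>. P \<mu> \<nu> = (\<Sum>j\<le>d. c j * \<mu> ^ j * \<nu> ^ (d - j))"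
    "\<forall>\<mu> \<nu>. Q \<mu> \<nu> = (\<Sum>j\<le>d. e j * \<mu> ^ j * \<nu> ^ (d - j))"
  then show "\<exists>c. \<forall>\<mu> \<nu>. P \<mu> \<nu> + Q \<mu> \<nu> = (\<Sum>j\<le>d. c j * \<mu> ^ j * \<nu> ^ (d - j))"
    by (intro exI[of _ "\<lambda>j. c j + e j"]) (simp add: sum.distrib algebra_simps)
qed

lemma binary_form_mult_fst:
  assumes "binary_form d P" shows "binary_form (Suc d) (\<lambda>\<mu> \<nu>. t * \<mu> * P \<mu> \<nu>)"
proof -
  obtain c where c: "\<And>\<mu> \<nu>. P \<mu> \<nu> = (\<Sum>j\<le>d. c j * \<mu> ^ j * \<nu> ^ (d - j))"
    using assms by (auto simp: binary_form_def)
  show ?thesis unfolding binary_form_def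
    by (rule exI[of _ "\<lambda>j. if j = 0 then 0 else t * c (j - 1)"])
      (simp add: c sum.atMost_Suc_shift sum_distrib_left mult_ac del: sum.atMost_Suc)
qed

lemma binary_form_mult_snd:
  assumes "binary_form d P" shows "binary_form (Suc d) (\<lambda>\<mu> \<nu>. t * \<nu> * P \<mu> \<nu>)"
proof -
  obtain c where c: "\<And>\<mu> \<nu>. P \<mu> \<nu> = (\<Sum>j\<le>d. c j * \<mu> ^ j * \<nu> ^ (d - j))"
    using assms by (auto simp: binary_form_def)
  show ?thesis unfolding binary_form_def
    by (rule exI[of _ "\<lambda>j. if j = Suc d then 0 else t * c j"])
      (auto simp: c sum_distrib_left Suc_diff_le mult_ac intro!: sum.cong)
qed

lemma binary_form_mult_linear:
  assumes "binary_form d P" shows "binary_form (Suc d) (\<lambda>\<mu> \<nu>. (b * \<mu> - a * \<nu>) * P \<mu> \<nu>)"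
  using binary_form_add[OF binary_form_mult_fst[OF assms, of b] binary_form_mult_snd[OF assms, of "- a"]]
  by (simp add: algebra_simps)

lemma binary_form_prod_linear:
  assumes "binary_form d P" "finite I"
  shows "binary_form (card I + d) (\<lambda>\<mu> \<nu>. (\<Prod>i\<in>I. b i * \<mu> - a i * \<nu>) * P \<mu> \<nu>)"
  using assms(2)
proof induction
  case empty
  then show ?case using assms(1) by simp
next
  case (insert i I)
  then show ?case using binary_form_mult_linear[OF insert.IH, of "b i" "a i"] by (simp add: mult.assoc)
qed

lemma binary_form_definite_power: "binary_form (2 * m) (\<lambda>\<mu> \<nu>. c * (\<mu>\<^sup>2 + \<nu>\<^sup>2) ^ m)"
proof (induction m)
  case 0
  show ?case by (simp add: binary_form_const)
next
  case (Suc m)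
  have "binary_form (Suc (Suc (2 * m)))
     (\<lambda>\<mu> \<nu>. 1 * \<mu> * (1 * \<mu> * (c * (\<mu>\<^sup>2 + \<nu>\<^sup>2) ^ m)) + 1 * \<nu> * (1 * \<nu> * (c * (\<mu>\<^sup>2 + \<nu>\<^sup>2) ^ m)))"
    by (intro binary_form_add binary_form_mult_fst binary_form_mult_snd Suc.IH)
  then show ?case by (simp add: algebra_simps power2_eq_square)
qed

lemma line_eq_span:
  fixes l :: "(real \<times> real) set"
  assumes "subspace l" "dim l = 1" shows "\<exists>v. v \<noteq> 0 \<and> l = span {v}"
proof -
  obtain B where B: "B \<subseteq> l" "independent B" "l \<subseteq> span B" "card B = dim l"
    using basis_exists by blast
  then obtain v where v: "B = {v}" using assms(2) by (metis card_1_singletonE One_nat_def)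
  with B have "v \<noteq> 0" by (auto simp: dependent_zero)
  moreover have "l = span {v}"
    using B v assms(1) by (metis span_minimal subset_antisym)
  ultimately show ?thesis by blast
qed

lemma span_line: "span {(a, b)} = {(t * a, t * b) | t. True}" for a b :: real
  by (auto simp: span_singleton)

lemma dim_span_line: "v \<noteq> 0 \<Longrightarrow> dim (span {v}) = 1" for v :: "real \<times> real"
  by (simp add: dim_span dim_eq_card_independent)

lemma span_line_eq_iff:
  fixes a b x y :: real
  assumes "(a, b) \<noteq> (0, 0)" "(x, y) \<noteq> (0, 0)"
  shows "span {(a, b)} = span {(x, y)} \<longleftrightarrow> a * y = b * x"
proof
  assume "span {(a, b)} = span {(x, y)}"
  then have "(a, b) \<in> span {(x, y)}" by (metis insertI1 span_base)
  then show "a * y = b * x" by (auto simp: span_line)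
next
  have *: "span {(a, b)} \<subseteq> span {(x, y)}" if "a * y = b * x" "(x, y) \<noteq> (0, 0)" for a b x y :: real
  proof -
    have "(a, b) = ((a * x + b * y) / (x\<^sup>2 + y\<^sup>2)) *\<^sub>R (x, y)"
    proof -
      have nz: "x\<^sup>2 + y\<^sup>2 \<noteq> 0" using that(2) by (simp add: sum_power2_eq_zero_iff)
      have "a * (x\<^sup>2 + y\<^sup>2) = (a * x + b * y) * x" "b * (x\<^sup>2 + y\<^sup>2) = (a * x + b * y) * y"
        using that(1) by (simp_all add: power2_eq_square algebra_simps)
      then show ?thesis using nz by (simp add: field_simps)
    qed
    then have "(a, b) \<in> span {(x, y)}" by (metis insertI1 span_base span_scale)
    then show ?thesis by (simp add: span_minimal)
  qed
  assume "a * y = b * x"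
  then show "span {(a, b)} = span {(x, y)}"
    using *[of a y b x] *[of x b y a] assms by (simp add: mult.commute subset_antisym)
qed

lemma span_in_real_roots:
  assumes "(a, b) \<noteq> (0, 0)" "\<And>t. P (t * a) (t * b) = 0"
  shows "span {(a, b)} \<in> real_roots P"
proof -
  have "\<forall>(x, y)\<in>span {(a, b)}. P x y = 0" using assms(2) by (auto simp: span_line)
  moreover have "dim (span {(a, b)}) = 1"
    by (rule dim_span_line) (use assms(1) in \<open>simp add: zero_prod_def\<close>)
  ultimately show ?thesis unfolding real_roots_def by simp
qed

lemma real_rootsE:
  assumes "l \<in> real_roots P"
  obtains a b where "(a, b) \<noteq> (0, 0)" "l = span {(a, b)}" "P a b = 0"
proof -
  obtain v where v: "v \<noteq> 0" "l = span {v}"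
    using assms line_eq_span[of l] unfolding real_roots_def by blast
  obtain a b where ab: "v = (a, b)" by force
  have "v \<in> l" using v by (simp add: span_base)
  then have "P a b = 0" using assms ab by (auto simp: real_roots_def)
  then show ?thesis using that v ab by (simp add: zero_prod_def)
qed

text \<open>The definite factor vanishes only at the origin, so the roots are the lines of the linear factors, and
removing one factor leaves a form that does not vanish on its line.\<close>

lemma exactly_simple_prod_linear:
  fixes a b :: "nat \<Rightarrow> real"
  assumes nz: "\<And>i. i < k \<Longrightarrow> (a i, b i) \<noteq> (0, 0)"
    and distinct: "\<And>i j. i < k \<Longrightarrow> j < k \<Longrightarrow> i \<noteq> j \<Longrightarrow> b i * a j \<noteq> a i * b j"
    and "c \<noteq> 0"
  shows "exactly_simple_real_roots (k + 2 * m) k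
           (\<lambda>\<mu> \<nu>. (\<Prod>i<k. b i * \<mu> - a i * \<nu>) * (c * (\<mu>\<^sup>2 + \<nu>\<^sup>2) ^ m))" (is "exactly_simple_real_roots _ _ ?P")
proof -
  have definite: "c * (\<mu>\<^sup>2 + \<nu>\<^sup>2) ^ m \<noteq> 0" if "(\<mu>, \<nu>) \<noteq> (0, 0)" for \<mu> \<nu>
    using that \<open>c \<noteq> 0\<close> by (auto simp: sum_power2_eq_zero_iff)
  have roots: "real_roots ?P = (\<lambda>i. span {(a i, b i)}) ` {..<k}"
  proof (intro equalityI subsetI)
    fix l assume "l \<in> real_roots ?P"
    then obtain x y where xy: "(x, y) \<noteq> (0, 0)" "l = span {(x, y)}" "?P x y = 0"
      by (rule real_rootsE)
    then obtain i where i: "i < k" "b i * x - a i * y = 0"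
      using definite[of x y] by auto
    then have "l = span {(a i, b i)}"
      using span_line_eq_iff[OF xy(1) nz[OF i(1)]] xy(2) by (simp add: mult.commute)
    then show "l \<in> (\<lambda>i. span {(a i, b i)}) ` {..<k}" using i by auto
  next
    fix l assume "l \<in> (\<lambda>i. span {(a i, b i)}) ` {..<k}"
    then obtain i where i: "i < k" "l = span {(a i, b i)}" by auto
    have "?P (t * a i) (t * b i) = 0" for t
    proof -
      have "b i * (t * a i) - a i * (t * b i) = 0" by simp
      then have "(\<Prod>j<k. b j * (t * a i) - a j * (t * b i)) = 0"
        using i(1) by (metis finite_lessThan lessThan_iff prod_zero)
      then show ?thesis by simp
    qed
    then show "l \<in> real_roots ?P" unfolding i(2) by (rule span_in_real_roots[OF nz[OF i(1)]])
  qed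
  have inj: "inj_on (\<lambda>i. span {(a i, b i)}) {..<k}"
  proof (rule inj_onI)
    fix i j assume "i \<in> {..<k}" "j \<in> {..<k}" "span {(a i, b i)} = span {(a j, b j)}"
    then show "i = j"
      using distinct[of i j] span_line_eq_iff[OF nz[of i] nz[of j]] by auto
  qed
  have "\<exists>t. \<forall>i<k. b i \<noteq> a i * t"
  proof -
    have "finite (\<Union>i<k. {t. b i = a i * t})"
    proof (intro finite_UN_I)
      fix i assume "i \<in> {..<k}"
      have "{t. b i = a i * t} \<subseteq> {b i / a i}"
        using nz[of i] \<open>i \<in> {..<k}\<close> by (auto simp: field_simps)
      then show "finite {t. b i = a i * t}" using finite_subset by blast
    qed simp
    then obtain t where "t \<notin> (\<Union>i<k. {t. b i = a i * t})"
      using ex_new_if_finite infinite_UNIV_char_0 by blast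
    then show ?thesis by blast
  qed
  then obtain t where t: "\<forall>i<k. b i \<noteq> a i * t" by blast
  have "?P 1 t \<noteq> 0" using t definite[of 1 t] by simp
  then have nonzero: "\<exists>\<mu> \<nu>. ?P \<mu> \<nu> \<noteq> 0" by blast
  have "simple_root (k + 2 * m) ?P l" if l: "l \<in> real_roots ?P" for l
  proof -
    obtain i where i: "i < k" "l = span {(a i, b i)}" using l roots by auto
    define Q where "Q \<mu> \<nu> = (\<Prod>j\<in>{..<k} - {i}. b j * \<mu> - a j * \<nu>) * (c * (\<mu>\<^sup>2 + \<nu>\<^sup>2) ^ m)" for \<mu> \<nu>
    have "binary_form (card ({..<k} - {i}) + 2 * m) Q"
      unfolding Q_def by (rule binary_form_prod_linear[OF binary_form_definite_power]) simp
    moreover have "card ({..<k} - {i}) + 2 * m = k + 2 * m - 1" using i(1) by simp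
    moreover have "?P \<mu> \<nu> = (b i * \<mu> - a i * \<nu>) * Q \<mu> \<nu>" for \<mu> \<nu>
      unfolding Q_def using i(1) by (simp add: prod.remove[of "{..<k}" i] mult.assoc)
    moreover have "Q (a i) (b i) \<noteq> 0"
      unfolding Q_def using definite[OF nz[OF i(1)]] distinct[OF _ i(1)] by auto
    moreover have "(a i, b i) \<in> l" unfolding i(2) by (simp add: span_base)
    ultimately show ?thesis
      unfolding simple_root_def using nz[OF i(1)] by metis
  qed
  then show ?thesis
    unfolding exactly_simple_real_roots_def using nonzero
    by (simp add: roots card_image[OF inj])
qed

text \<open>The substitution is a linear isomorphism of the plane, so it maps the roots of one form bijectively to
those of the other. The constant is nonzero because the forms counted are.\<close>

lemma has_root_count_linear_change:
  assumes P': "\<And>\<mu> \<nu>. P' \<mu> \<nu> = d * P (p * \<mu> + q * \<nu>) (r * \<mu> + s * \<nu>)"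
    and det: "p * s \<noteq> q * r" and cnt: "has_root_count k P'"
  shows "has_root_count k P"
proof -
  have d: "d \<noteq> 0" using cnt P' by (auto simp: has_root_count_def)
  define C where "C v = (p * fst v + q * snd v, r * fst v + s * snd v)" for v :: "real \<times> real"
  define E where "E v = ((s * fst v - q * snd v) / (p * s - q * r), (p * snd v - r * fst v) / (p * s - q * r))"
    for v :: "real \<times> real"
  have linC: "linear C" unfolding C_def
    by (rule linearI) (auto simp: algebra_simps)
  have EC: "E (C v) = v" for v
  proof -
    have "s * (p * x + q * y) - q * (r * x + s * y) = x * (p * s - q * r)"
      "p * (r * x + s * y) - r * (p * x + q * y) = y * (p * s - q * r)" for x y
      by (simp_all add: algebra_simps)
    then show ?thesis using det by (cases v) (simp add: E_def C_def)
  qed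
  have CE: "C (E v) = v" for v
  proof -
    have "p * (s * x - q * y) + q * (p * y - r * x) = x * (p * s - q * r)"
      "r * (s * x - q * y) + s * (p * y - r * x) = y * (p * s - q * r)" for x y
      by (simp_all add: algebra_simps)
    then show ?thesis using det
      by (cases v) (simp add: E_def C_def add_divide_distrib[symmetric])
  qed
  have injC: "inj C" by (metis EC injI)
  have P'C: "P' (fst v) (snd v) = d * P (fst (C v)) (snd (C v))" for v
    by (simp add: P' C_def)
  have img: "(\<lambda>l. C ` l) ` real_roots P' = real_roots P"
  proof (intro equalityI subsetI)
    fix l assume "l \<in> (\<lambda>l. C ` l) ` real_roots P'"
    then obtain m where m: "m \<in> real_roots P'" "l = C ` m" by auto
    have "subspace l" using m linC by (auto simp: real_roots_def intro: linear_subspace_image)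
    moreover have "dim l = 1"
      using m dim_image_eq[OF linC, of m] injC by (auto simp: real_roots_def intro: inj_on_subset)
    moreover have "P (fst w) (snd w) = 0" if w: "w \<in> l" for w
    proof -
      obtain v where v: "v \<in> m" "w = C v" using w m by auto
      then have "P' (fst v) (snd v) = 0" using m(1) by (auto simp: real_roots_def split_def)
      then show ?thesis using P'C[of v] v d by simp
    qed
    ultimately show "l \<in> real_roots P" by (auto simp: real_roots_def split_def)
  next
    fix l assume l: "l \<in> real_roots P"
    have Cl: "C ` (C -` l) = l" using CE by (metis surj_image_vimage_eq surjI)
    have sub: "subspace (C -` l)" using l linC by (auto simp: real_roots_def intro: linear_subspace_vimage)
    have "dim (C -` l) = 1"
      using l dim_image_eq[OF linC inj_on_subset[OF injC], of "C -` l"] Cl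
      by (simp add: real_roots_def)
    moreover have "P' (fst v) (snd v) = 0" if "v \<in> C -` l" for v
      using that l P'C[of v] by (auto simp: real_roots_def split_def)
    ultimately have "C -` l \<in> real_roots P'" using sub by (auto simp: real_roots_def split_def)
    then show "l \<in> (\<lambda>l. C ` l) ` real_roots P'" using Cl by (metis image_eqI)
  qed
  have "inj_on (\<lambda>l. C ` l) (real_roots P')"
    using injC by (auto simp: inj_on_def inj_image_eq_iff)
  then have "card (real_roots P) = card (real_roots P')" using img card_image by metis
  moreover have "finite (real_roots P)" using cnt img by (metis has_root_count_def finite_imageI)
  moreover have "\<exists>\<mu> \<nu>. P \<mu> \<nu> \<noteq> 0" using cnt P' by (auto simp: has_root_count_def)
  ultimately show ?thesis using cnt by (simp add: has_root_count_def)
qed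

lemma span_unit_slope_eq_iff:
  "span {(1::real, t)} = span {(1::real, s)} \<longleftrightarrow> t = s" for t s :: real
  by (subst span_line_eq_iff) auto

text \<open>The pencil that obstructs ampleness. Only the first row is varied; it pairs with the isotropic
  half \<open>{N..<2 * N}\<close>, so the Pfaffian is, up to a nonzero constant, \<open>(x w - y z) R\<close> where \<open>x\<close>, \<open>y\<close>
  are the first two entries of the first row and \<open>w\<close>, \<open>z\<close>, \<open>R\<close> are fixed. For \<open>k \<le> N - 2\<close> take
  \<open>R\<close> with \<open>k\<close> real roots and \<open>w = \<mu>\<close>, \<open>z = - \<nu>\<close>: without the coefficient of \<open>\<mu>\<close> in \<open>x\<close> the
  quadratic factor has the root \<open>(1, 0)\<close> and there are too many roots. For \<open>k = N\<close> take \<open>R\<close> with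
  \<open>N - 2\<close> real roots and \<open>w = \<nu>\<close>, \<open>z = 0\<close>: without that coefficient \<open>(1, 0)\<close> is a double root and
  there are too few.\<close>

theorem obstructing_pencil:
  assumes N: "N \<ge> 2" and k: "k \<le> N" "k mod 2 = N mod 2"
  shows "\<exists>U V :: nat \<Rightarrow> nat \<Rightarrow> real.
    (\<forall>i j. U j i = - U i j \<and> V j i = - V i j) \<and> U 0 N = 1 \<and>
    exactly_simple_real_roots N k (\<lambda>\<mu> \<nu>. pfaffian N (\<lambda>i j. \<mu> * U i j + \<nu> * V i j)) \<and>
    (\<forall>U' V'. (\<forall>i<2 * N. \<forall>j<2 * N. U' j i = - U' i j \<and> V' j i = - V' i j) \<longrightarrow>
       (\<forall>i j. 1 \<le> i \<and> i < 2 * N \<and> 1 \<le> j \<and> j < 2 * N \<longrightarrow> U' i j = U i j \<and> V' i j = V i j) \<longrightarrow>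
       U' 0 N = 0 \<longrightarrow>
       \<not> has_root_count k (\<lambda>\<mu> \<nu>. pfaffian N (\<lambda>i j. \<mu> * U' i j + \<nu> * V' i j)))"
proof -
  define c where "c = pfaffian N (split_skew N)"
  have c: "c \<noteq> 0" unfolding c_def by (rule pfaffian_split_skew_nonzero)
  define r where "r = (if k = N then N - 2 else k)"
  define m where "m = (N - 2 - r) div 2"
  define \<alpha> where "\<alpha> = (if k = N then 0 else 1 :: real)"
  have "2 dvd N - k" using k mod_eq_dvd_iff_nat[of k N 2] by simp
  then obtain h where h: "N = k + 2 * h" using k(1) by (metis dvdE le_add_diff_inverse)
  have k2: "k = N \<or> k + 2 \<le> N" using h by (cases h) auto
  have rm: "r + 2 * m = N - 2"
  proof (cases "k = N")
    case False
    then obtain h' where "h = Suc h'" using h by (cases h) auto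
    then show ?thesis using h by (simp add: r_def m_def)
  qed (simp add: r_def m_def)
  obtain U\<^sub>0 V\<^sub>0 where UV0: "\<forall>\<mu> \<nu>. det_fn (N - 2) (\<lambda>i j. \<mu> * U\<^sub>0 i j + \<nu> * V\<^sub>0 i j) =
      (\<Prod>i<r. \<nu> - real (Suc i) * \<mu>) * (\<mu>\<^sup>2 + \<nu>\<^sup>2) ^ m"
    using det_pencil_exists[of r m] unfolding rm by (elim exE) (rule that)
  define BU where "BU i j = (if i < 2 \<or> j < 2 then if i = 0 \<and> j = 0 then 1 else if i = 1 \<and> j = 1 then \<alpha> else 0
      else U\<^sub>0 (i - 2) (j - 2))" for i j
  define BV where "BV i j = (if i < 2 \<or> j < 2 then if i = 0 \<and> j = 1 then \<alpha> else if i = 1 \<and> j = 0 then - \<alpha>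
        else if i = 1 \<and> j = 1 then 1 - \<alpha> else 0
      else V\<^sub>0 (i - 2) (j - 2))" for i j
  define ext where "ext B i j = (if i < N \<and> N \<le> j then B i (j - N) else if j < N \<and> N \<le> i then - B j (i - N) else 0)"
    for B :: "nat \<Rightarrow> nat \<Rightarrow> real" and i j
  have ext_skew: "ext B j i = - ext B i j" for B i j by (simp add: ext_def)
  define U V where "U = ext BU" and "V = ext BV"
  have skew_UV: "U j i = - U i j \<and> V j i = - V i j" for i j
    unfolding U_def V_def using ext_skew by blast
  define R where "R \<mu> \<nu> = (\<Prod>i<r. \<nu> - real (Suc i) * \<mu>) * (\<mu>\<^sup>2 + \<nu>\<^sup>2) ^ m" for \<mu> \<nu>
  have pf: "pfaffian N (\<lambda>i j. \<mu> * U' i j + \<nu> * V' i j) =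
      c * (((\<mu> * U' 0 N + \<nu> * V' 0 N) * (\<alpha> * \<mu> + (1 - \<alpha>) * \<nu>) +
            (\<mu> * U' 0 (Suc N) + \<nu> * V' 0 (Suc N)) * (\<alpha> * \<nu>)) * R \<mu> \<nu>)"
    if skew: "\<And>i j. i < 2 * N \<Longrightarrow> j < 2 * N \<Longrightarrow> U' j i = - U' i j \<and> V' j i = - V' i j"
      and eq: "\<And>i j. 1 \<le> i \<Longrightarrow> i < 2 * N \<Longrightarrow> 1 \<le> j \<Longrightarrow> j < 2 * N \<Longrightarrow> U' i j = U i j \<and> V' i j = V i j"
    for U' V' \<mu> \<nu>
  proof -
    define a where "a i j = \<mu> * U' i j + \<nu> * V' i j" for i j
    have a_eq: "a (Suc i) (N + j) = \<mu> * BU (Suc i) j + \<nu> * BV (Suc i) j" if "Suc i < N" "j < N" for i j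
      using that eq[of "Suc i" "N + j"] by (simp add: a_def U_def V_def ext_def)
    have "pfaffian N a = c * det_fn N (\<lambda>i j. a i (N + j))"
      unfolding c_def
    proof (rule pfaffian_isotropic_half)
      show "a j i = - a i j" if "i < 2 * N" "j < 2 * N" for i j
        using skew[OF that] by (simp add: a_def)
      show "a (N + i) (N + j) = 0" if "i < N" "j < N" for i j
        using eq[of "N + i" "N + j"] that N by (simp add: a_def U_def V_def ext_def)
    qed
    also have "det_fn N (\<lambda>i j. a i (N + j)) = det_fn (2 + (N - 2)) (\<lambda>i j. a i (N + j))"
      by (simp only: le_add_diff_inverse[OF N])
    also have "\<dots> = det_fn 2 (\<lambda>i j. a i (N + j)) * det_fn (N - 2) (\<lambda>i j. a (2 + i) (N + (2 + j)))"
    proof (rule det_fn_block)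
      fix i j :: nat assume "i < N - 2" "j < 2"
      then show "a (2 + i) (N + j) = 0" using a_eq[of "Suc i" j] by (simp add: BU_def BV_def)
    qed
    also have "det_fn (N - 2) (\<lambda>i j. a (2 + i) (N + (2 + j))) = R \<mu> \<nu>"
    proof -
      have "mat (N - 2) (N - 2) (\<lambda>(i, j). a (2 + i) (N + (2 + j))) =
          mat (N - 2) (N - 2) (\<lambda>(i, j). \<mu> * U\<^sub>0 i j + \<nu> * V\<^sub>0 i j)"
      proof (rule eq_matI)
        fix i j assume "i < dim_row (mat (N - 2) (N - 2) (\<lambda>(i, j). \<mu> * U\<^sub>0 i j + \<nu> * V\<^sub>0 i j))"
          "j < dim_col (mat (N - 2) (N - 2) (\<lambda>(i, j). \<mu> * U\<^sub>0 i j + \<nu> * V\<^sub>0 i j))"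
        then show "mat (N - 2) (N - 2) (\<lambda>(i, j). a (2 + i) (N + (2 + j))) $$ (i, j) =
            mat (N - 2) (N - 2) (\<lambda>(i, j). \<mu> * U\<^sub>0 i j + \<nu> * V\<^sub>0 i j) $$ (i, j)"
          using a_eq[of "Suc i" "Suc (Suc j)"] by (simp add: BU_def BV_def)
      qed auto
      then show ?thesis using UV0 by (simp only: R_def)
    qed
    also have "det_fn 2 (\<lambda>i j. a i (N + j)) =
        a 0 N * (\<alpha> * \<mu> + (1 - \<alpha>) * \<nu>) + a 0 (Suc N) * (\<alpha> * \<nu>)"
    proof -
      have "a 1 N = - (\<alpha> * \<nu>)" "a 1 (N + 1) = \<alpha> * \<mu> + (1 - \<alpha>) * \<nu>"
        using a_eq[of 0 0] a_eq[of 0 1] N by (simp_all add: BU_def BV_def mult.commute)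
      then show ?thesis unfolding det_fn_2 by simp
    qed
    finally show ?thesis by (simp add: a_def)
  qed
  have entries: "U 0 N = 1" "V 0 N = 0" "U 0 (Suc N) = 0" "V 0 (Suc N) = \<alpha>"
    using N by (simp_all add: U_def V_def ext_def BU_def BV_def)
  have simple: "exactly_simple_real_roots N k (\<lambda>\<mu> \<nu>. pfaffian N (\<lambda>i j. \<mu> * U i j + \<nu> * V i j))"
  proof -
    have P: "pfaffian N (\<lambda>i j. \<mu> * U i j + \<nu> * V i j) =
        c * ((\<mu> * (\<alpha> * \<mu> + (1 - \<alpha>) * \<nu>) + \<nu> * \<alpha> * (\<alpha> * \<nu>)) * R \<mu> \<nu>)" for \<mu> \<nu>
      using pf[of U V \<mu> \<nu>, OF skew_UV] entries by simp
    show ?thesis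
    proof (cases "k = N")
      case True
      define a b :: "nat \<Rightarrow> real" where "a i = (if i = r + 1 then 0 else - 1)"
        and "b i = (if i = r + 1 then 1 else if i = r then 0 else - real (Suc i))" for i
      have Nr: "N = Suc (Suc r)" "m = 0" using True N rm by (auto simp: r_def)
      have "exactly_simple_real_roots (N + 2 * m) N
          (\<lambda>\<mu> \<nu>. (\<Prod>i<N. b i * \<mu> - a i * \<nu>) * (c * (\<mu>\<^sup>2 + \<nu>\<^sup>2) ^ m))"
        by (rule exactly_simple_prod_linear) (auto simp: a_def b_def c)
      moreover have "(\<Prod>i<N. b i * \<mu> - a i * \<nu>) = (\<Prod>i<r. \<nu> - real (Suc i) * \<mu>) * \<nu> * \<mu>" for \<mu> \<nu>
      proof -
        have "(\<Prod>i<r. b i * \<mu> - a i * \<nu>) = (\<Prod>i<r. \<nu> - real (Suc i) * \<mu>)"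
          by (rule prod.cong) (auto simp: a_def b_def algebra_simps)
        then show ?thesis unfolding Nr(1) by (simp add: a_def b_def)
      qed
      ultimately show ?thesis
        using True Nr(2) by (simp add: P \<alpha>_def R_def mult_ac)
    next
      case False
      define a b :: "nat \<Rightarrow> real" where "a i = - 1" and "b i = - real (Suc i)" for i
      have Nk: "N = k + 2 * Suc m" "r = k" using False k2 rm by (auto simp: r_def)
      have "exactly_simple_real_roots (k + 2 * Suc m) k
          (\<lambda>\<mu> \<nu>. (\<Prod>i<k. b i * \<mu> - a i * \<nu>) * (c * (\<mu>\<^sup>2 + \<nu>\<^sup>2) ^ Suc m))"
        by (rule exactly_simple_prod_linear) (auto simp: a_def b_def c)
      moreover have "(\<Prod>i<k. b i * \<mu> - a i * \<nu>) = (\<Prod>i<k. \<nu> - real (Suc i) * \<mu>)" for \<mu> \<nu>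
        by (rule prod.cong) (auto simp: a_def b_def algebra_simps)
      moreover have "pfaffian N (\<lambda>i j. \<mu> * U i j + \<nu> * V i j) =
          (\<Prod>i<k. \<nu> - real (Suc i) * \<mu>) * (c * (\<mu>\<^sup>2 + \<nu>\<^sup>2) ^ Suc m)" for \<mu> \<nu>
        using False Nk(2) by (simp add: P \<alpha>_def R_def power2_eq_square)
      ultimately show ?thesis by (simp only: Nk(1)[symmetric])
    qed
  qed
  have bad: "\<not> has_root_count k (\<lambda>\<mu> \<nu>. pfaffian N (\<lambda>i j. \<mu> * U' i j + \<nu> * V' i j))"
    if skew: "\<forall>i<2 * N. \<forall>j<2 * N. U' j i = - U' i j \<and> V' j i = - V' i j"
      and eq: "\<forall>i j. 1 \<le> i \<and> i < 2 * N \<and> 1 \<le> j \<and> j < 2 * N \<longrightarrow> U' i j = U i j \<and> V' i j = V i j"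
      and zero: "U' 0 N = 0" for U' V'
  proof
    let ?P = "\<lambda>\<mu> \<nu>. pfaffian N (\<lambda>i j. \<mu> * U' i j + \<nu> * V' i j)"
    have P: "?P \<mu> \<nu> = c * ((\<nu> * V' 0 N * (\<alpha> * \<mu> + (1 - \<alpha>) * \<nu>) +
        (\<mu> * U' 0 (Suc N) + \<nu> * V' 0 (Suc N)) * (\<alpha> * \<nu>)) * R \<mu> \<nu>)" for \<mu> \<nu>
    proof -
      have skew': "U' j i = - U' i j \<and> V' j i = - V' i j" if "i < 2 * N" "j < 2 * N" for i j
        using skew that by blast
      have eq': "U' i j = U i j \<and> V' i j = V i j" if "1 \<le> i" "i < 2 * N" "1 \<le> j" "j < 2 * N" for i j
        using eq that by blast
      show ?thesis using pf[of U' V' \<mu> \<nu>, OF skew' eq'] zero by simp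
    qed
    have inj: "inj_on (\<lambda>i. span {(1::real, real i)}) S" for S
      by (rule inj_onI) (simp add: span_unit_slope_eq_iff)
    assume "has_root_count k ?P"
    then have nonzero: "\<exists>\<mu> \<nu>. ?P \<mu> \<nu> \<noteq> 0" and fin: "finite (real_roots ?P)" and card: "card (real_roots ?P) = k"
      unfolding has_root_count_def by auto
    show False
    proof (cases "k = N")
      case True
      have "real_roots ?P \<subseteq> (\<lambda>i. span {(1::real, real i)}) ` {..r}"
      proof
        fix l assume "l \<in> real_roots ?P"
        then obtain x y where xy: "(x, y) \<noteq> (0, 0)" "l = span {(x, y)}" "?P x y = 0"
          by (rule real_rootsE)
        have "V' 0 N \<noteq> 0" using nonzero True by (auto simp: P \<alpha>_def)
        then have "y = 0 \<or> R x y = 0" using xy(3) c True by (auto simp: P \<alpha>_def)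
        moreover have "x\<^sup>2 + y\<^sup>2 \<noteq> 0" using xy(1) by (simp add: sum_power2_eq_zero_iff)
        ultimately have "\<exists>i\<le>r. y = real i * x"
        proof (elim disjE)
          assume "R x y = 0" "x\<^sup>2 + y\<^sup>2 \<noteq> 0"
          then obtain j where "j < r" "y - real (Suc j) * x = 0"
            unfolding R_def by auto
          then show ?thesis by (intro exI[of _ "Suc j"]) simp
        qed auto
        then obtain i where "i \<le> r" "y = real i * x" by blast
        then show "l \<in> (\<lambda>i. span {(1::real, real i)}) ` {..r}"
          using span_line_eq_iff[OF xy(1), of 1 "real i"] xy(2) by (auto simp: mult.commute)
      qed
      then have "card (real_roots ?P) \<le> card {..r}"
        by (meson card_image_le card_mono finite_atMost finite_imageI le_trans)
      then show False using card True N by (simp add: r_def)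
    next
      case False
      have "(\<lambda>i. span {(1::real, real i)}) ` {..r} \<subseteq> real_roots ?P"
      proof (intro image_subsetI span_in_real_roots)
        fix i t assume "i \<in> {..r}"
        have "real i = 0 \<or> R (t * 1) (t * real i) = 0"
        proof (cases i)
          case (Suc j)
          have "(\<Prod>j<r. t * real i - real (Suc j) * (t * 1)) = 0"
            by (rule prod_zero[OF _ bexI[of _ j]]) (use Suc \<open>i \<in> {..r}\<close> in auto)
          then show ?thesis by (simp add: R_def)
        qed simp
        then show "?P (t * 1) (t * real i) = 0" by (auto simp: P)
      qed auto
      then have "card ((\<lambda>i. span {(1::real, real i)}) ` {..r}) \<le> card (real_roots ?P)"
        by (rule card_mono[OF fin])
      then have "card {..r} \<le> card (real_roots ?P)" by (simp only: card_image[OF inj])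
      then show False using card False by (simp add: r_def)
    qed
  qed
  show ?thesis
  proof (rule exI[of _ U], rule exI[of _ V], intro conjI)
    show "\<forall>i j. U j i = - U i j \<and> V j i = - V i j" by (intro allI skew_UV)
    show "U 0 N = 1" by (rule entries(1))
    show "exactly_simple_real_roots N k (\<lambda>\<mu> \<nu>. pfaffian N (\<lambda>i j. \<mu> * U i j + \<nu> * V i j))"
      by (rule simple)
    show "\<forall>U' V'. (\<forall>i<2 * N. \<forall>j<2 * N. U' j i = - U' i j \<and> V' j i = - V' i j) \<longrightarrow>
       (\<forall>i j. 1 \<le> i \<and> i < 2 * N \<and> 1 \<le> j \<and> j < 2 * N \<longrightarrow> U' i j = U i j \<and> V' i j = V i j) \<longrightarrow>
       U' 0 N = 0 \<longrightarrow>
       \<not> has_root_count k (\<lambda>\<mu> \<nu>. pfaffian N (\<lambda>i j. \<mu> * U' i j + \<nu> * V' i j))"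
    proof (intro allI impI)
      fix U' V' :: "nat \<Rightarrow> nat \<Rightarrow> real"
      assume 1: "\<forall>i<2 * N. \<forall>j<2 * N. U' j i = - U' i j \<and> V' j i = - V' i j"
        and 2: "\<forall>i j. 1 \<le> i \<and> i < 2 * N \<and> 1 \<le> j \<and> j < 2 * N \<longrightarrow> U' i j = U i j \<and> V' i j = V i j"
        and 3: "U' 0 N = 0"
      show "\<not> has_root_count k (\<lambda>\<mu> \<nu>. pfaffian N (\<lambda>i j. \<mu> * U' i j + \<nu> * V' i j))"
        by (rule bad[OF 1 2 3])
    qed
  qed
qed

section \<open>Smooth functions\<close>

lemma frechet_derivative_cong_open:
  assumes "open S" "x \<in> S" "\<And>y. y \<in> S \<Longrightarrow> f y = g y"
  shows "frechet_derivative f (at x) = frechet_derivative g (at x)"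
proof -
  have "(f has_derivative D) (at x) \<longleftrightarrow> (g has_derivative D) (at x)" for D
    using has_derivative_transform_within_open[OF _ assms(1,2), of f D UNIV g]
      has_derivative_transform_within_open[OF _ assms(1,2), of g D UNIV f] assms(3) by auto
  then show ?thesis by (simp add: frechet_derivative_def)
qed

lemma C_on_cong:
  assumes "open S" "\<And>y. y \<in> S \<Longrightarrow> f y = g y" "C_on r S f"
  shows "C_on r S g"
  using assms(2,3)
proof (induction r arbitrary: f g)
  case 0
  then show ?case by (simp cong: continuous_on_cong)
next
  case (Suc r)
  have "frechet_derivative f (at x) = frechet_derivative g (at x)" if "x \<in> S" for x
    using frechet_derivative_cong_open[OF assms(1) that] Suc.prems(1) by blast
  then have "C_on r S (\<lambda>x. frechet_derivative g (at x) v)" for v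
    using Suc.IH[of "\<lambda>x. frechet_derivative f (at x) v" "\<lambda>x. frechet_derivative g (at x) v"]
      Suc.prems(2) by simp
  moreover have "g differentiable_on S"
    unfolding differentiable_on_def
  proof
    fix x assume "x \<in> S"
    then have "f differentiable (at x within S)"
      using Suc.prems(2) by (simp add: differentiable_on_def)
    then show "g differentiable (at x within S)"
      by (rule differentiable_transform_within[where d = 1]) (use \<open>x \<in> S\<close> Suc.prems(1) in simp_all)
  qed
  ultimately show ?case by simp
qed

lemma C_on_subset: "C_on r T f \<Longrightarrow> S \<subseteq> T \<Longrightarrow> C_on r S f"
  by (induction r arbitrary: f) (auto intro: continuous_on_subset differentiable_on_subset)

lemma C_on_Suc_D: "C_on (Suc r) S f \<Longrightarrow> C_on r S f"
proof (induction r arbitrary: f)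
  case 0
  then show ?case by (simp add: differentiable_imp_continuous_on)
next
  case (Suc r)
  have "C_on (Suc r) S (\<lambda>x. frechet_derivative f (at x) v)" for v using Suc.prems by simp
  then have "C_on r S (\<lambda>x. frechet_derivative f (at x) v)" for v by (rule Suc.IH)
  moreover have "f differentiable_on S" using Suc.prems by simp
  ultimately show ?case by simp
qed

lemma C_on_SucI:
  assumes "open S" "\<And>x. x \<in> S \<Longrightarrow> (f has_derivative D x) (at x)" "\<And>v. C_on r S (\<lambda>x. D x v)"
  shows "C_on (Suc r) S f"
proof -
  have D: "frechet_derivative f (at x) = D x" if "x \<in> S" for x
    using frechet_derivative_at[OF assms(2)[OF that]] by simp
  have "C_on r S (\<lambda>x. frechet_derivative f (at x) v)" for v
    by (rule C_on_cong[OF assms(1) _ assms(3)[of v]]) (simp add: D)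
  moreover have "f differentiable_on S"
    unfolding differentiable_on_def
    using assms(2) differentiable_at_withinI differentiable_def by blast
  ultimately show ?thesis by simp
qed

lemma C_on_Suc_has_derivative:
  assumes "open S" "C_on (Suc r) S f" "x \<in> S"
  shows "(f has_derivative frechet_derivative f (at x)) (at x)"
  using assms by (simp add: differentiable_on_eq_differentiable_at frechet_derivative_works)

lemma C_on_const: "open S \<Longrightarrow> C_on r S (\<lambda>x. c)"
proof (induction r arbitrary: c)
  case (Suc r)
  show ?case
    by (rule C_on_SucI[OF \<open>open S\<close> has_derivative_const]) (rule Suc.IH[OF \<open>open S\<close>])
qed simp

lemma C_on_add:
  assumes "open S" shows "C_on r S f \<Longrightarrow> C_on r S g \<Longrightarrow> C_on r S (\<lambda>x. f x + g x)"
proof (induction r arbitrary: f g)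
  case 0
  then show ?case by (auto intro: continuous_on_add)
next
  case (Suc r)
  show ?case
  proof (rule C_on_SucI[OF assms])
    show "((\<lambda>x. f x + g x) has_derivative
        (\<lambda>v. frechet_derivative f (at x) v + frechet_derivative g (at x) v)) (at x)" if "x \<in> S" for x
      by (intro has_derivative_add C_on_Suc_has_derivative[OF assms _ that, of r] Suc.prems)
    show "C_on r S (\<lambda>x. frechet_derivative f (at x) v + frechet_derivative g (at x) v)" for v
      by (rule Suc.IH) (use Suc.prems in auto)
  qed
qed

lemma C_on_sum:
  assumes "open S" "finite I" "\<And>i. i \<in> I \<Longrightarrow> C_on r S (f i)"
  shows "C_on r S (\<lambda>x. \<Sum>i\<in>I. f i x)"
  using assms(2,3)
  by (induction I rule: finite_induct) (auto intro: C_on_const C_on_add assms(1))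

lemma C_on_linear_comp:
  assumes "open S" "bounded_linear L" shows "C_on r S f \<Longrightarrow> C_on r S (\<lambda>x. L (f x))"
proof (induction r arbitrary: f)
  case 0
  then show ?case using bounded_linear.continuous_on[OF assms(2)] by auto
next
  case (Suc r)
  show ?case
  proof (rule C_on_SucI[OF assms(1)])
    show "((\<lambda>x. L (f x)) has_derivative (\<lambda>v. L (frechet_derivative f (at x) v))) (at x)"
      if "x \<in> S" for x
      by (intro bounded_linear.has_derivative[OF assms(2)] C_on_Suc_has_derivative[OF assms(1) _ that, of r] Suc.prems)
    show "C_on r S (\<lambda>x. L (frechet_derivative f (at x) v))" for v
      by (rule Suc.IH) (use Suc.prems in auto)
  qed
qed

lemma C_on_bounded_linear:
  assumes "open S" "bounded_linear L" shows "C_on r S L"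
proof (cases r)
  case 0
  then show ?thesis using bounded_linear.continuous_on[OF assms(2) continuous_on_id] by simp
next
  case (Suc q)
  show ?thesis unfolding Suc
    by (rule C_on_SucI[OF assms(1) bounded_linear_imp_has_derivative[OF assms(2)]])
      (rule C_on_const[OF assms(1)])
qed

lemma C_on_bilinear:
  assumes "open S" "bounded_bilinear B"
  shows "C_on r S f \<Longrightarrow> C_on r S g \<Longrightarrow> C_on r S (\<lambda>x. B (f x) (g x))"
proof (induction r arbitrary: f g)
  case 0
  then show ?case using bounded_bilinear.continuous_on[OF assms(2)] by auto
next
  case (Suc r)
  show ?case
  proof (rule C_on_SucI[OF assms(1)])
    show "((\<lambda>x. B (f x) (g x)) has_derivative
        (\<lambda>v. B (f x) (frechet_derivative g (at x) v) + B (frechet_derivative f (at x) v) (g x))) (at x)"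
      if "x \<in> S" for x
      by (intro bounded_bilinear.FDERIV[OF assms(2)] C_on_Suc_has_derivative[OF assms(1) _ that, of r] Suc.prems)
    have "C_on r S f" "C_on r S g" using Suc.prems C_on_Suc_D by blast+
    then show "C_on r S (\<lambda>x. B (f x) (frechet_derivative g (at x) v) +
        B (frechet_derivative f (at x) v) (g x))" for v
      using Suc.prems by (intro C_on_add[OF assms(1)] Suc.IH) auto
  qed
qed

text \<open>The derivative of a composition is taken in a direction that varies with the point; expanding that
direction in a basis turns it into a sum of products, to which the induction hypothesis applies.\<close>

lemma C_on_compose:
  fixes h :: "'a::real_normed_vector \<Rightarrow> 'b::euclidean_space" and f :: "'b \<Rightarrow> 'c::real_normed_vector"
  assumes "open S" "open T"
  shows "h ` S \<subseteq> T \<Longrightarrow> C_on r S h \<Longrightarrow> C_on r T f \<Longrightarrow> C_on r S (\<lambda>x. f (h x))"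
proof (induction r arbitrary: f)
  case 0
  then show ?case using continuous_on_compose2[of T f S h] by simp
next
  case (Suc r)
  let ?D = "\<lambda>x v. frechet_derivative f (at (h x)) (frechet_derivative h (at x) v)"
  have fd: "(f has_derivative frechet_derivative f (at (h x))) (at (h x))" if "x \<in> S" for x
    using C_on_Suc_has_derivative[OF assms(2) Suc.prems(3)] that Suc.prems(1) by blast
  have hd: "(h has_derivative frechet_derivative h (at x)) (at x)" if "x \<in> S" for x
    using C_on_Suc_has_derivative[OF assms(1) Suc.prems(2) that] .
  show ?case
  proof (rule C_on_SucI[OF assms(1)])
    show "((\<lambda>x. f (h x)) has_derivative ?D x) (at x)" if "x \<in> S" for x
      using has_derivative_compose[OF hd fd] that by simp
    show "C_on r S (\<lambda>x. ?D x v)" for v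
    proof (rule C_on_cong[OF assms(1)])
      have "C_on r S (\<lambda>x. frechet_derivative h (at x) v)" using Suc.prems by simp
      moreover have "C_on r S (\<lambda>x. frechet_derivative f (at (h x)) b)" for b
        by (rule Suc.IH) (use Suc.prems C_on_Suc_D[OF Suc.prems(2)] in auto)
      ultimately show "C_on r S (\<lambda>x. \<Sum>b\<in>Basis. (frechet_derivative h (at x) v \<bullet> b) *\<^sub>R
          frechet_derivative f (at (h x)) b)"
        by (intro C_on_sum[OF assms(1)] C_on_bilinear[OF assms(1) bounded_bilinear_scaleR]
            C_on_linear_comp[OF assms(1) bounded_linear_inner_left]) auto
      show "(\<Sum>b\<in>Basis. (frechet_derivative h (at x) v \<bullet> b) *\<^sub>R frechet_derivative f (at (h x)) b) = ?D x v"
        if "x \<in> S" for x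
      proof -
        have "linear (frechet_derivative f (at (h x)))"
          using fd[OF that] has_derivative_linear by blast
        then show ?thesis
          by (subst (2) euclidean_representation[symmetric]) (simp add: linear_sum linear_cmul)
      qed
    qed
  qed
qed

lemma smooth_on_differentiable: "smooth_on S f \<Longrightarrow> open S \<Longrightarrow> x \<in> S \<Longrightarrow> f differentiable (at x)"
  unfolding smooth_on_def by (metis C_on.simps(2) differentiable_on_eq_differentiable_at)

lemma smooth_on_derivative: "smooth_on S f \<Longrightarrow> smooth_on S (\<lambda>x. frechet_derivative f (at x) v)"
  unfolding smooth_on_def by (metis C_on.simps(2))

lemma smooth_on_compose:
  fixes h :: "'a::real_normed_vector \<Rightarrow> 'b::euclidean_space"
  assumes "open S" "open T" "h ` S \<subseteq> T" "smooth_on S h" "smooth_on T f"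
  shows "smooth_on S (\<lambda>x. f (h x))"
  using assms C_on_compose[OF assms(1,2)] unfolding smooth_on_def by blast

no_notation vec_index (infixl "$" 100)

section \<open>Differentiable atlases\<close>

lemma has_derivative_cong_nhds:
  assumes "(f has_derivative D) (at x)" "\<forall>\<^sub>F y in nhds x. f y = g y"
  shows "(g has_derivative D) (at x)"
  using has_derivative_transform_eventually[OF assms(1)] assms(2)
  by (simp add: eventually_nhds_conv_at)

lemma frechet_derivative_eqI:
  "(f has_derivative D) (at x) \<Longrightarrow> frechet_derivative f (at x) = D"
  by (rule frechet_derivative_at[symmetric])

lemma has_derivative_tendsto:
  assumes "(f has_derivative D) (at x)" shows "(f \<longlongrightarrow> f x) (nhds x)"
  using has_derivative_continuous[OF assms] by (simp add: continuous_at tendsto_at_iff_tendsto_nhds)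

text \<open>Enough of an atlas for tangent spaces and differentials to behave as usual. It serves the
manifold and the Grassmannian bundle alike; for the latter only first derivatives of the transition maps are used.\<close>

definition diff_atlas :: "('a, 'e::real_normed_vector) chart set \<Rightarrow> bool" where
  "diff_atlas B \<longleftrightarrow>
     (\<forall>c\<in>B. inj_on (chart_map c) (chart_dom c)) \<and>
     (\<forall>c\<in>B. \<forall>c'\<in>B. open (chart_map c ` (chart_dom c \<inter> chart_dom c')) \<and>
        (\<forall>x\<in>chart_dom c \<inter> chart_dom c'.
           (chart_map c' \<circ> chart_inv c) differentiable (at (chart_map c x))))"

abbreviation trans_deriv :: "('a, 'e::real_normed_vector) chart \<Rightarrow> ('a, 'e) chart \<Rightarrow> 'a \<Rightarrow> 'e \<Rightarrow> 'e" where
  "trans_deriv c c' x \<equiv> frechet_derivative (chart_map c' \<circ> chart_inv c) (at (chart_map c x))"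

lemma chart_inv_map:
  "diff_atlas B \<Longrightarrow> c \<in> B \<Longrightarrow> x \<in> chart_dom c \<Longrightarrow> chart_inv c (chart_map c x) = x"
  by (simp add: diff_atlas_def chart_inv_def inv_into_f_f)

lemma chart_map_inv:
  "y \<in> chart_map c ` chart_dom c \<Longrightarrow> chart_map c (chart_inv c y) = y"
  by (simp add: chart_inv_def f_inv_into_f)

lemma chart_inv_in:
  "y \<in> chart_map c ` chart_dom c \<Longrightarrow> chart_inv c y \<in> chart_dom c"
  by (simp add: chart_inv_def inv_into_into)

lemma eventually_chart_overlap:
  assumes "diff_atlas B" "c \<in> B" "c' \<in> B" "x \<in> chart_dom c" "x \<in> chart_dom c'"
  shows "\<forall>\<^sub>F y in nhds (chart_map c x). y \<in> chart_map c ` (chart_dom c \<inter> chart_dom c')"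
  using assms by (intro eventually_nhds_in_open) (auto simp: diff_atlas_def)

lemma chart_overlapD:
  assumes "diff_atlas B" "c \<in> B" "y \<in> chart_map c ` (chart_dom c \<inter> chart_dom c')"
  shows "chart_inv c y \<in> chart_dom c" "chart_inv c y \<in> chart_dom c'"
    "chart_map c (chart_inv c y) = y"
  using assms by (auto simp: chart_inv_map)

lemma transition_has_derivative:
  assumes "diff_atlas B" "c \<in> B" "c' \<in> B" "x \<in> chart_dom c" "x \<in> chart_dom c'"
  shows "((\<lambda>y. chart_map c' (chart_inv c y)) has_derivative trans_deriv c c' x) (at (chart_map c x))"
  using assms unfolding diff_atlas_def by (simp add: frechet_derivative_works o_def)

lemma trans_deriv_linear:
  assumes "diff_atlas B" "c \<in> B" "c' \<in> B" "x \<in> chart_dom c" "x \<in> chart_dom c'"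
  shows "linear (trans_deriv c c' x)"
  using transition_has_derivative[OF assms] has_derivative_linear by blast

lemma trans_deriv_self:
  assumes "diff_atlas B" "c \<in> B" "x \<in> chart_dom c"
  shows "trans_deriv c c x = (\<lambda>w. w)"
proof (rule frechet_derivative_eqI, rule has_derivative_cong_nhds[OF has_derivative_ident])
  show "\<forall>\<^sub>F y in nhds (chart_map c x). y = (chart_map c \<circ> chart_inv c) y"
    using eventually_chart_overlap[OF assms(1,2,2,3,3)]
    by eventually_elim (auto simp: chart_map_inv)
qed

lemma trans_deriv_cocycle:
  assumes B: "diff_atlas B" and c: "c1 \<in> B" "c2 \<in> B" "c3 \<in> B"
    and x: "x \<in> chart_dom c1" "x \<in> chart_dom c2" "x \<in> chart_dom c3"
  shows "trans_deriv c1 c3 x w = trans_deriv c2 c3 x (trans_deriv c1 c2 x w)"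
proof -
  have "chart_map c2 (chart_inv c1 (chart_map c1 x)) = chart_map c2 x"
    using chart_inv_map[OF B c(1) x(1)] by simp
  then have h: "((\<lambda>y. chart_map c3 (chart_inv c2 (chart_map c2 (chart_inv c1 y)))) has_derivative
      (\<lambda>w. trans_deriv c2 c3 x (trans_deriv c1 c2 x w))) (at (chart_map c1 x))"
    using has_derivative_compose[OF transition_has_derivative[OF B c(1,2) x(1,2)]]
      transition_has_derivative[OF B c(2,3) x(2,3)] by simp
  have ev: "\<forall>\<^sub>F y in nhds (chart_map c1 x).
      chart_map c3 (chart_inv c2 (chart_map c2 (chart_inv c1 y))) = (chart_map c3 \<circ> chart_inv c1) y"
    using eventually_chart_overlap[OF B c(1,2) x(1,2)]
    by eventually_elim (simp add: chart_inv_map[OF B c(2)] chart_overlapD[OF B c(1)])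
  show ?thesis
    using fun_cong[OF frechet_derivative_eqI[OF has_derivative_cong_nhds[OF h ev]], of w] by (simp add: o_def)
qed

lemma trans_deriv_inverse:
  assumes "diff_atlas B" "c1 \<in> B" "c2 \<in> B" "x \<in> chart_dom c1" "x \<in> chart_dom c2"
  shows "trans_deriv c2 c1 x (trans_deriv c1 c2 x w) = w"
  using trans_deriv_cocycle[OF assms(1,2,3,2,4,5,4), of w] trans_deriv_self[OF assms(1,2,4)] by simp

lemma tangent_vec_apply:
  "c' \<in> B \<Longrightarrow> x \<in> chart_dom c' \<Longrightarrow> tangent_vec B c x w c' = trans_deriv c c' x w"
  by (simp add: tangent_vec_def)

lemma tangent_vec_self:
  "diff_atlas B \<Longrightarrow> c \<in> B \<Longrightarrow> x \<in> chart_dom c \<Longrightarrow> tangent_vec B c x w c = w"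
  by (simp add: tangent_vec_apply trans_deriv_self)

lemma tangent_vec_in:
  assumes "diff_atlas B" "c \<in> B" "x \<in> chart_dom c"
  shows "tangent_vec B c x w \<in> tangent_space B x"
  unfolding tangent_space_def mem_Collect_eq
proof (intro conjI ballI allI impI)
  fix c1 c2 assume "c1 \<in> B" "c2 \<in> B" "x \<in> chart_dom c1 \<and> x \<in> chart_dom c2"
  then show "tangent_vec B c x w c2 = trans_deriv c1 c2 x (tangent_vec B c x w c1)"
    using trans_deriv_cocycle[OF assms(1,2) _ _ assms(3), of c1 c2 w] by (simp add: tangent_vec_apply)
next
  fix c1 assume "\<not> (c1 \<in> B \<and> x \<in> chart_dom c1)"
  then show "tangent_vec B c x w c1 = 0" unfolding tangent_vec_def by (rule if_not_P)
qed

lemma tangent_space_apply: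
  assumes "c \<in> B" "x \<in> chart_dom c" "c' \<in> B" "x \<in> chart_dom c'" "v \<in> tangent_space B x"
  shows "v c' = trans_deriv c c' x (v c)"
  using assms unfolding tangent_space_def by blast

lemma tangent_space_outside:
  "v \<in> tangent_space B x \<Longrightarrow> \<not> (c \<in> B \<and> x \<in> chart_dom c) \<Longrightarrow> v c = 0"
  unfolding tangent_space_def by blast

lemma tangent_vec_of:
  assumes "c \<in> B" "x \<in> chart_dom c" "v \<in> tangent_space B x"
  shows "tangent_vec B c x (v c) = v"
proof
  fix c'
  show "tangent_vec B c x (v c) c' = v c'"
  proof (cases "c' \<in> B \<and> x \<in> chart_dom c'")
    case True
    then show ?thesis using tangent_space_apply[OF assms(1,2) _ _ assms(3), of c', symmetric]
      by (simp add: tangent_vec_apply)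
  next
    case False
    then show ?thesis using tangent_space_outside[OF assms(3) False] by (auto simp: tangent_vec_def)
  qed
qed

lemma tangent_space_eqI:
  assumes "c \<in> B" "x \<in> chart_dom c" "v \<in> tangent_space B x" "w \<in> tangent_space B x" "v c = w c"
  shows "v = w"
  using tangent_vec_of[OF assms(1-3)] unfolding assms(5) tangent_vec_of[OF assms(1,2,4)] by simp

lemma tangent_vec_linear:
  assumes "diff_atlas B" "c \<in> B" "x \<in> chart_dom c"
  shows "linear (tangent_vec B c x)"
proof (rule linearI)
  note lin = trans_deriv_linear[OF assms(1,2) _ assms(3)]
  show "tangent_vec B c x (u + v) = tangent_vec B c x u + tangent_vec B c x v" for u v
    using lin by (auto simp: tangent_vec_def fun_eq_iff linear_add)
  show "tangent_vec B c x (r *\<^sub>R v) = r *\<^sub>R tangent_vec B c x v" for r v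
    using lin by (auto simp: tangent_vec_def fun_eq_iff linear_cmul)
qed

lemma tangent_vec_image:
  assumes "diff_atlas B" "c \<in> B" "x \<in> chart_dom c"
  shows "range (tangent_vec B c x) = tangent_space B x"
proof (intro equalityI subsetI)
  fix v assume "v \<in> tangent_space B x"
  then show "v \<in> range (tangent_vec B c x)"
    by (intro range_eqI[where x = "v c"] tangent_vec_of[OF assms(2,3), symmetric])
qed (use tangent_vec_in[OF assms] in auto)

lemma tangent_vec_inj:
  assumes "diff_atlas B" "c \<in> B" "x \<in> chart_dom c"
  shows "inj (tangent_vec B c x)"
  by (rule injI) (metis tangent_vec_self[OF assms])

lemma tangent_space_subspace:
  assumes "diff_atlas B" "c \<in> B" "x \<in> chart_dom c"
  shows "subspace (tangent_space B x)"
  using linear_subspace_image[OF tangent_vec_linear[OF assms] subspace_UNIV] tangent_vec_image[OF assms] by simp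

lemma dim_injective_image:
  fixes f :: "'v::euclidean_space \<Rightarrow> 'w::real_vector"
  assumes "linear f" "inj f"
  shows "dim (f ` S) = dim S"
proof -
  obtain b where b: "b \<subseteq> S" "independent b" "S \<subseteq> span b" "card b = dim S"
    using basis_exists by blast
  have "dim (f ` S) = card (f ` b)"
  proof (rule dim_unique)
    show "f ` S \<subseteq> span (f ` b)" using b(3) linear_span_image[OF assms(1), of b] by auto
    show "independent (f ` b)"
      using linear_independent_injective_image[OF assms(1) b(2)] assms(2) inj_on_subset by blast
  qed (use b in auto)
  also have "\<dots> = card b" using assms(2) card_image inj_on_subset by blast
  finally show ?thesis using b(4) by simp
qed

lemma chart_at_in:
  "c \<in> A \<Longrightarrow> q \<in> chart_dom c \<Longrightarrow> chart_at A q \<in> A \<and> q \<in> chart_dom (chart_at A q)"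
  unfolding chart_at_def by (rule someI) auto

definition diff_map_in_charts where
  "diff_map_in_charts c c' f q \<longleftrightarrow>
     (\<forall>\<^sub>F y in nhds (chart_map c q). f (chart_inv c y) \<in> chart_dom c') \<and>
     (\<lambda>y. chart_map c' (f (chart_inv c y))) differentiable (at (chart_map c q))"

text \<open>Differentiability of a map is witnessed by one pair of charts, while its differential is defined by a pair
chosen otherwise; the chain rule connects the two.\<close>

lemma diff_map_change_charts:
  assumes A: "diff_atlas A" and B: "diff_atlas B"
    and c: "c1 \<in> A" "c \<in> A" "c1' \<in> B" "c' \<in> B"
    and q: "q \<in> chart_dom c1" "q \<in> chart_dom c" "f q \<in> chart_dom c1'" "f q \<in> chart_dom c'"
    and d: "diff_map_in_charts c1 c1' f q"
  shows "diff_map_in_charts c c' f q"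
    and "frechet_derivative (\<lambda>y. chart_map c' (f (chart_inv c y))) (at (chart_map c q)) w =
      trans_deriv c1' c' (f q) (frechet_derivative (\<lambda>y. chart_map c1' (f (chart_inv c1 y)))
        (at (chart_map c1 q)) (trans_deriv c c1 q w))"
proof -
  let ?t = "\<lambda>y. chart_map c1 (chart_inv c y)"
  let ?h1 = "\<lambda>y. chart_map c1' (f (chart_inv c1 y))"
  let ?D = "\<lambda>w. frechet_derivative ?h1 (at (chart_map c1 q)) (trans_deriv c c1 q w)"
  note t = transition_has_derivative[OF A c(2,1) q(2,1)]
  note ev = eventually_chart_overlap[OF A c(2,1) q(2,1)]
  have t0: "?t (chart_map c q) = chart_map c1 q" using chart_inv_map[OF A c(2) q(2)] by simp
  have t_lim: "(?t \<longlongrightarrow> chart_map c1 q) (nhds (chart_map c q))"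
    using has_derivative_tendsto[OF t] t0 by simp
  have t_inv: "\<forall>\<^sub>F y in nhds (chart_map c q). chart_inv c1 (?t y) = chart_inv c y"
    using ev by eventually_elim (simp add: chart_inv_map[OF A c(1)] chart_overlapD[OF A c(2)])
  have "\<forall>\<^sub>F y in nhds (chart_map c q). f (chart_inv c1 (?t y)) \<in> chart_dom c1'"
    using d t_lim by (auto simp: diff_map_in_charts_def filterlim_iff)
  with t_inv have dom1: "\<forall>\<^sub>F y in nhds (chart_map c q). f (chart_inv c y) \<in> chart_dom c1'"
    by eventually_elim simp
  have "(?h1 has_derivative frechet_derivative ?h1 (at (chart_map c1 q))) (at (?t (chart_map c q)))"
    using d t0 by (simp add: diff_map_in_charts_def frechet_derivative_works)
  then have "((\<lambda>y. ?h1 (?t y)) has_derivative ?D) (at (chart_map c q))"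
    by (rule has_derivative_compose[OF t])
  then have h: "((\<lambda>y. chart_map c1' (f (chart_inv c y))) has_derivative ?D) (at (chart_map c q))"
    by (rule has_derivative_cong_nhds) (use t_inv in eventually_elim, simp)
  have h0: "chart_map c1' (f (chart_inv c (chart_map c q))) = chart_map c1' (f q)"
    using chart_inv_map[OF A c(2) q(2)] by simp
  have h_lim: "((\<lambda>y. chart_map c1' (f (chart_inv c y))) \<longlongrightarrow> chart_map c1' (f q)) (nhds (chart_map c q))"
    using has_derivative_tendsto[OF h] h0 by simp
  have "\<forall>\<^sub>F y in nhds (chart_map c q).
      chart_map c1' (f (chart_inv c y)) \<in> chart_map c1' ` (chart_dom c1' \<inter> chart_dom c')"
    using eventually_chart_overlap[OF B c(3,4) q(3,4)] h_lim by (auto simp: filterlim_iff)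
  with dom1 have dom: "\<forall>\<^sub>F y in nhds (chart_map c q). f (chart_inv c y) \<in> chart_dom c1' \<inter> chart_dom c'"
  proof eventually_elim
    case (elim y)
    then obtain p where p: "p \<in> chart_dom c1'" "p \<in> chart_dom c'"
        "chart_map c1' p = chart_map c1' (f (chart_inv c y))" by auto
    moreover have "p = f (chart_inv c y)"
      using chart_inv_map[OF B c(3)] p(1,3) elim(1) by metis
    ultimately show ?case by simp
  qed
  have "((\<lambda>y. chart_map c' (chart_inv c1' y)) has_derivative trans_deriv c1' c' (f q))
      (at (chart_map c1' (f (chart_inv c (chart_map c q)))))"
    using transition_has_derivative[OF B c(3,4) q(3,4)] h0 by simp
  from has_derivative_compose[OF h this]
  have "((\<lambda>y. chart_map c' (f (chart_inv c y))) has_derivative (\<lambda>w. trans_deriv c1' c' (f q) (?D w)))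
      (at (chart_map c q))"
    by (rule has_derivative_cong_nhds) (use dom in eventually_elim, simp add: chart_inv_map[OF B c(3)])
  then show "frechet_derivative (\<lambda>y. chart_map c' (f (chart_inv c y))) (at (chart_map c q)) w =
      trans_deriv c1' c' (f q) (?D w)"
    and "diff_map_in_charts c c' f q"
    using dom by (auto simp: frechet_derivative_eqI diff_map_in_charts_def differentiable_def
      elim: eventually_mono)
qed

lemma differential_in_tangent_space:
  assumes "diff_atlas B" "c' \<in> B" "f q \<in> chart_dom c'" "v \<in> tangent_space A q"
  shows "differential A B f q v \<in> tangent_space B (f q)"
  using tangent_vec_in[OF assms(1)] chart_at_in[OF assms(2,3)] assms(4)
  by (simp add: differential_def Let_def)

lemma differential_apply:
  assumes A: "diff_atlas A" and B: "diff_atlas B"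
    and c: "c \<in> A" "c' \<in> B" and q: "q \<in> chart_dom c" "f q \<in> chart_dom c'"
    and d: "diff_map_in_charts c c' f q" and v: "v \<in> tangent_space A q"
  shows "differential A B f q v c' =
    frechet_derivative (\<lambda>y. chart_map c' (f (chart_inv c y))) (at (chart_map c q)) (v c)"
proof -
  let ?c0 = "chart_at A q" and ?c1 = "chart_at B (f q)"
  have c0: "?c0 \<in> A" "q \<in> chart_dom ?c0" and c1: "?c1 \<in> B" "f q \<in> chart_dom ?c1"
    using chart_at_in[OF c(1) q(1)] chart_at_in[OF c(2) q(2)] by simp_all
  have d0: "diff_map_in_charts ?c0 ?c1 f q"
    by (rule diff_map_change_charts(1)[OF A B c(1) c0(1) c(2) c1(1) q(1) c0(2) q(2) c1(2) d])
  show ?thesis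
    using diff_map_change_charts(2)[OF A B c0(1) c(1) c1(1) c(2) c0(2) q(1) c1(2) q(2) d0, of "v c"]
      tangent_space_apply[OF c(1) q(1) c0 v] v
    by (simp add: differential_def Let_def tangent_vec_apply[OF c(2) q(2)] o_def)
qed

lemma smooth_manifold_chart_open_iff:
  assumes "smooth_manifold T A" "c \<in> A" "W \<subseteq> chart_dom c"
  shows "openin T W \<longleftrightarrow> open (chart_map c ` W)"
proof -
  have dom: "openin T (chart_dom c)" and img: "open (chart_map c ` chart_dom c)"
    and hom: "homeomorphic_map (subtopology T (chart_dom c))
      (top_of_set (chart_map c ` chart_dom c)) (chart_map c)"
    using assms(1,2) by (auto simp: smooth_manifold_def)
  have "topspace (subtopology T (chart_dom c)) = chart_dom c"
    using openin_subset[OF dom] by auto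
  then have "openin (top_of_set (chart_map c ` chart_dom c)) (chart_map c ` W) \<longleftrightarrow>
      openin (subtopology T (chart_dom c)) W"
    using homeomorphic_map_openness[OF hom, of W] assms(3) by simp
  then show ?thesis
    using openin_open_subtopology[OF dom] openin_open_eq[OF img] assms(3) by (metis image_mono)
qed

lemma smooth_manifold_diff_atlas:
  assumes M: "smooth_manifold T A" shows "diff_atlas A"
  unfolding diff_atlas_def
proof (intro conjI ballI)
  fix c assume c: "c \<in> A"
  have hom: "homeomorphic_map (subtopology T (chart_dom c))
      (top_of_set (chart_map c ` chart_dom c)) (chart_map c)" and "openin T (chart_dom c)"
    using M c by (auto simp: smooth_manifold_def)
  then show "inj_on (chart_map c) (chart_dom c)"
    using homeomorphic_imp_injective_map[OF hom] openin_subset[of T "chart_dom c"]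
    by (simp add: Int_absorb1)
next
  fix c c' assume c: "c \<in> A" "c' \<in> A"
  then have "openin T (chart_dom c \<inter> chart_dom c')"
    using M by (auto simp: smooth_manifold_def)
  then show op: "open (chart_map c ` (chart_dom c \<inter> chart_dom c'))"
    using smooth_manifold_chart_open_iff[OF M c(1)] by simp
  fix x assume "x \<in> chart_dom c \<inter> chart_dom c'"
  then show "(chart_map c' \<circ> chart_inv c) differentiable (at (chart_map c x))"
    using M c by (intro smooth_on_differentiable[OF _ op]) (auto simp: smooth_manifold_def)
qed

section \<open>Standard charts of the Grassmannian bundle\<close>

lemma differentiable_prod:
  fixes f :: "'i \<Rightarrow> 'a::real_normed_vector \<Rightarrow> real"
  shows "finite I \<Longrightarrow> (\<And>i. i \<in> I \<Longrightarrow> f i differentiable (at x)) \<Longrightarrow>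
    (\<lambda>x. \<Prod>i\<in>I. f i x) differentiable (at x)"
  by (induction I rule: finite_induct) (simp_all add: differentiable_mult)

lemma differentiable_det:
  fixes M :: "'a::real_normed_vector \<Rightarrow> real^'n^'n"
  assumes "\<And>i j. (\<lambda>x. M x $ i $ j) differentiable (at x)"
  shows "(\<lambda>x. Determinants.det (M x)) differentiable (at x)"
  unfolding Determinants.det_def
  by (intro differentiable_sum ballI differentiable_mult differentiable_const differentiable_prod assms)
    (simp_all add: finite_permutations)

lemma differentiable_matrixI:
  fixes F :: "'a::real_normed_vector \<Rightarrow> real^'n^'m"
  assumes "\<And>i j. (\<lambda>x. F x $ i $ j) differentiable (at x)"
  shows "F differentiable (at x)"
proof -
  have "(\<lambda>x. F x \<bullet> b) differentiable (at x)" if b: "b \<in> Basis" for b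
  proof -
    obtain i j where "b = axis i (axis j 1)" using b by (auto simp: Basis_vec_def)
    then show ?thesis using assms[of i j] by (simp add: inner_axis)
  qed
  then show ?thesis by (subst differentiable_componentwise_within) simp
qed

text \<open>This is \<open>K M\<^sup>-\<^sup>1\<close>, written with Cramer's rule so that its differentiability follows from that of
determinants.\<close>

definition right_quotient :: "real^'n^'n \<Rightarrow> real^'n^'m \<Rightarrow> real^'n^'m" where
  "right_quotient M K =
     (\<chi> i k. Determinants.det (\<chi> r s. if s = k then K $ i $ r else M $ s $ r)
       / Determinants.det (Finite_Cartesian_Product.transpose M))"

lemma right_quotient:
  assumes "Determinants.det M \<noteq> 0"
  shows "right_quotient M K ** M = K"
proof -
  have "right_quotient M K $ i = (\<chi> k. Determinants.det (\<chi> r s. if s = k then K $ i $ r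
      else Finite_Cartesian_Product.transpose M $ r $ s) / Determinants.det (Finite_Cartesian_Product.transpose M))" for i
    by (simp add: right_quotient_def Finite_Cartesian_Product.transpose_def vec_eq_iff cong: if_cong)
  then have "Finite_Cartesian_Product.transpose M *v (right_quotient M K $ i) = K $ i" for i
    using cramer[of "Finite_Cartesian_Product.transpose M" "right_quotient M K $ i" "K $ i"] assms
    by (simp add: Determinants.det_transpose)
  then have "(Finite_Cartesian_Product.transpose M *v (right_quotient M K $ i)) $ r = K $ i $ r" for i r
    by simp
  then show ?thesis
    by (simp add: vec_eq_iff matrix_matrix_mult_def matrix_vector_mult_def
        Finite_Cartesian_Product.transpose_def mult.commute)
qed

lemma differentiable_right_quotient:
  fixes M :: "'a::real_normed_vector \<Rightarrow> real^'n^'n" and K :: "'a \<Rightarrow> real^'n^'m"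
  assumes "\<And>i j. (\<lambda>x. M x $ i $ j) differentiable (at x)" "\<And>i j. (\<lambda>x. K x $ i $ j) differentiable (at x)"
    and "Determinants.det (M x) \<noteq> 0"
  shows "(\<lambda>x. right_quotient (M x) (K x)) differentiable (at x)"
proof (rule differentiable_matrixI)
  fix i k
  have "(\<lambda>x. Determinants.det (\<chi> r s. if s = k then K x $ i $ r else M x $ s $ r)
      / Determinants.det (M x)) differentiable (at x)"
  proof (intro differentiable_divide differentiable_det assms)
    fix r s
    show "(\<lambda>x. (\<chi> r s. if s = k then K x $ i $ r else M x $ s $ r) $ r $ s) differentiable (at x)"
      using assms(1,2) by (cases "s = k") simp_all
  qed
  then show "(\<lambda>x. right_quotient (M x) (K x) $ i $ k) differentiable (at x)"
    by (simp add: right_quotient_def Determinants.det_transpose)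
qed

text \<open>The image of a linear map into a product is a graph over the first factor exactly if its first component
is invertible.\<close>

lemma graph_of_linear:
  fixes S :: "real^'n \<Rightarrow> (real^'n) \<times> (real^'m)"
  assumes "linear S" "inj S"
  shows "range S = {p. snd p = G *v fst p} \<Longrightarrow> inj (\<lambda>u. fst (S u))"
    and "inj (\<lambda>u. fst (S u)) \<Longrightarrow> (\<And>u. G *v fst (S u) = snd (S u)) \<Longrightarrow> range S = {p. snd p = G *v fst p}"
proof -
  have lin: "linear (\<lambda>u. fst (S u))" using linear_compose[OF assms(1) linear_fst] by (simp add: o_def)
  {
    assume graph: "range S = {p. snd p = G *v fst p}"
    show "inj (\<lambda>u. fst (S u))"
    proof (subst linear_injective_0[OF lin], intro allI impI)
      fix u assume "fst (S u) = 0"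
      moreover have "snd (S u) = G *v fst (S u)" using graph by auto
      ultimately have "S u = S 0" using linear_0[OF assms(1)] by (simp add: prod_eq_iff)
      then show "u = 0" using assms(2) by (simp add: inj_def)
    qed
  next
    assume inj: "inj (\<lambda>u. fst (S u))" and G: "\<And>u. G *v fst (S u) = snd (S u)"
    have surj: "surj (\<lambda>u. fst (S u))" by (rule linear_injective_imp_surjective[OF lin inj refl])
    show "range S = {p. snd p = G *v fst p}"
    proof (intro equalityI subsetI)
      fix p assume p: "p \<in> {p. snd p = G *v fst p}"
      obtain u where u: "fst p = fst (S u)" using surj by (metis surjD)
      then have "p = S u" using p G[of u] by (simp add: prod_eq_iff)
      then show "p \<in> range S" by simp
    qed (use G in auto)
  }
qed

abbreviation linv :: "('v \<Rightarrow> 'w) \<Rightarrow> 'w \<Rightarrow> 'v" where "linv g \<equiv> inv_into UNIV g"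

lemma linear_inv_bij:
  assumes "linear g" "bij g" shows "linear (linv g)"
proof (rule linearI)
  have gi: "g (linv g y) = y" for y using assms(2) by (simp add: bij_is_surj surj_f_inv_f)
  have ig: "linv g (g y) = y" for y using assms(2) by (simp add: bij_is_inj)
  show "linv g (x + y) = linv g x + linv g y" for x y
    using ig[of "linv g x + linv g y"] by (simp add: linear_add[OF assms(1)] gi)
  show "linv g (r *\<^sub>R x) = r *\<^sub>R linv g x" for r x
    using ig[of "r *\<^sub>R linv g x"] by (simp add: linear_cmul[OF assms(1)] gi)
qed

abbreviation graph_set :: "('e \<Rightarrow> (real^'d) \<times> (real^2)) \<Rightarrow> real^'d^2 \<Rightarrow> 'e set" where
  "graph_set g G \<equiv> {w. snd (g w) = G *v fst (g w)}"

definition graph_plane ::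
  "('a, 'e::real_normed_vector) chart set \<Rightarrow> ('a, 'e) chart \<Rightarrow> ('e \<Rightarrow> (real^'d) \<times> (real^2)) \<Rightarrow> 'a
     \<Rightarrow> real^'d^2 \<Rightarrow> ('a, 'e) tvec set" where
  "graph_plane A c g q G = tangent_vec A c q ` graph_set g G"

lemma bij_inv_apply: "bij g \<Longrightarrow> g (linv g p) = p" "bij g \<Longrightarrow> linv g (g w) = w"
  by (simp_all add: bij_is_surj surj_f_inv_f bij_is_inj)

lemma graph_set_eq_range:
  assumes "bij g" shows "graph_set g G = range (\<lambda>u. linv g (u, G *v u))"
proof (intro equalityI subsetI)
  fix w assume "w \<in> graph_set g G"
  then have "(fst (g w), G *v fst (g w)) = g w" by (simp add: prod_eq_iff)
  then show "w \<in> range (\<lambda>u. linv g (u, G *v u))"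
    by (intro range_eqI[where x = "fst (g w)"]) (simp only: bij_inv_apply(2)[OF assms])
next
  fix w assume "w \<in> range (\<lambda>u. linv g (u, G *v u))"
  then show "w \<in> graph_set g G" by (elim rangeE) (simp add: bij_inv_apply(1)[OF assms])
qed

lemma graph_set_inj:
  assumes "bij g" "graph_set g G = graph_set g G'" shows "G = G'"
proof -
  have "G *v u = G' *v u" for u
  proof -
    have "linv g (u, G *v u) \<in> graph_set g G" by (simp add: bij_inv_apply[OF assms(1)])
    then show ?thesis unfolding assms(2) by (simp add: bij_inv_apply[OF assms(1)])
  qed
  then show ?thesis by (simp add: matrix_eq)
qed

lemma linear_graph_map:
  fixes g :: "'e::real_vector \<Rightarrow> (real^'d) \<times> (real^2)"
  assumes "linear g" "bij g" shows "linear (\<lambda>u. linv g (u, G *v u))"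
proof -
  have "linear (\<lambda>u. (u, G *v u))"
    using linear_add[OF matrix_vector_mul_linear[of G]] linear_cmul[OF matrix_vector_mul_linear[of G]]
    by (intro linearI) simp_all
  then show ?thesis using linear_compose[OF _ linear_inv_bij[OF assms]] by (simp add: o_def)
qed

lemma dim_graph_set:
  fixes g :: "'e::euclidean_space \<Rightarrow> (real^'d) \<times> (real^2)"
  assumes "linear g" "bij g" shows "subspace (graph_set g G)" "dim (graph_set g G) = CARD('d)"
proof -
  have inj: "inj (\<lambda>u. linv g (u, G *v u))"
    using assms(2) by (intro injI) (metis bij_inv_apply(1) prod.inject)
  show "subspace (graph_set g G)"
    unfolding graph_set_eq_range[OF assms(2)]
    by (rule linear_subspace_image[OF linear_graph_map[OF assms] subspace_UNIV])
  show "dim (graph_set g G) = CARD('d)"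
    unfolding graph_set_eq_range[OF assms(2)]
    by (simp add: dim_injective_image[OF linear_graph_map[OF assms] inj])
qed

context
  fixes T :: "'a topology" and A :: "('a, 'e::euclidean_space) chart set"
  assumes A: "diff_atlas A" and A_top: "\<Union>(chart_dom ` A) \<subseteq> topspace T"
begin

lemma gr_graph_graph_plane:
  assumes "c \<in> A" "q \<in> chart_dom c" shows "gr_graph c g (graph_plane A c g q G) G"
  unfolding gr_graph_def graph_plane_def using tangent_vec_self[OF A assms] by (simp add: image_image)

lemma gr_graph_imp_graph_plane:
  assumes "c \<in> A" "q \<in> chart_dom c" "D \<subseteq> tangent_space A q" "gr_graph c g D G"
  shows "D = graph_plane A c g q G"
proof -
  have "D = (\<lambda>v. tangent_vec A c q (v c)) ` D"
  proof -
    have "(\<lambda>v. tangent_vec A c q (v c)) ` D = (\<lambda>v. v) ` D"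
      by (rule image_cong) (use tangent_vec_of[OF assms(1,2)] assms(3) in auto)
    then show ?thesis by simp
  qed
  also have "\<dots> = tangent_vec A c q ` ((\<lambda>v. v c) ` D)" by (simp add: image_image)
  finally show ?thesis using assms(4) unfolding gr_graph_def graph_plane_def by simp
qed

lemma graph_plane_in_gr_bundle:
  fixes g :: "'e \<Rightarrow> (real^'d) \<times> (real^2)"
  assumes "c \<in> A" "q \<in> chart_dom c" "linear g" "bij g"
  shows "(q, graph_plane A c g q G) \<in> gr_bundle T A CARD('d)"
  unfolding gr_bundle_def graph_plane_def
  using subsetD[OF A_top UN_I[where B = chart_dom, OF assms(1,2)]] tangent_vec_in[OF A assms(1,2)] dim_graph_set[OF assms(3,4), of G]
    linear_subspace_image[OF tangent_vec_linear[OF A assms(1,2)]]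
    dim_injective_image[OF tangent_vec_linear[OF A assms(1,2)] tangent_vec_inj[OF A assms(1,2)]]
  by (simp add: image_subset_iff)

lemma gr_chart_dom_iff:
  fixes g :: "'e \<Rightarrow> (real^'d) \<times> (real^2)"
  assumes "c \<in> A" "linear g" "bij g"
  shows "x \<in> chart_dom (gr_chart T A c g) \<longleftrightarrow> (\<exists>q G. q \<in> chart_dom c \<and> x = (q, graph_plane A c g q G))"
proof
  assume "x \<in> chart_dom (gr_chart T A c g)"
  then obtain q D G where "x = (q, D)" "(q, D) \<in> gr_bundle T A CARD('d)" "q \<in> chart_dom c" "gr_graph c g D G"
    by (auto simp: gr_chart_def)
  moreover from this have "D = graph_plane A c g q G"
    by (intro gr_graph_imp_graph_plane[OF assms(1)]) (auto simp: gr_bundle_def)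
  ultimately show "\<exists>q G. q \<in> chart_dom c \<and> x = (q, graph_plane A c g q G)" by blast
next
  assume "\<exists>q G. q \<in> chart_dom c \<and> x = (q, graph_plane A c g q G)"
  then show "x \<in> chart_dom (gr_chart T A c g)"
  proof (elim exE conjE)
    fix q G assume "q \<in> chart_dom c" "x = (q, graph_plane A c g q G)"
    then show ?thesis
      using graph_plane_in_gr_bundle[OF assms(1) _ assms(2,3), of q G]
        exI[where P = "gr_graph c g _", OF gr_graph_graph_plane[OF assms(1), of q g G]]
      by (simp add: gr_chart_def)
  qed
qed

lemma gr_chart_map:
  fixes g :: "'e \<Rightarrow> (real^'d) \<times> (real^2)"
  assumes "c \<in> A" "q \<in> chart_dom c" "bij g"
  shows "chart_map (gr_chart T A c g) (q, graph_plane A c g q G) = (chart_map c q, G)"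
proof -
  have "(THE G'. gr_graph c g (graph_plane A c g q G) G') = G"
    using gr_graph_graph_plane[OF assms(1,2), of g G] graph_set_inj[OF assms(3)]
    by (intro the_equality) (auto simp: gr_graph_def)
  then show ?thesis by (simp add: gr_chart_def)
qed

lemma gr_chart_inj:
  fixes g :: "'e \<Rightarrow> (real^'d) \<times> (real^2)"
  assumes "c \<in> A" "linear g" "bij g"
  shows "inj_on (chart_map (gr_chart T A c g)) (chart_dom (gr_chart T A c g))"
proof (rule inj_onI)
  fix x y assume xy: "x \<in> chart_dom (gr_chart T A c g)" "y \<in> chart_dom (gr_chart T A c g)"
    "chart_map (gr_chart T A c g) x = chart_map (gr_chart T A c g) y"
  from xy(1,2) show "x = y"
    unfolding gr_chart_dom_iff[OF assms]
  proof (elim exE conjE)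
    fix q G q' G'
    assume x: "q \<in> chart_dom c" "x = (q, graph_plane A c g q G)"
      and y: "q' \<in> chart_dom c" "y = (q', graph_plane A c g q' G')"
    have "(chart_map c q, G) = (chart_map c q', G')"
      using xy(3) unfolding x(2) y(2) gr_chart_map[OF assms(1) x(1) assms(3)] gr_chart_map[OF assms(1) y(1) assms(3)] .
    then have "chart_inv c (chart_map c q) = chart_inv c (chart_map c q')" "G = G'" by simp_all
    then show "x = y"
      unfolding x(2) y(2) chart_inv_map[OF A assms(1) x(1)] chart_inv_map[OF A assms(1) y(1)] by simp
  qed
qed

lemma gr_chart_inv:
  fixes g :: "'e \<Rightarrow> (real^'d) \<times> (real^2)"
  assumes "c \<in> A" "linear g" "bij g" "z \<in> chart_map c ` chart_dom c"
  shows "chart_inv (gr_chart T A c g) (z, G) = (chart_inv c z, graph_plane A c g (chart_inv c z) G)"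
    (is "_ = ?x")
proof -
  have q: "chart_inv c z \<in> chart_dom c" using assms(4) by (rule chart_inv_in)
  have x: "?x \<in> chart_dom (gr_chart T A c g)"
    unfolding gr_chart_dom_iff[OF assms(1-3)] using q by blast
  have "chart_map (gr_chart T A c g) ?x = (z, G)"
    using gr_chart_map[OF assms(1) q assms(3)] chart_map_inv[OF assms(4)] by simp
  then show ?thesis
    using inv_into_f_f[OF gr_chart_inj[OF assms(1-3)] x] by (simp add: chart_inv_def[of "gr_chart T A c g"])
qed

end

lemma differentiable_cong_nhds:
  "f differentiable (at x) \<Longrightarrow> \<forall>\<^sub>F y in nhds x. f y = g y \<Longrightarrow> g differentiable (at x)"
  unfolding differentiable_def by (elim exE) (rule exI, rule has_derivative_cong_nhds)

lemma differentiable_Pair: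
  "f differentiable (at x) \<Longrightarrow> g differentiable (at x) \<Longrightarrow> (\<lambda>y. (f y, g y)) differentiable (at x)"
  unfolding differentiable_def by (elim exE) (rule exI, rule has_derivative_Pair)

text \<open>Expanding in a basis separates the dependence of the linear map on the parameter from that of its
argument.\<close>

lemma linear_family_differentiable:
  fixes F :: "'z::real_normed_vector \<Rightarrow> 'e::euclidean_space \<Rightarrow> 'f::real_normed_vector"
  assumes Z: "open Z" "z \<in> Z" and lin: "\<And>y. y \<in> Z \<Longrightarrow> linear (F y)"
    and F: "\<And>w. (\<lambda>y. F y w) differentiable (at z)" and h: "h differentiable (at G)"
  shows "(\<lambda>y. F (fst y) (h (snd y))) differentiable (at (z, G))"
proof (rule differentiable_cong_nhds)
  have fst: "fst differentiable (at (z, G))" and snd: "snd differentiable (at (z, G))"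
    by (auto intro: bounded_linear_imp_differentiable bounded_linear_fst bounded_linear_snd)
  have hs: "(\<lambda>y. h (snd y)) differentiable (at (z, G))"
    by (rule differentiable_compose[OF _ snd]) (simp add: h)
  have Fs: "(\<lambda>y. F (fst y) b) differentiable (at (z, G))" for b
    by (rule differentiable_compose[OF _ fst, where f = "\<lambda>y. F y b"]) (simp add: F)
  have hi: "(\<lambda>y. h (snd y) \<bullet> b) differentiable (at (z, G))" for b
    by (rule differentiable_compose[OF bounded_linear_imp_differentiable[OF bounded_linear_inner_left] hs])
  show "(\<lambda>y. \<Sum>b\<in>Basis. (h (snd y) \<bullet> b) *\<^sub>R F (fst y) b) differentiable (at (z, G))"
    by (intro differentiable_sum ballI differentiable_scaleR hi Fs finite_Basis)
  have "\<forall>\<^sub>F y in nhds (z, G). y \<in> Z \<times> UNIV"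
    by (rule eventually_nhds_in_open) (use Z in \<open>auto intro: open_Times\<close>)
  then show "\<forall>\<^sub>F y in nhds (z, G).
      (\<Sum>b\<in>Basis. (h (snd y) \<bullet> b) *\<^sub>R F (fst y) b) = F (fst y) (h (snd y))"
  proof eventually_elim
    case (elim y)
    have l: "linear (F (fst y))" using elim by (intro lin) auto
    show ?case
      by (subst (2) euclidean_representation[symmetric]) (simp add: linear_sum[OF l] linear_cmul[OF l])
  qed
qed

lemma range_linv_eq_graph_set:
  assumes "bij g"
  shows "range (\<lambda>u. linv g (S u)) = graph_set g G \<longleftrightarrow> range S = {p. snd p = G *v fst p}"
proof -
  have "g ` range (\<lambda>u. linv g (S u)) = range S"
    by (simp add: image_image bij_inv_apply(1)[OF assms])
  moreover have "g ` graph_set g G = {p. snd p = G *v fst p}"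
  proof (intro equalityI subsetI)
    fix p assume "p \<in> {p. snd p = G *v fst p}"
    then show "p \<in> g ` graph_set g G"
      by (intro image_eqI[where x = "linv g p"]) (simp_all add: bij_inv_apply(1)[OF assms])
  qed auto
  ultimately show ?thesis
    using inj_image_eq_iff[OF bij_is_inj[OF assms], of "range (\<lambda>u. linv g (S u))" "graph_set g G"] by simp
qed

context
  fixes T :: "'a topology" and A :: "('a, 'e::euclidean_space) chart set"
  assumes M: "smooth_manifold T A"
begin

lemma A_diff: "diff_atlas A" by (rule smooth_manifold_diff_atlas[OF M])

lemma chart_dom_subset: "\<Union>(chart_dom ` A) \<subseteq> topspace T"
  using M unfolding smooth_manifold_def by blast

lemma open_overlap: "c \<in> A \<Longrightarrow> c' \<in> A \<Longrightarrow> open (chart_map c ` (chart_dom c \<inter> chart_dom c'))"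
  using A_diff by (simp add: diff_atlas_def)

lemma smooth_transition:
  "c \<in> A \<Longrightarrow> c' \<in> A \<Longrightarrow> smooth_on (chart_map c ` (chart_dom c \<inter> chart_dom c')) (chart_map c' \<circ> chart_inv c)"
  using M by (simp add: smooth_manifold_def)

lemma trans_deriv_inj:
  "c \<in> A \<Longrightarrow> c' \<in> A \<Longrightarrow> q \<in> chart_dom c \<Longrightarrow> q \<in> chart_dom c' \<Longrightarrow> inj (trans_deriv c c' q)"
  by (rule inj_on_inverseI[where g = "trans_deriv c' c q"]) (rule trans_deriv_inverse[OF A_diff])

text \<open>If the isomorphism between the two models of the tangent space has the block rows \<open>M\<close>, \<open>K\<close> along
  the graph of \<open>G\<close>, then the image of the graph is the graph of \<open>K M\<^sup>-\<^sup>1\<close>, and it is a graph at all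
  exactly where \<open>M\<close> is invertible.\<close>

lemma gr_transition:
  fixes g g' :: "'e \<Rightarrow> (real^'d) \<times> (real^2)"
  assumes c: "c \<in> A" "c' \<in> A" and g: "linear g" "bij g" and g': "linear g'" "bij g'"
  defines "C \<equiv> gr_chart T A c g" and "C' \<equiv> gr_chart T A c' g'"
  shows "open (chart_map C ` (chart_dom C \<inter> chart_dom C'))"
    and "x \<in> chart_dom C \<Longrightarrow> x \<in> chart_dom C' \<Longrightarrow> (chart_map C' \<circ> chart_inv C) differentiable (at (chart_map C x))"
proof -
  define Z where "Z = chart_map c ` (chart_dom c \<inter> chart_dom c')"
  define TD where "TD z = frechet_derivative (chart_map c' \<circ> chart_inv c) (at z)" for z
  define S where "S y u = g' (TD (fst y) (linv g (u, snd y *v u)))" for y :: "'e \<times> (real^'d^2)" and u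
  define MM :: "'e \<times> (real^'d^2) \<Rightarrow> real^'d^'d" where "MM y = matrix (\<lambda>u. fst (S y u))" for y
  define KK :: "'e \<times> (real^'d^2) \<Rightarrow> real^'d^2" where "KK y = matrix (\<lambda>u. snd (S y u))" for y
  have openZ: "open Z" unfolding Z_def by (rule open_overlap[OF c])
  have TD_lin: "linear (TD z)" and TD_inj: "inj (TD z)" if "z \<in> Z" for z
    using that trans_deriv_linear[OF A_diff c] trans_deriv_inj[OF c] by (auto simp: Z_def TD_def)
  have TD_diff: "(\<lambda>z. TD z w) differentiable (at z)" if "z \<in> Z" for z w
    unfolding TD_def
    by (rule smooth_on_differentiable[OF smooth_on_derivative[OF smooth_transition[OF c]]])
      (use openZ that in \<open>simp_all add: Z_def\<close>)
  have S_lin: "linear (S y)" if "fst y \<in> Z" for y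
    using linear_compose[OF linear_compose[OF linear_graph_map[OF g, of "snd y"] TD_lin[OF that]] g'(1)]
    unfolding S_def o_def .
  have S_inj: "inj (S y)" if "fst y \<in> Z" for y
  proof (rule injI)
    fix u v assume "S y u = S y v"
    then have "linv g (u, snd y *v u) = linv g (v, snd y *v v)"
      unfolding S_def using bij_is_inj[OF g'(2)] TD_inj[OF that] by (simp add: inj_eq)
    then have "(u, snd y *v u) = (v, snd y *v v)" by (metis bij_inv_apply(1)[OF g(2)])
    then show "u = v" by simp
  qed
  have lin1: "linear (\<lambda>u. fst (S y u))" and lin2: "linear (\<lambda>u. snd (S y u))" if "fst y \<in> Z" for y
    using linear_compose[OF S_lin[OF that] linear_fst] linear_compose[OF S_lin[OF that] linear_snd]
    by (simp_all add: o_def)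
  have det_iff: "Determinants.det (MM y) \<noteq> 0 \<longleftrightarrow> inj (\<lambda>u. fst (S y u))" if "fst y \<in> Z" for y
    unfolding MM_def by (rule det_nz_iff_inj[OF lin1[OF that]])
  have key: "(q, graph_plane A c g q G) \<in> chart_dom C' \<longleftrightarrow> Determinants.det (MM (chart_map c q, G)) \<noteq> 0"
    "Determinants.det (MM (chart_map c q, G)) \<noteq> 0 \<Longrightarrow> chart_map C' (q, graph_plane A c g q G) =
       (chart_map c' q, right_quotient (MM (chart_map c q, G)) (KK (chart_map c q, G)))"
    if q: "q \<in> chart_dom c" "q \<in> chart_dom c'" for q G
  proof -
    let ?y = "(chart_map c q, G)" and ?D = "graph_plane A c g q G"
    have yZ: "fst ?y \<in> Z" using q by (auto simp: Z_def)
    have img: "(\<lambda>v. v c') ` ?D = range (\<lambda>u. linv g' (S ?y u))"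
      unfolding graph_plane_def graph_set_eq_range[OF g(2)] image_image S_def
      by (simp add: tangent_vec_apply[OF c(2) q(2)] TD_def bij_inv_apply(2)[OF g'(2)])
    have graph_iff: "gr_graph c' g' ?D G' \<longleftrightarrow> range (S ?y) = {p. snd p = G' *v fst p}" for G'
      unfolding gr_graph_def img by (rule range_linv_eq_graph_set[OF g'(2)])
    have in_gr: "(q, ?D) \<in> gr_bundle T A CARD('d)"
      by (rule graph_plane_in_gr_bundle[OF A_diff chart_dom_subset c(1) q(1) g])
    have dom_iff: "(q, ?D) \<in> chart_dom C' \<longleftrightarrow> (\<exists>G'. gr_graph c' g' ?D G')"
      using in_gr q by (simp add: C'_def gr_chart_def)
    have rq: "gr_graph c' g' ?D (right_quotient (MM ?y) (KK ?y))" if det: "Determinants.det (MM ?y) \<noteq> 0"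
    proof -
      have "right_quotient (MM ?y) (KK ?y) *v fst (S ?y u) = snd (S ?y u)" for u
      proof -
        have "right_quotient (MM ?y) (KK ?y) *v (MM ?y *v u) = KK ?y *v u"
          by (simp only: matrix_vector_mul_assoc right_quotient[OF det])
        then show ?thesis
          unfolding MM_def KK_def using fun_cong[OF matrix_vector_mul(2)[OF lin1[OF yZ]], of u]
            fun_cong[OF matrix_vector_mul(2)[OF lin2[OF yZ]], of u] by simp
      qed
      then show ?thesis
        unfolding graph_iff using det det_iff[OF yZ] by (intro graph_of_linear(2)[OF S_lin[OF yZ] S_inj[OF yZ]]) simp_all
    qed
    show "(q, ?D) \<in> chart_dom C' \<longleftrightarrow> Determinants.det (MM ?y) \<noteq> 0"
    proof
      assume "(q, ?D) \<in> chart_dom C'"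
      then obtain G' where "range (S ?y) = {p. snd p = G' *v fst p}" unfolding dom_iff graph_iff ..
      then show "Determinants.det (MM ?y) \<noteq> 0"
        unfolding det_iff[OF yZ] by (rule graph_of_linear(1)[OF S_lin[OF yZ] S_inj[OF yZ]])
    next
      assume "Determinants.det (MM ?y) \<noteq> 0"
      then show "(q, ?D) \<in> chart_dom C'" unfolding dom_iff using rq by (intro exI)
    qed
    assume det: "Determinants.det (MM ?y) \<noteq> 0"
    have "?D = graph_plane A c' g' q (right_quotient (MM ?y) (KK ?y))"
      by (rule gr_graph_imp_graph_plane[OF A_diff chart_dom_subset c(2) q(2) _ rq[OF det]])
        (use in_gr in \<open>simp_all add: gr_bundle_def\<close>)
    then have "chart_map C' (q, ?D) = chart_map C' (q, graph_plane A c' g' q (right_quotient (MM ?y) (KK ?y)))"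
      by (rule arg_cong)
    also have "\<dots> = (chart_map c' q, right_quotient (MM ?y) (KK ?y))"
      unfolding C'_def by (rule gr_chart_map[OF A_diff chart_dom_subset c(2) q(2) g'(2)])
    finally show "chart_map C' (q, ?D) = (chart_map c' q, right_quotient (MM ?y) (KK ?y))" .
  qed
  have h_diff: "(\<lambda>G. linv g (axis k 1, G *v axis k 1)) differentiable (at G)" for k G
  proof (rule differentiable_compose[OF linear_imp_differentiable[OF linear_inv_bij[OF g]]], rule differentiable_Pair)
    have "linear (\<lambda>G. (G::real^'d^2) *v axis k 1)"
      by (rule linearI) (simp_all add: matrix_vector_mult_add_rdistrib scaleR_matrix_vector_assoc)
    then show "(\<lambda>G. (G::real^'d^2) *v axis k 1) differentiable (at G)" by (rule linear_imp_differentiable)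
  qed simp
  have entry_diff: "(\<lambda>y. L (S y (axis k 1))) differentiable (at y)"
    if "fst y \<in> Z" "linear L" for y k and L :: "(real^'d) \<times> (real^2) \<Rightarrow> real"
  proof -
    have inner: "(\<lambda>y. TD (fst y) (linv g (axis k 1, snd y *v axis k 1))) differentiable (at (fst y, snd y))"
      by (rule linear_family_differentiable[OF openZ that(1) TD_lin TD_diff[OF that(1)] h_diff])
    have outer: "(\<lambda>w. L (g' w)) differentiable net" for net
      using linear_imp_differentiable[OF linear_compose[OF g'(1) that(2)]] by (simp add: o_def)
    show ?thesis
      unfolding S_def by (rule differentiable_compose[OF outer inner[unfolded prod.collapse]])
  qed
  have M_diff: "(\<lambda>y. MM y $ i $ j) differentiable (at y)" if "fst y \<in> Z" for y i j
    unfolding MM_def matrix_def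
    using entry_diff[OF that, of "\<lambda>p. fst p $ i"] by (simp add: linear_iff)
  have K_diff: "(\<lambda>y. KK y $ i $ j) differentiable (at y)" if "fst y \<in> Z" for y i j
    unfolding KK_def matrix_def
    using entry_diff[OF that, of "\<lambda>p. snd p $ i"] by (simp add: linear_iff)
  have overlap: "chart_map C ` (chart_dom C \<inter> chart_dom C') = (Z \<times> UNIV) \<inter> (\<lambda>y. Determinants.det (MM y)) -` (- {0})"
  proof (intro equalityI subsetI)
    fix y assume "y \<in> chart_map C ` (chart_dom C \<inter> chart_dom C')"
    then obtain x where x: "x \<in> chart_dom C" "x \<in> chart_dom C'" "y = chart_map C x" by blast
    obtain q G where q: "q \<in> chart_dom c" "x = (q, graph_plane A c g q G)"
      using x(1) unfolding C_def gr_chart_dom_iff[OF A_diff chart_dom_subset c(1) g] by blast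
    have q': "q \<in> chart_dom c'" using x(2) q(2) by (simp add: C'_def gr_chart_def)
    have "y = (chart_map c q, G)"
      unfolding x(3) q(2) C_def by (rule gr_chart_map[OF A_diff chart_dom_subset c(1) q(1) g(2)])
    then show "y \<in> (Z \<times> UNIV) \<inter> (\<lambda>y. Determinants.det (MM y)) -` (- {0})"
      using key(1)[OF q(1) q'] x(2) q q' by (auto simp: Z_def)
  next
    fix y assume y: "y \<in> (Z \<times> UNIV) \<inter> (\<lambda>y. Determinants.det (MM y)) -` (- {0})"
    then obtain q G where q: "q \<in> chart_dom c" "q \<in> chart_dom c'" "y = (chart_map c q, G)"
      by (auto simp: Z_def)
    show "y \<in> chart_map C ` (chart_dom C \<inter> chart_dom C')"
    proof (rule image_eqI)
      show "y = chart_map C (q, graph_plane A c g q G)"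
        unfolding q(3) C_def by (rule gr_chart_map[OF A_diff chart_dom_subset c(1) q(1) g(2), symmetric])
      have "(q, graph_plane A c g q G) \<in> chart_dom C"
        unfolding C_def gr_chart_dom_iff[OF A_diff chart_dom_subset c(1) g] using q(1) by blast
      moreover have "(q, graph_plane A c g q G) \<in> chart_dom C'" using key(1)[OF q(1,2)] y q(3) by auto
      ultimately show "(q, graph_plane A c g q G) \<in> chart_dom C \<inter> chart_dom C'" ..
    qed
  qed
  show op: "open (chart_map C ` (chart_dom C \<inter> chart_dom C'))"
    unfolding overlap
  proof (rule continuous_open_preimage)
    show "continuous_on (Z \<times> UNIV) (\<lambda>y. Determinants.det (MM y))"
      by (rule continuous_at_imp_continuous_on, rule ballI, rule differentiable_imp_continuous_within,
          rule differentiable_det, rule M_diff) auto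
  qed (use openZ in \<open>auto intro: open_Times\<close>)
  assume x: "x \<in> chart_dom C" "x \<in> chart_dom C'"
  let ?y = "chart_map C x"
  have y: "?y \<in> chart_map C ` (chart_dom C \<inter> chart_dom C')" using x by blast
  then have yZ: "fst ?y \<in> Z" and det: "Determinants.det (MM ?y) \<noteq> 0" unfolding overlap by auto
  have diff: "(\<lambda>y. (chart_map c' (chart_inv c (fst y)), right_quotient (MM y) (KK y))) differentiable (at ?y)"
  proof (rule differentiable_Pair)
    have "(chart_map c' \<circ> chart_inv c) differentiable (at (fst ?y))"
      by (rule smooth_on_differentiable[OF smooth_transition[OF c]]) (use openZ yZ in \<open>simp_all add: Z_def\<close>)
    then show "(\<lambda>y. chart_map c' (chart_inv c (fst y))) differentiable (at ?y)"
      using differentiable_compose[OF _ bounded_linear_imp_differentiable[OF bounded_linear_fst]]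
      by (simp add: o_def)
    show "(\<lambda>y. right_quotient (MM y) (KK y)) differentiable (at ?y)"
      by (rule differentiable_right_quotient[OF M_diff[OF yZ] K_diff[OF yZ] det])
  qed
  show "(chart_map C' \<circ> chart_inv C) differentiable (at ?y)"
  proof (rule differentiable_cong_nhds[OF diff])
    show "\<forall>\<^sub>F y in nhds ?y. (chart_map c' (chart_inv c (fst y)), right_quotient (MM y) (KK y)) =
        (chart_map C' \<circ> chart_inv C) y"
      using eventually_nhds_in_open[OF op y]
    proof eventually_elim
      case (elim y)
      then have e: "fst y \<in> Z" "Determinants.det (MM y) \<noteq> 0" unfolding overlap by auto
      then obtain q where q: "q \<in> chart_dom c" "q \<in> chart_dom c'" "fst y = chart_map c q" by (auto simp: Z_def)
      have yq: "y = (chart_map c q, snd y)" using q(3) by (simp add: prod_eq_iff)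
      have iq: "chart_inv c (chart_map c q) = q" by (rule chart_inv_map[OF A_diff c(1) q(1)])
      have "chart_inv C (chart_map c q, snd y) = (q, graph_plane A c g q (snd y))"
        unfolding C_def using gr_chart_inv[OF A_diff chart_dom_subset c(1) g, of "chart_map c q"] q(1) iq by simp
      then have "(chart_map C' \<circ> chart_inv C) y = chart_map C' (q, graph_plane A c g q (snd y))"
        using yq by (metis comp_apply)
      also have "\<dots> = (chart_map c' q, right_quotient (MM y) (KK y))"
        using key(2)[OF q(1,2), of "snd y"] e(2) yq by simp
      finally show ?case using q(3) iq by simp
    qed
  qed
qed

lemma gr_atlas_diff: "diff_atlas (gr_atlas T A :: (_, 'e \<times> (real^'d^2)) chart set)"
  unfolding diff_atlas_def
proof (intro conjI ballI)
  fix C :: "(_, 'e \<times> (real^'d^2)) chart" assume "C \<in> gr_atlas T A"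
  then obtain c and g :: "'e \<Rightarrow> (real^'d) \<times> (real^2)" where C: "C = gr_chart T A c g" "c \<in> A" "linear g" "bij g"
    unfolding gr_atlas_def by blast
  show "inj_on (chart_map C) (chart_dom C)"
    unfolding C(1) by (rule gr_chart_inj[OF A_diff chart_dom_subset C(2-4)])
next
  fix C C' :: "(_, 'e \<times> (real^'d^2)) chart" assume "C \<in> gr_atlas T A" "C' \<in> gr_atlas T A"
  then obtain c c' and g g' :: "'e \<Rightarrow> (real^'d) \<times> (real^2)"
    where C: "C = gr_chart T A c g" "c \<in> A" "linear g" "bij g"
      and C': "C' = gr_chart T A c' g'" "c' \<in> A" "linear g'" "bij g'"
    unfolding gr_atlas_def by blast
  show "open (chart_map C ` (chart_dom C \<inter> chart_dom C'))"
    unfolding C(1) C'(1) by (rule gr_transition(1)[OF C(2) C'(2) C(3,4) C'(3,4)])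
  fix x assume "x \<in> chart_dom C \<inter> chart_dom C'"
  then show "(chart_map C' \<circ> chart_inv C) differentiable (at (chart_map C x))"
    unfolding C(1) C'(1) by (intro gr_transition(2)[OF C(2) C'(2) C(3,4) C'(3,4)]) simp_all
qed

end

section \<open>Sections and their jets\<close>

lemma smooth_on_subset: "smooth_on T f \<Longrightarrow> S \<subseteq> T \<Longrightarrow> smooth_on S f"
  unfolding smooth_on_def using C_on_subset by blast

lemma smooth_on_cong:
  "smooth_on S f \<Longrightarrow> open S \<Longrightarrow> (\<And>y. y \<in> S \<Longrightarrow> f y = g y) \<Longrightarrow> smooth_on S g"
  unfolding smooth_on_def using C_on_cong by blast

lemma smooth_on_linear_comp:
  fixes L :: "'b::euclidean_space \<Rightarrow> 'c::real_normed_vector"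
  assumes "open S" "linear L" "smooth_on S f" shows "smooth_on S (\<lambda>x. L (f x))"
  using C_on_linear_comp[OF assms(1)] assms(2,3)
  unfolding smooth_on_def linear_conv_bounded_linear by blast

lemma smooth_on_bilinear:
  assumes "open S" "bounded_bilinear H" "smooth_on S f" "smooth_on S g"
  shows "smooth_on S (\<lambda>x. H (f x) (g x))"
  using C_on_bilinear[OF assms(1,2)] assms(3,4) unfolding smooth_on_def by blast

lemma smooth_on_add:
  "open S \<Longrightarrow> smooth_on S f \<Longrightarrow> smooth_on S g \<Longrightarrow> smooth_on S (\<lambda>x. f x + g x)"
  unfolding smooth_on_def using C_on_add by blast

lemma smooth_on_affine:
  fixes L :: "'b::euclidean_space \<Rightarrow> 'c::real_normed_vector"
  assumes "open S" "linear L" shows "smooth_on S (\<lambda>y. L y + z)"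
  unfolding smooth_on_def
  by (intro allI C_on_add[OF assms(1)] C_on_bounded_linear[OF assms(1)] C_on_const[OF assms(1)])
    (use assms(2) in \<open>simp add: linear_conv_bounded_linear\<close>)

lemma gr_atlasE:
  fixes C :: "(('a, 'e::euclidean_space) gr_point, 'e \<times> (real^'d^2)) chart"
  assumes "C \<in> gr_atlas T A"
  obtains c and g :: "'e \<Rightarrow> (real^'d) \<times> (real^2)" where "C = gr_chart T A c g" "c \<in> A" "linear g" "bij g"
  using assms unfolding gr_atlas_def by blast

text \<open>The matrix-valued function G whose graph is the distribution, as a function of the coordinates of
the base point.\<close>

definition section_coord ::
  "(('a, 'e::real_normed_vector) gr_point, 'e \<times> (real^'d^2)) chart \<Rightarrow> ('a, 'e) chart \<Rightarrow> ('a \<Rightarrow> ('a, 'e) gr_point)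
     \<Rightarrow> 'e \<Rightarrow> real^'d^2" where
  "section_coord C c f y = snd (chart_map C (f (chart_inv c y)))"

lemma section_diff_map:
  fixes g :: "'e::euclidean_space \<Rightarrow> (real^'d) \<times> (real^2)"
  assumes M: "smooth_manifold T A" and c: "c \<in> A" "q \<in> chart_dom c" and g: "linear g" "bij g"
    and sec: "local_section T A (gr_atlas T A :: (_, 'e \<times> (real^'d^2)) chart set) X fst U f" and q: "q \<in> U"
    and dom: "f q \<in> chart_dom (gr_chart T A c g)"
  shows "diff_map_in_charts c (gr_chart T A c g) f q"
proof -
  let ?C = "gr_chart T A c g"
  have "smooth_map_at A (gr_atlas T A :: (_, 'e \<times> (real^'d^2)) chart set) f q"
    using sec q unfolding local_section_def by blast
  then obtain c1 W and C1 :: "(_, 'e \<times> (real^'d^2)) chart"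
    where 1: "c1 \<in> A" "C1 \<in> gr_atlas T A" "q \<in> W" "W \<subseteq> chart_dom c1" "open (chart_map c1 ` W)"
      "f ` W \<subseteq> chart_dom C1" "smooth_on (chart_map c1 ` W) (chart_map C1 \<circ> f \<circ> chart_inv c1)"
    unfolding smooth_map_at_def by blast
  have "diff_map_in_charts c1 C1 f q"
    unfolding diff_map_in_charts_def
  proof
    have "\<forall>\<^sub>F y in nhds (chart_map c1 q). y \<in> chart_map c1 ` W"
      using 1 by (intro eventually_nhds_in_open) auto
    then show "\<forall>\<^sub>F y in nhds (chart_map c1 q). f (chart_inv c1 y) \<in> chart_dom C1"
    proof eventually_elim
      case (elim y)
      then obtain p where p: "p \<in> W" "y = chart_map c1 p" by blast
      then have "chart_inv c1 y = p" using 1(4) chart_inv_map[OF A_diff[OF M] 1(1), of p] by blast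
      then show ?case using 1(6) p(1) by blast
    qed
    show "(\<lambda>y. chart_map C1 (f (chart_inv c1 y))) differentiable at (chart_map c1 q)"
      using smooth_on_differentiable[OF 1(7,5)] 1(3) by (simp add: o_def)
  qed
  moreover have "?C \<in> gr_atlas T A" unfolding gr_atlas_def using c(1) g by blast
  ultimately show ?thesis
    using diff_map_change_charts(1)[where f = f, OF A_diff[OF M] gr_atlas_diff[OF M] 1(1) c(1) 1(2) _ _ c(2) _ dom] 1(3,4,6) by blast
qed

lemma section_in_chart:
  fixes g :: "'e::euclidean_space \<Rightarrow> (real^'d) \<times> (real^2)"
  assumes M: "smooth_manifold T A" and c: "c \<in> A" "q \<in> chart_dom c" and g: "linear g" "bij g"
    and sec: "local_section T A (gr_atlas T A :: (_, 'e \<times> (real^'d^2)) chart set) X fst U f" and q: "q \<in> U"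
    and dom: "f q \<in> chart_dom (gr_chart T A c g)"
  defines "C \<equiv> gr_chart T A c g"
  shows "\<forall>\<^sub>F y in nhds (chart_map c q). y \<in> chart_map c ` chart_dom c \<and>
      f (chart_inv c y) = (chart_inv c y, graph_plane A c g (chart_inv c y) (section_coord C c f y)) \<and>
      chart_map C (f (chart_inv c y)) = (y, section_coord C c f y)"
    and "(section_coord C c f has_derivative frechet_derivative (section_coord C c f) (at (chart_map c q)))
      (at (chart_map c q))"
    and "frechet_derivative (\<lambda>y. chart_map C (f (chart_inv c y))) (at (chart_map c q)) =
      (\<lambda>w. (w, frechet_derivative (section_coord C c f) (at (chart_map c q)) w))"
proof -
  note A = A_diff[OF M]
  have d: "diff_map_in_charts c C f q"
    unfolding C_def by (rule section_diff_map[OF M c g sec q dom])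
  have U: "openin T U" "\<And>p. p \<in> U \<Longrightarrow> fst (f p) = p" using sec unfolding local_section_def by auto
  have "openin T (U \<inter> chart_dom c)" using U(1) M c(1) unfolding smooth_manifold_def by blast
  then have "open (chart_map c ` (U \<inter> chart_dom c))"
    using smooth_manifold_chart_open_iff[OF M c(1), of "U \<inter> chart_dom c"] by simp
  then have "\<forall>\<^sub>F y in nhds (chart_map c q). y \<in> chart_map c ` (U \<inter> chart_dom c)"
    using q c(2) by (intro eventually_nhds_in_open) auto
  moreover have "\<forall>\<^sub>F y in nhds (chart_map c q). f (chart_inv c y) \<in> chart_dom C"
    using d unfolding diff_map_in_charts_def by blast
  ultimately show ev: "\<forall>\<^sub>F y in nhds (chart_map c q). y \<in> chart_map c ` chart_dom c \<and>
      f (chart_inv c y) = (chart_inv c y, graph_plane A c g (chart_inv c y) (section_coord C c f y)) \<and>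
      chart_map C (f (chart_inv c y)) = (y, section_coord C c f y)"
  proof eventually_elim
    case (elim y)
    then obtain p where p: "p \<in> U" "p \<in> chart_dom c" "y = chart_map c p" by blast
    have ip: "chart_inv c y = p" using chart_inv_map[OF A c(1) p(2)] p(3) by simp
    obtain q' G where G: "q' \<in> chart_dom c" "f p = (q', graph_plane A c g q' G)"
      using elim(2) unfolding ip C_def gr_chart_dom_iff[OF A chart_dom_subset[OF M] c(1) g] by blast
    have q': "q' = p" using U(2)[OF p(1)] G(2) by simp
    have "chart_map C (f p) = (y, G)"
      unfolding G(2) q' p(3) C_def by (rule gr_chart_map[OF A chart_dom_subset[OF M] c(1) p(2) g(2)])
    then show ?case using G(2) p ip q' by (simp add: section_coord_def)
  qed
  have h: "((\<lambda>y. chart_map C (f (chart_inv c y))) has_derivative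
      frechet_derivative (\<lambda>y. chart_map C (f (chart_inv c y))) (at (chart_map c q))) (at (chart_map c q))"
    using d unfolding diff_map_in_charts_def by (simp add: frechet_derivative_works)
  have "((\<lambda>y. snd (chart_map C (f (chart_inv c y)))) has_derivative
      (\<lambda>w. snd (frechet_derivative (\<lambda>y. chart_map C (f (chart_inv c y))) (at (chart_map c q)) w)))
      (at (chart_map c q))"
    by (rule has_derivative_snd[OF h])
  then show G: "(section_coord C c f has_derivative frechet_derivative (section_coord C c f) (at (chart_map c q)))
      (at (chart_map c q))"
    unfolding section_coord_def[abs_def] using frechet_derivative_works differentiable_def by blast
  have "((\<lambda>y. (y, section_coord C c f y)) has_derivative
      (\<lambda>w. (w, frechet_derivative (section_coord C c f) (at (chart_map c q)) w))) (at (chart_map c q))"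
    by (rule has_derivative_Pair[OF has_derivative_ident G])
  then show "frechet_derivative (\<lambda>y. chart_map C (f (chart_inv c y))) (at (chart_map c q)) =
      (\<lambda>w. (w, frechet_derivative (section_coord C c f) (at (chart_map c q)) w))"
    by (intro frechet_derivative_eqI, elim has_derivative_cong_nhds) (use ev in \<open>auto elim: eventually_mono\<close>)
qed

text \<open>Every prescribed value of the derivative at a point is the derivative of a section: in a
  standard chart take the section with affine coordinates.\<close>

definition affine_section ::
  "('a, 'e::real_normed_vector) chart set \<Rightarrow> ('a, 'e) chart \<Rightarrow> ('e \<Rightarrow> (real^'d) \<times> (real^2)) \<Rightarrow> 'a
     \<Rightarrow> ('e \<Rightarrow> real^'d^2) \<Rightarrow> 'a \<Rightarrow> ('a, 'e) gr_point" where
  "affine_section A c g q L p = (p, graph_plane A c g p (L (chart_map c p - chart_map c q)))"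

lemma affine_section:
  fixes g :: "'e::euclidean_space \<Rightarrow> (real^'d) \<times> (real^2)"
  assumes M: "smooth_manifold T A" and c: "c \<in> A" "q \<in> chart_dom c" and g: "linear g" "bij g"
    and L: "linear L"
  defines "C \<equiv> gr_chart T A c g" and "f \<equiv> affine_section A c g q L"
  shows "local_section T A (gr_atlas T A :: (_, 'e \<times> (real^'d^2)) chart set) (gr_bundle T A CARD('d)) fst (chart_dom c) f"
    and "f q = (q, graph_plane A c g q 0)"
    and "frechet_derivative (section_coord C c f) (at (chart_map c q)) = L"
proof -
  note A = A_diff[OF M]
  have op: "openin T (chart_dom c)" "open (chart_map c ` chart_dom c)"
    using M c(1) unfolding smooth_manifold_def by blast+
  have C: "C \<in> gr_atlas T A" unfolding gr_atlas_def C_def using c(1) g by blast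
  have f_dom: "f p \<in> chart_dom C" if "p \<in> chart_dom c" for p
    unfolding f_def C_def affine_section_def gr_chart_dom_iff[OF A chart_dom_subset[OF M] c(1) g]
    using that by blast
  have f_map: "chart_map C (f p) = (chart_map c p, L (chart_map c p - chart_map c q))" if "p \<in> chart_dom c" for p
    unfolding f_def C_def affine_section_def by (rule gr_chart_map[OF A chart_dom_subset[OF M] c(1) that g(2)])
  have coord: "chart_map C (f (chart_inv c y)) = (y, L (y - chart_map c q))" if "y \<in> chart_map c ` chart_dom c" for y
    using f_map[OF chart_inv_in[OF that]] chart_map_inv[OF that] by simp
  show "f q = (q, graph_plane A c g q 0)" unfolding f_def affine_section_def by (simp add: linear_0[OF L])
  show "frechet_derivative (section_coord C c f) (at (chart_map c q)) = L"
  proof (rule frechet_derivative_eqI, rule has_derivative_cong_nhds)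
    have "((\<lambda>y. L (y - chart_map c q)) has_derivative (\<lambda>w. L (w - 0))) (at (chart_map c q))"
      by (intro bounded_linear.has_derivative[of L] has_derivative_diff has_derivative_ident has_derivative_const)
        (use L in \<open>simp add: linear_conv_bounded_linear\<close>)
    then show "((\<lambda>y. L (y - chart_map c q)) has_derivative L) (at (chart_map c q))" by simp
    have "\<forall>\<^sub>F y in nhds (chart_map c q). y \<in> chart_map c ` chart_dom c"
      using op(2) c(2) by (intro eventually_nhds_in_open) auto
    then show "\<forall>\<^sub>F y in nhds (chart_map c q). L (y - chart_map c q) = section_coord C c f y"
      by eventually_elim (simp add: section_coord_def coord)
  qed
  show "local_section T A (gr_atlas T A :: (_, 'e \<times> (real^'d^2)) chart set) (gr_bundle T A CARD('d)) fst (chart_dom c) f"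
    unfolding local_section_def
  proof (intro conjI ballI op(1))
    fix p assume p: "p \<in> chart_dom c"
    show "f p \<in> gr_bundle T A CARD('d)"
      unfolding f_def affine_section_def by (rule graph_plane_in_gr_bundle[OF A chart_dom_subset[OF M] c(1) p g])
    show "fst (f p) = p" by (simp add: f_def affine_section_def)
    have lin: "linear (\<lambda>y. (y, L y))"
      using linear_add[OF L] linear_cmul[OF L] by (intro linearI) simp_all
    have "smooth_on (chart_map c ` chart_dom c) (\<lambda>y. (y, L y) + (0, - L (chart_map c q)))"
      by (rule smooth_on_affine[OF op(2) lin])
    then have "smooth_on (chart_map c ` chart_dom c) (chart_map C \<circ> f \<circ> chart_inv c)"
      by (rule smooth_on_cong[OF _ op(2)]) (simp add: coord linear_diff[OF L])
    then show "smooth_map_at A (gr_atlas T A :: (_, 'e \<times> (real^'d^2)) chart set) f p"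
      unfolding smooth_map_at_def using c(1) C p op(2) f_dom
      by (intro bexI[of _ c] bexI[of _ C] exI[of _ "chart_dom c"]) auto
  qed
qed

lemma section_differential:
  fixes g :: "'e::euclidean_space \<Rightarrow> (real^'d) \<times> (real^2)"
  assumes M: "smooth_manifold T A" and c: "c \<in> A" "q \<in> chart_dom c" and g: "linear g" "bij g"
    and sec: "local_section T A (gr_atlas T A :: (_, 'e \<times> (real^'d^2)) chart set) X fst U f" and q: "q \<in> U"
    and dom: "f q \<in> chart_dom (gr_chart T A c g)" and v: "v \<in> tangent_space A q"
  defines "C \<equiv> gr_chart T A c g"
  shows "differential A (gr_atlas T A :: (_, 'e \<times> (real^'d^2)) chart set) f q v \<in> tangent_space (gr_atlas T A) (f q)"
    and "differential A (gr_atlas T A) f q v C =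
      (v c, frechet_derivative (section_coord C c f) (at (chart_map c q)) (v c))"
proof -
  have C: "C \<in> gr_atlas T A" unfolding gr_atlas_def C_def using c(1) g by blast
  show "differential A (gr_atlas T A :: (_, 'e \<times> (real^'d^2)) chart set) f q v \<in> tangent_space (gr_atlas T A) (f q)"
    by (rule differential_in_tangent_space[OF gr_atlas_diff[OF M] C _ v]) (use dom C_def in simp)
  have "differential A (gr_atlas T A) f q v C =
      frechet_derivative (\<lambda>y. chart_map C (f (chart_inv c y))) (at (chart_map c q)) (v c)"
    unfolding C_def
    by (rule differential_apply[where f = f, OF A_diff[OF M] gr_atlas_diff[OF M] c(1) C[unfolded C_def] c(2) dom
          section_diff_map[OF M c g sec q dom] v])
  then show "differential A (gr_atlas T A) f q v C =
      (v c, frechet_derivative (section_coord C c f) (at (chart_map c q)) (v c))"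
    unfolding C_def section_in_chart(3)[OF M c g sec q dom] .
qed

lemma vertical_iff:
  fixes g :: "'e::euclidean_space \<Rightarrow> (real^'d) \<times> (real^2)"
  assumes M: "smooth_manifold T A" and c: "c \<in> A" "q \<in> chart_dom c" and g: "linear g" "bij g"
    and dom: "(q, D) \<in> chart_dom (gr_chart T A c g)"
    and u: "u \<in> tangent_space (gr_atlas T A :: (_, 'e \<times> (real^'d^2)) chart set) (q, D)"
    and zero: "fst (u (gr_chart T A c g)) = 0"
  shows "u \<in> vertical_space A (gr_atlas T A) fst (q, D)"
proof -
  note A = A_diff[OF M]
  let ?C = "gr_chart T A c g"
  let ?B = "gr_atlas T A :: (_, 'e \<times> (real^'d^2)) chart set"
  have C: "?C \<in> ?B" unfolding gr_atlas_def using c(1) g by blast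
  obtain G where D: "(q, D) = (q, graph_plane A c g q G)"
    using dom unfolding gr_chart_dom_iff[OF A chart_dom_subset[OF M] c(1) g] by auto
  have Cq: "chart_map ?C (q, D) = (chart_map c q, G)"
    unfolding D by (rule gr_chart_map[OF A chart_dom_subset[OF M] c g(2)])
  have op: "open (chart_map c ` chart_dom c)" using M c(1) unfolding smooth_manifold_def by blast
  have ev: "\<forall>\<^sub>F y in nhds (chart_map ?C (q, D)). y \<in> chart_map c ` chart_dom c \<times> UNIV"
    unfolding Cq by (rule eventually_nhds_in_open) (use op c(2) in \<open>auto intro: open_Times\<close>)
  have fst_inv: "fst (chart_inv ?C y) = chart_inv c (fst y)" if "y \<in> chart_map c ` chart_dom c \<times> UNIV"
    for y :: "'e \<times> (real^'d^2)"
  proof -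
    have "chart_inv ?C (fst y, snd y) = (chart_inv c (fst y), graph_plane A c g (chart_inv c (fst y)) (snd y))"
      by (rule gr_chart_inv[OF A chart_dom_subset[OF M] c(1) g]) (use that in auto)
    then show ?thesis by simp
  qed
  have eq: "\<forall>\<^sub>F y in nhds (chart_map ?C (q, D)). fst y = chart_map c (fst (chart_inv ?C y))"
    using ev by eventually_elim (auto simp: fst_inv chart_map_inv)
  have h: "((\<lambda>y. chart_map c (fst (chart_inv ?C y))) has_derivative fst) (at (chart_map ?C (q, D)))"
    by (rule has_derivative_cong_nhds[OF bounded_linear_imp_has_derivative[OF bounded_linear_fst] eq])
  have d: "diff_map_in_charts ?C c fst (q, D)"
    unfolding diff_map_in_charts_def
  proof
    show "\<forall>\<^sub>F y in nhds (chart_map ?C (q, D)). fst (chart_inv ?C y) \<in> chart_dom c"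
      using ev by eventually_elim (auto simp: fst_inv chart_inv_in)
    show "(\<lambda>y. chart_map c (fst (chart_inv ?C y))) differentiable at (chart_map ?C (q, D))"
      using h unfolding differentiable_def by blast
  qed
  have c': "fst (q, D) \<in> chart_dom c" using c(2) by simp
  have "differential ?B A fst (q, D) u c = frechet_derivative (\<lambda>y. chart_map c (fst (chart_inv ?C y)))
      (at (chart_map ?C (q, D))) (u ?C)"
    by (rule differential_apply[OF gr_atlas_diff[OF M] A C c(1) dom c' d u])
  then have "differential ?B A fst (q, D) u c = 0"
    using zero by (simp add: frechet_derivative_eqI[OF h])
  moreover have "differential ?B A fst (q, D) u \<in> tangent_space A q"
    using differential_in_tangent_space[where f = fst, OF A c(1) c' u] by simp
  moreover have "0 \<in> tangent_space A q" by (rule subspace_0[OF tangent_space_subspace[OF A c]])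
  ultimately have "differential ?B A fst (q, D) u = 0"
    using tangent_space_eqI[OF c, of "differential ?B A fst (q, D) u" 0] by simp
  then show ?thesis using u unfolding vertical_space_def by simp
qed

section \<open>The dual Levi map of a section\<close>

lemma bounded_bilinear_matrix_dual:
  "bounded_bilinear (\<lambda>(G::real^'d^2) (u::real^'d). p \<bullet> (G *v u))"
proof -
  have 1: "linear (\<lambda>u. p \<bullet> (G *v u))" for G :: "real^'d^2"
    using linear_add[OF matrix_vector_mul_linear[of G]] linear_cmul[OF matrix_vector_mul_linear[of G]]
    by (intro linearI) (simp_all add: inner_add_right)
  have 2: "linear (\<lambda>G::real^'d^2. p \<bullet> (G *v u))" for u
    by (rule linearI) (simp_all add: matrix_vector_mult_add_rdistrib scaleR_matrix_vector_assoc[symmetric] inner_add_right)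
  have "bilinear (\<lambda>(G::real^'d^2) (u::real^'d). p \<bullet> (G *v u))"
    unfolding bilinear_def using 1 2 by simp
  then show ?thesis by (simp add: bilinear_conv_bounded_bilinear)
qed

lemma Hom_onD:
  assumes "L \<in> Hom_on S W"
  shows "u \<in> S \<Longrightarrow> v \<in> S \<Longrightarrow> L (u + v) = L u + L v" "v \<in> S \<Longrightarrow> L (a *\<^sub>R v) = a *\<^sub>R L v"
    "v \<notin> S \<Longrightarrow> L v = 0" "v \<in> S \<Longrightarrow> L v \<in> W"
  using assms by (auto simp: Hom_on_def lin_on_def)

lemma Hom_on_tangent_vec_linear:
  assumes "diff_atlas A" "c \<in> A" "q \<in> chart_dom c" "\<alpha> \<in> Hom_on (tangent_space A q) UNIV"
  shows "linear (\<lambda>w. \<alpha> (tangent_vec A c q w))"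
proof (rule linearI)
  note lin = tangent_vec_linear[OF assms(1-3)] and tin = tangent_vec_in[OF assms(1-3)]
  show "\<alpha> (tangent_vec A c q (u + v)) = \<alpha> (tangent_vec A c q u) + \<alpha> (tangent_vec A c q v)" for u v
    unfolding linear_add[OF lin] by (rule Hom_onD(1)[OF assms(4) tin tin])
  show "\<alpha> (tangent_vec A c q (r *\<^sub>R v)) = r *\<^sub>R \<alpha> (tangent_vec A c q v)" for r v
    unfolding linear_cmul[OF lin] by (rule Hom_onD(2)[OF assms(4) tin])
qed

text \<open>A form vanishing on a graph is a multiple of the equations of the graph.\<close>

lemma vanishing_on_graph:
  fixes g :: "'e::euclidean_space \<Rightarrow> (real^'d) \<times> (real^2)" and \<phi> :: "'e \<Rightarrow> real"
  assumes "linear \<phi>" "linear g" "bij g" "\<And>w. w \<in> graph_set g G \<Longrightarrow> \<phi> w = 0"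
  shows "\<exists>p. \<forall>w. \<phi> w = p \<bullet> (snd (g w) - G *v fst (g w))"
proof -
  have "linear (\<lambda>s. (0, s) :: (real^'d) \<times> (real^2))" by (rule linearI) simp_all
  then have lin: "linear (\<lambda>s. \<phi> (linv g (0, s)))"
    using linear_compose[OF linear_compose[OF _ linear_inv_bij[OF assms(2,3)]] assms(1)] by (simp add: o_def)
  have "\<phi> w = adjoint (\<lambda>s. \<phi> (linv g (0, s))) 1 \<bullet> (snd (g w) - G *v fst (g w))" for w
  proof -
    let ?s = "snd (g w) - G *v fst (g w)"
    have "g w = (fst (g w), G *v fst (g w)) + (0, ?s)" by (simp add: prod_eq_iff)
    then have "linv g (g w) = linv g (fst (g w), G *v fst (g w)) + linv g (0, ?s)"
      using linear_add[OF linear_inv_bij[OF assms(2,3)]] by metis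
    then have w: "w = linv g (fst (g w), G *v fst (g w)) + linv g (0, ?s)"
      by (simp only: bij_inv_apply(2)[OF assms(3)])
    have "\<phi> (linv g (fst (g w), G *v fst (g w))) = 0"
      by (rule assms(4)) (simp add: bij_inv_apply(1)[OF assms(3)])
    then have "\<phi> w = \<phi> (linv g (0, ?s))"
      using linear_add[OF assms(1), of "linv g (fst (g w), G *v fst (g w))" "linv g (0, ?s)"] w by simp
    also have "\<dots> = ?s \<bullet> adjoint (\<lambda>s. \<phi> (linv g (0, s))) 1"
      using adjoint_works[OF lin, of ?s 1] by simp
    finally show ?thesis by (simp add: inner_commute)
  qed
  then show ?thesis by blast
qed

text \<open>Near the point the plane field is the graph of a smooth G in some standard chart, and the forms
\<open>p \<bullet> (dy - G dx)\<close> with constant p vanish on it. The chart is the one in which the section is known to be smooth;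
smoothness in every other chart of the manifold comes from the transition maps.\<close>

lemma annihilating_extension_exists:
  assumes M: "smooth_manifold T A"
    and sec: "local_section T A (gr_atlas T A :: (_, 'e::euclidean_space \<times> (real^'d^2)) chart set) X fst U f"
    and q: "q \<in> U" and \<alpha>: "\<alpha> \<in> annihilator A q (snd (f q))"
  shows "\<exists>\<alpha>'. annihilating_extension T A (\<lambda>p. snd (f p)) q \<alpha> \<alpha>'"
proof -
  note A = A_diff[OF M] and top = chart_dom_subset[OF M]
  have "smooth_map_at A (gr_atlas T A :: (_, 'e \<times> (real^'d^2)) chart set) f q"
    using sec q unfolding local_section_def by blast
  then obtain c1 W and C1 :: "(_, 'e \<times> (real^'d^2)) chart"
    where 1: "c1 \<in> A" "C1 \<in> gr_atlas T A" "q \<in> W" "W \<subseteq> chart_dom c1" "open (chart_map c1 ` W)"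
      "f ` W \<subseteq> chart_dom C1" "smooth_on (chart_map c1 ` W) (chart_map C1 \<circ> f \<circ> chart_inv c1)"
    unfolding smooth_map_at_def by blast
  obtain c2 and g :: "'e \<Rightarrow> (real^'d) \<times> (real^2)" where 2: "C1 = gr_chart T A c2 g" "c2 \<in> A" and g: "linear g" "bij g"
    by (rule gr_atlasE[OF 1(2)])
  define G where "G p = snd (chart_map C1 (f p))" for p
  define U' where "U' = W \<inter> U"
  have U: "openin T U" "\<And>p. p \<in> U \<Longrightarrow> fst (f p) = p" using sec unfolding local_section_def by auto
  have "openin T W" using smooth_manifold_chart_open_iff[OF M 1(1,4)] 1(5) by simp
  then have U'_open: "openin T U'" unfolding U'_def using U(1) by (rule openin_Int)
  have f: "p \<in> chart_dom c2" "f p = (p, graph_plane A c2 g p (G p))" if p: "p \<in> U'" for p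
  proof -
    have "f p \<in> chart_dom (gr_chart T A c2 g)" using 1(6) p 2(1) unfolding U'_def by blast
    then obtain p' H where H: "p' \<in> chart_dom c2" "f p = (p', graph_plane A c2 g p' H)"
      unfolding gr_chart_dom_iff[OF A top 2(2) g] by blast
    have "p' = p" using U(2)[of p] p H(2) unfolding U'_def by simp
    moreover have "G p = H"
      unfolding G_def H(2) 2(1) gr_chart_map[OF A top 2(2) H(1) g(2)] by simp
    ultimately show "p \<in> chart_dom c2" "f p = (p, graph_plane A c2 g p (G p))" using H by simp_all
  qed
  have qU: "q \<in> U'" using q 1(3) by (simp add: U'_def)
  have \<alpha>_hom: "\<alpha> \<in> Hom_on (tangent_space A q) UNIV" and \<alpha>_zero: "\<And>v. v \<in> snd (f q) \<Longrightarrow> \<alpha> v = 0"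
    using \<alpha> unfolding annihilator_def by auto
  have van: "\<alpha> (tangent_vec A c2 q w) = 0" if "w \<in> graph_set g (G q)" for w
    by (rule \<alpha>_zero) (use f(2)[OF qU] that in \<open>simp add: graph_plane_def\<close>)
  obtain pv where "\<forall>w. \<alpha> (tangent_vec A c2 q w) = pv \<bullet> (snd (g w) - G q *v fst (g w))"
    using vanishing_on_graph[OF Hom_on_tangent_vec_linear[OF A 2(2) f(1)[OF qU] \<alpha>_hom] g van] by blast
  note pv = this[rule_format]
  define \<alpha>' where "\<alpha>' p v = (if v \<in> tangent_space A p then pv \<bullet> (snd (g (v c2)) - G p *v fst (g (v c2))) else 0)" for p v
  have "\<alpha>' q = \<alpha>"
  proof
    fix v show "\<alpha>' q v = \<alpha> v"
    proof (cases "v \<in> tangent_space A q")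
      case True
      then show ?thesis using pv[of "v c2"] tangent_vec_of[OF 2(2) f(1)[OF qU] True] by (simp add: \<alpha>'_def)
    next
      case False
      then show ?thesis using Hom_onD(3)[OF \<alpha>_hom False] by (simp add: \<alpha>'_def)
    qed
  qed
  moreover have "one_form_on A U' \<alpha>'"
    unfolding one_form_on_def
  proof (intro conjI ballI allI)
    fix p assume p: "p \<in> U'"
    have sub: "subspace (tangent_space A p)" by (rule tangent_space_subspace[OF A 2(2) f(1)[OF p]])
    have Gl: "linear ((*v) (G p))" by simp
    show "\<alpha>' p \<in> Hom_on (tangent_space A p) UNIV"
      unfolding Hom_on_def lin_on_def
      using subspace_add[OF sub] subspace_scale[OF sub] linear_add[OF g(1)] linear_cmul[OF g(1)]
        linear_add[OF Gl] linear_cmul[OF Gl]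
      by (auto simp: \<alpha>'_def inner_add_right inner_diff_right right_diff_distrib)
  next
    fix c w assume c: "c \<in> A"
    let ?O = "chart_map c ` (U' \<inter> chart_dom c)"
    have op: "open ?O"
    proof -
      have "openin T (U' \<inter> chart_dom c)" using U'_open M c unfolding smooth_manifold_def by blast
      then show ?thesis using smooth_manifold_chart_open_iff[OF M c, of "U' \<inter> chart_dom c"] by simp
    qed
    let ?FD = "\<lambda>y. frechet_derivative (chart_map c2 \<circ> chart_inv c) (at y) w"
    let ?G = "\<lambda>y. snd ((chart_map C1 \<circ> f \<circ> chart_inv c1) (chart_map c1 (chart_inv c y)))"
    have FD: "smooth_on ?O ?FD"
      by (rule smooth_on_subset[OF smooth_on_derivative[OF smooth_transition[OF M c 2(2)]]]) (use f(1) in auto)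
    have "smooth_on ?O (chart_map c1 \<circ> chart_inv c)"
      by (rule smooth_on_subset[OF smooth_transition[OF M c 1(1)]]) (use 1(4) in \<open>auto simp: U'_def\<close>)
    then have t: "smooth_on ?O (\<lambda>y. chart_map c1 (chart_inv c y))" by (simp add: o_def)
    have "smooth_on ?O (\<lambda>y. (chart_map C1 \<circ> f \<circ> chart_inv c1) (chart_map c1 (chart_inv c y)))"
      by (rule smooth_on_compose[OF op 1(5) _ t 1(7)])
        (use chart_inv_map[OF A c] in \<open>auto simp: U'_def\<close>)
    then have G: "smooth_on ?O ?G" by (rule smooth_on_linear_comp[OF op linear_snd])
    have "linear (\<lambda>w. pv \<bullet> snd (g w))" "linear (\<lambda>w. fst (g w))"
      using linear_add[OF g(1)] linear_cmul[OF g(1)] by (auto intro!: linearI simp: inner_add_right)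
    then have s: "smooth_on ?O (\<lambda>y. pv \<bullet> snd (g (?FD y)))" "smooth_on ?O (\<lambda>y. fst (g (?FD y)))"
      using smooth_on_linear_comp[OF op _ FD] by blast+
    have "smooth_on ?O (\<lambda>y. pv \<bullet> (?G y *v fst (g (?FD y))))"
      by (rule smooth_on_bilinear[OF op bounded_bilinear_matrix_dual G s(2)])
    then have "smooth_on ?O (\<lambda>y. - (pv \<bullet> (?G y *v fst (g (?FD y)))))"
      by (rule smooth_on_linear_comp[OF op, rotated]) (simp add: linear_iff)
    from smooth_on_add[OF op s(1) this]
    show "smooth_on ?O (\<lambda>y. \<alpha>' (chart_inv c y) (tangent_vec A c (chart_inv c y) w))"
    proof (rule smooth_on_cong[OF _ op])
      fix y assume "y \<in> ?O"
      then obtain p where p: "p \<in> U'" "p \<in> chart_dom c" "y = chart_map c p" by blast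
      have ip: "chart_inv c y = p" using chart_inv_map[OF A c p(2)] p(3) by simp
      have "chart_inv c1 (chart_map c1 p) = p"
        by (rule chart_inv_map[OF A 1(1)]) (use p(1) 1(4) in \<open>auto simp: U'_def\<close>)
      then have "?G y = G p" by (simp add: G_def ip)
      moreover have "tangent_vec A c p w c2 = ?FD y"
        unfolding p(3) by (rule tangent_vec_apply[OF 2(2) f(1)[OF p(1)]])
      moreover have "tangent_vec A c p w \<in> tangent_space A p" by (rule tangent_vec_in[OF A c p(2)])
      ultimately show "pv \<bullet> snd (g (?FD y)) + - (pv \<bullet> (?G y *v fst (g (?FD y)))) =
          \<alpha>' (chart_inv c y) (tangent_vec A c (chart_inv c y) w)"
        unfolding ip by (simp only: \<alpha>'_def if_True inner_diff_right add_uminus_conv_diff)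
    qed
  qed
  moreover have "\<alpha>' p v = 0" if pU: "p \<in> U'" and v: "v \<in> snd (f p)" for p v
  proof -
    obtain w where w: "w \<in> graph_set g (G p)" "v = tangent_vec A c2 p w"
      using v f(2)[OF pU] by (auto simp: graph_plane_def)
    have "v c2 = w" unfolding w(2) by (rule tangent_vec_self[OF A 2(2) f(1)[OF pU]])
    then show ?thesis using w(1) by (simp add: \<alpha>'_def)
  qed
  ultimately show ?thesis
    unfolding annihilating_extension_def using U'_open qU by blast
qed

text \<open>Differentiating \<open>\<alpha>(E) = 0\<close> along the moving graph vectors \<open>E = (u, G u)\<close> expresses the derivative of
  the coefficients of an extension through the derivative of \<open>G\<close>; this is why neither the extension
  nor more than the 1-jet matters.\<close>

lemma dual_levi_formula:
  fixes g :: "'e::euclidean_space \<Rightarrow> (real^'d) \<times> (real^2)" and A :: "('a, 'e) chart set"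
  assumes M: "smooth_manifold T A" and c: "c \<in> A" "q \<in> chart_dom c" "c = chart_at A q" and g: "linear g" "bij g"
    and sec: "local_section T A (gr_atlas T A :: (_, 'e \<times> (real^'d^2)) chart set) X fst U f" and q: "q \<in> U"
    and fq: "f q = (q, graph_plane A c g q 0)" and \<alpha>: "\<alpha> \<in> annihilator A q (graph_plane A c g q 0)"
  defines "\<Lambda> \<equiv> frechet_derivative (section_coord (gr_chart T A c g) c f) (at (chart_map c q))"
  shows "dual_levi T A (\<lambda>p. snd (f p)) q \<alpha> (tangent_vec A c q (linv g (u, 0))) (tangent_vec A c q (linv g (v, 0))) =
    \<alpha> (tangent_vec A c q (linv g (0, \<Lambda> (linv g (v, 0)) *v u - \<Lambda> (linv g (u, 0)) *v v)))"
proof -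
  note A = A_diff[OF M] and top = chart_dom_subset[OF M]
  let ?C = "gr_chart T A c g" and ?y0 = "chart_map c q"
  let ?G = "section_coord ?C c f"
  note lg = linear_inv_bij[OF g]
  have dom: "f q \<in> chart_dom ?C"
    unfolding fq gr_chart_dom_iff[OF A top c(1) g] using c(2) by blast
  have iq: "chart_inv c ?y0 = q" by (rule chart_inv_map[OF A c(1,2)])
  have G0: "?G ?y0 = 0" unfolding section_coord_def iq fq gr_chart_map[OF A top c(1,2) g(2)] by simp
  have G': "(?G has_derivative \<Lambda>) (at ?y0)" unfolding \<Lambda>_def by (rule section_in_chart(2)[OF M c(1,2) g sec q dom])
  define \<beta> where "\<beta> = (SOME \<alpha>'. annihilating_extension T A (\<lambda>p. snd (f p)) q \<alpha> \<alpha>')"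
  have ex: "\<exists>\<alpha>'. annihilating_extension T A (\<lambda>p. snd (f p)) q \<alpha> \<alpha>'"
    by (rule annihilating_extension_exists[OF M sec q]) (use \<alpha> fq in simp)
  have "annihilating_extension T A (\<lambda>p. snd (f p)) q \<alpha> \<beta>"
    unfolding \<beta>_def by (rule someI_ex[OF ex])
  then obtain V where V: "\<beta> q = \<alpha>" "openin T V" "q \<in> V" "one_form_on A V \<beta>"
      "\<And>p w. p \<in> V \<Longrightarrow> w \<in> snd (f p) \<Longrightarrow> \<beta> p w = 0"
    unfolding annihilating_extension_def by blast
  define a where "a w y = \<beta> (chart_inv c y) (tangent_vec A c (chart_inv c y) w)" for w y
  let ?O = "chart_map c ` (V \<inter> chart_dom c)"
  have op: "open ?O"
  proof -
    have "openin T (V \<inter> chart_dom c)" using V(2) M c(1) unfolding smooth_manifold_def by blast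
    then show ?thesis using smooth_manifold_chart_open_iff[OF M c(1), of "V \<inter> chart_dom c"] by simp
  qed
  have y0: "?y0 \<in> ?O" using V(3) c(2) by blast
  have a_smooth: "smooth_on ?O (a w)" for w
    using V(4) c(1) unfolding one_form_on_def a_def by blast
  have a_diff: "(a w has_derivative frechet_derivative (a w) (at ?y0)) (at ?y0)" for w
    using smooth_on_differentiable[OF a_smooth op y0] by (simp add: frechet_derivative_works)
  have a_lin: "linear (\<lambda>w. a w y)" if yO: "y \<in> ?O" for y
  proof -
    obtain p where p: "p \<in> V" "p \<in> chart_dom c" "y = chart_map c p" using yO by blast
    have "chart_inv c y = p" using chart_inv_map[OF A c(1) p(2)] p(3) by simp
    then show ?thesis
      unfolding a_def using Hom_on_tangent_vec_linear[OF A c(1) p(2), of "\<beta> p"] V(4) p(1)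
      unfolding one_form_on_def by simp
  qed
  define e where "e i = linv g (0, axis i 1)" for i :: 2
  have split: "linv g (u, s) = linv g (u, 0) + (\<Sum>i\<in>UNIV. (s $ i) *\<^sub>R e i)" for u s
  proof -
    have s: "linear (\<lambda>s. linv g (0, s))"
      using linear_add[OF lg] linear_cmul[OF lg] by (intro linearI) (simp_all flip: linear_add[OF lg] linear_cmul[OF lg])
    have "(\<Sum>i\<in>UNIV. (s $ i) *\<^sub>R axis i 1) = s"
      using basis_expansion[of s] by (simp add: scalar_mult_eq_scaleR)
    then have "linv g (0, s) = linv g (0, \<Sum>i\<in>UNIV. (s $ i) *\<^sub>R axis i 1)" by (simp only:)
    also have "\<dots> = (\<Sum>i\<in>UNIV. (s $ i) *\<^sub>R e i)"
      unfolding e_def by (simp only: linear_sum[OF s] linear_cmul[OF s])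
    finally have "linv g (0, s) = (\<Sum>i\<in>UNIV. (s $ i) *\<^sub>R e i)" .
    moreover have "linv g (u, s) = linv g (u, 0) + linv g (0, s)"
      using linear_add[OF lg, of "(u, 0)" "(0, s)"] by simp
    ultimately show ?thesis by simp
  qed
  have a_split: "a (linv g (u, s)) y = a (linv g (u, 0)) y + (\<Sum>i\<in>UNIV. (s $ i) * a (e i) y)" if "y \<in> ?O" for u s y
    unfolding split[of u s]
    by (simp add: linear_add[OF a_lin[OF that]] linear_sum[OF a_lin[OF that]] linear_cmul[OF a_lin[OF that]])
  have D: "frechet_derivative (a (linv g (u, 0))) (at ?y0) w = - a (linv g (0, \<Lambda> w *v u)) ?y0" for u w
  proof -
    have "((\<lambda>y. (?G y *v u) $ i) has_derivative (\<lambda>w. (\<Lambda> w *v u) $ i)) (at ?y0)" for i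
    proof -
      have "linear (\<lambda>H::real^'d^2. (H *v u) $ i)"
        by (rule linearI) (simp_all add: matrix_vector_mult_add_rdistrib scaleR_matrix_vector_assoc[symmetric])
      then show ?thesis
        using bounded_linear.has_derivative[OF _ G'] by (simp add: linear_conv_bounded_linear)
    qed
    then have "((\<lambda>y. (?G y *v u) $ i * a (e i) y) has_derivative (\<lambda>w. (\<Lambda> w *v u) $ i * a (e i) ?y0)) (at ?y0)" for i
      using has_derivative_mult[OF _ a_diff] by (fastforce simp: G0)
    then have h: "((\<lambda>y. - (\<Sum>i\<in>UNIV. (?G y *v u) $ i * a (e i) y)) has_derivative
        (\<lambda>w. - (\<Sum>i\<in>UNIV. (\<Lambda> w *v u) $ i * a (e i) ?y0))) (at ?y0)"
      by (intro has_derivative_minus has_derivative_sum)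
    have "\<forall>\<^sub>F y in nhds ?y0. y \<in> ?O" by (rule eventually_nhds_in_open[OF op y0])
    then have "\<forall>\<^sub>F y in nhds ?y0. - (\<Sum>i\<in>UNIV. (?G y *v u) $ i * a (e i) y) = a (linv g (u, 0)) y"
      using section_in_chart(1)[OF M c(1,2) g sec q dom]
    proof eventually_elim
      case (elim y)
      then obtain p where p: "p \<in> V" "p \<in> chart_dom c" "y = chart_map c p" by blast
      have ip: "chart_inv c y = p" using chart_inv_map[OF A c(1) p(2)] p(3) by simp
      have "tangent_vec A c p (linv g (u, ?G y *v u)) \<in> snd (f p)"
        using elim(2) unfolding ip by (simp add: graph_plane_def bij_inv_apply(1)[OF g(2)])
      then have "a (linv g (u, ?G y *v u)) y = 0" unfolding a_def ip by (rule V(5)[OF p(1)])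
      then show ?case using a_split[OF elim(1), of u "?G y *v u"] by simp
    qed
    from has_derivative_cong_nhds[OF h this]
    have "frechet_derivative (a (linv g (u, 0))) (at ?y0) w = - (\<Sum>i\<in>UNIV. (\<Lambda> w *v u) $ i * a (e i) ?y0)"
      by (simp add: frechet_derivative_eqI)
    moreover have "a (linv g (0, 0)) ?y0 = 0"
      using linear_0[OF a_lin[OF y0]] linear_0[OF lg] by (simp add: zero_prod_def)
    ultimately show ?thesis using a_split[OF y0, of 0 "\<Lambda> w *v u"] by simp
  qed
  have "dual_levi T A (\<lambda>p. snd (f p)) q \<alpha> (tangent_vec A c q (linv g (u, 0))) (tangent_vec A c q (linv g (v, 0))) =
      frechet_derivative (a (linv g (v, 0))) (at ?y0) (linv g (u, 0)) -
      frechet_derivative (a (linv g (u, 0))) (at ?y0) (linv g (v, 0))"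
    unfolding dual_levi_def \<beta>_def[symmetric] ext_deriv_def Let_def c(3)[symmetric] tangent_vec_self[OF A c(1,2)] a_def[abs_def] ..
  also have "\<dots> = a (linv g (0, \<Lambda> (linv g (v, 0)) *v u)) ?y0 - a (linv g (0, \<Lambda> (linv g (u, 0)) *v v)) ?y0"
    unfolding D by simp
  also have "\<dots> = a (linv g (0, \<Lambda> (linv g (v, 0)) *v u - \<Lambda> (linv g (u, 0)) *v v)) ?y0"
  proof -
    have "linv g (0, s - s') = linv g (0, s) - linv g (0, s')" for s s'
      using linear_diff[OF lg, of "(0, s)" "(0, s')"] by simp
    then show ?thesis by (simp only: linear_diff[OF a_lin[OF y0]])
  qed
  finally show ?thesis unfolding a_def iq V(1) .
qed

section \<open>The pencil of a section\<close>

lemma ordered_basis_image: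
  fixes f :: "real^'n \<Rightarrow> 'w::real_vector"
  assumes "linear f" "inj f" "bij_betw e {..<n} (UNIV :: 'n set)"
  shows "ordered_basis n (\<lambda>i. f (axis (e i) 1)) (range f)"
proof -
  have "(\<lambda>i. axis (e i) 1) ` {..<n} = (\<lambda>j. axis j (1::real)) ` (e ` {..<n})" by (simp add: image_image)
  also have "\<dots> = (Basis :: (real^'n) set)"
    using assms(3) by (auto simp: bij_betw_def Basis_vec_def)
  finally have B: "(\<lambda>i. f (axis (e i) 1)) ` {..<n} = f ` Basis" by (metis image_image)
  have "inj_on (\<lambda>i. f (axis (e i) 1)) {..<n}"
  proof (rule inj_onI)
    fix i j assume ij: "i \<in> {..<n}" "j \<in> {..<n}" "f (axis (e i) 1) = f (axis (e j) 1)"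
    then have "axis (e i) (1::real) = axis (e j) 1" using assms(2) by (simp add: inj_eq)
    then have "e i = e j" by (simp add: axis_eq_axis)
    then show "i = j" by (rule inj_onD[OF bij_betw_imp_inj_on[OF assms(3)] _ ij(1,2)])
  qed
  moreover have "independent (f ` Basis)"
    by (rule linear_independent_injective_image[OF assms(1) independent_Basis]) (use assms(2) in \<open>auto intro: inj_on_subset\<close>)
  moreover have "span (f ` Basis) = range f"
    using linear_span_image[OF assms(1), of Basis] by simp
  ultimately show ?thesis unfolding ordered_basis_def B by simp
qed

lemma ordered_basis_in: "ordered_basis n b S \<Longrightarrow> i < n \<Longrightarrow> b i \<in> S"
  unfolding ordered_basis_def by (auto intro: span_base)

lemma ordered_basis_2_independent:
  assumes "ordered_basis 2 p S" "a *\<^sub>R p 0 + b *\<^sub>R p 1 = 0"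
  shows "a = 0 \<and> b = 0"
proof -
  have S: "{..<2} = {0, 1::nat}" by auto
  have inj: "p 0 \<noteq> p 1" and ind: "independent {p 0, p 1}"
    using assms(1) unfolding ordered_basis_def S by (auto simp: inj_on_def)
  define u where "u v = (if v = p 0 then a else b)" for v
  have sum0: "(\<Sum>v\<in>{p 0, p 1}. u v *\<^sub>R v) = 0" using assms(2) inj by (simp add: u_def)
  have "u v = 0" if "v \<in> {p 0, p 1}" for v
    by (rule independentD[OF ind _ _ sum0 that]) auto
  from this[of "p 0"] this[of "p 1"] show ?thesis using inj by (simp add: u_def)
qed

lemma exists_linear_bij:
  assumes "DIM('e::euclidean_space) = DIM('f::euclidean_space)"
  shows "\<exists>g :: 'e \<Rightarrow> 'f. linear g \<and> bij g"
proof -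
  obtain g :: "'e \<Rightarrow> 'f" where "linear g" "g ` UNIV = UNIV" "inj_on g UNIV"
    using subspace_isomorphism[of "UNIV :: 'e set" "UNIV :: 'f set"] assms by auto
  then show ?thesis by (auto simp: bij_def)
qed

lemma hyperplane_of_image:
  fixes f :: "'e::euclidean_space \<Rightarrow> 'w::real_vector" and \<phi> :: "'e \<Rightarrow> real"
  assumes f: "linear f" "inj f" and \<phi>: "linear \<phi>" "\<phi> a \<noteq> 0"
  shows "hyperplane_of (range f) (f ` {w. \<phi> w = 0})"
proof -
  define r where "r = adjoint \<phi> 1"
  have \<phi>_inner: "\<phi> w = r \<bullet> w" for w
    using adjoint_works[OF \<phi>(1), of w 1] by (simp add: r_def inner_commute)
  have nz: "r \<noteq> 0" using \<phi>(2) unfolding \<phi>_inner by auto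
  have "dim {w. \<phi> w = 0} = DIM('e) - 1"
    unfolding \<phi>_inner by (rule dim_hyperplane[OF nz])
  moreover have "DIM('e) > 0" by simp
  ultimately have "dim (f ` {w. \<phi> w = 0}) + 1 = dim (range f)"
    by (simp add: dim_injective_image[OF f])
  moreover have "subspace (f ` {w. \<phi> w = 0})"
    by (intro linear_subspace_image[OF f(1)] linear_subspace_kernel[OF \<phi>(1)])
  ultimately show ?thesis unfolding hyperplane_of_def by blast
qed

lemma axis_expansion: "u = (\<Sum>l<n. (u $ e l) *\<^sub>R axis (e l) 1)"
  if "bij_betw e {..<n} (UNIV :: 'n set)" for u :: "real^'n"
proof -
  have "u = (\<Sum>i\<in>UNIV. (u $ i) *\<^sub>R axis i 1)"
    using basis_expansion[of u] by (simp add: scalar_mult_eq_scaleR)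
  also have "\<dots> = (\<Sum>l<n. (u $ e l) *\<^sub>R axis (e l) 1)"
    by (rule sum.reindex_bij_betw[OF that, symmetric])
  finally show ?thesis .
qed

text \<open>The entries of the k-th form of the pencil in the standard bases, for a section with derivative
\<open>\<Lambda>\<close>.\<close>

definition levi_entry ::
  "('e \<Rightarrow> (real^'d) \<times> (real^2)) \<Rightarrow> (nat \<Rightarrow> 'd) \<Rightarrow> ('e \<Rightarrow> real^'d^2) \<Rightarrow> 2 \<Rightarrow> nat \<Rightarrow> nat \<Rightarrow> real" where
  "levi_entry g e \<Lambda> k i j =
     \<Lambda> (linv g (axis (e j) 1, 0)) $ k $ e i - \<Lambda> (linv g (axis (e i) 1, 0)) $ k $ e j"

lemma levi_entry_bilinear:
  fixes g :: "'e::euclidean_space \<Rightarrow> (real^'d) \<times> (real^2)"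
  assumes g: "linear g" "bij g" and \<Lambda>: "linear \<Lambda>" and e: "bij_betw e {..<n} (UNIV :: 'd set)"
  shows "(\<Lambda> (linv g (v, 0)) *v u - \<Lambda> (linv g (u, 0)) *v v) $ k =
    (\<Sum>l<n. \<Sum>m<n. u $ e l * v $ e m * levi_entry g e \<Lambda> k l m)"
proof -
  have lin: "linear (\<lambda>u. \<Lambda> (linv g (u, 0)))"
  proof (rule linearI)
    note lg = linear_inv_bij[OF g]
    show "\<Lambda> (linv g (x + y, 0)) = \<Lambda> (linv g (x, 0)) + \<Lambda> (linv g (y, 0))" for x y
      using linear_add[OF lg, of "(x, 0)" "(y, 0)"] linear_add[OF \<Lambda>] by simp
    show "\<Lambda> (linv g (r *\<^sub>R x, 0)) = r *\<^sub>R \<Lambda> (linv g (x, 0))" for r x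
      using linear_cmul[OF lg, of r "(x, 0)"] linear_cmul[OF \<Lambda>] by simp
  qed
  have one: "(\<Lambda> (linv g (v, 0)) *v u) $ k =
      (\<Sum>l<n. \<Sum>m<n. u $ e l * v $ e m * \<Lambda> (linv g (axis (e m) 1, 0)) $ k $ e l)" for u v
  proof -
    have "\<Lambda> (linv g (v, 0)) = (\<Sum>m<n. (v $ e m) *\<^sub>R \<Lambda> (linv g (axis (e m) 1, 0)))"
      by (subst axis_expansion[OF e, of v]) (simp only: linear_sum[OF lin] linear_cmul[OF lin])
    then have entry: "\<Lambda> (linv g (v, 0)) $ k $ j = (\<Sum>m<n. v $ e m * \<Lambda> (linv g (axis (e m) 1, 0)) $ k $ j)" for j
      by (simp add: sum_component)
    have "(\<Lambda> (linv g (v, 0)) *v u) $ k = (\<Sum>j\<in>UNIV. \<Lambda> (linv g (v, 0)) $ k $ j * u $ j)"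
      by (simp add: matrix_vector_mult_def)
    also have "\<dots> = (\<Sum>l<n. \<Lambda> (linv g (v, 0)) $ k $ e l * u $ e l)"
      by (rule sum.reindex_bij_betw[OF e, symmetric])
    finally show ?thesis unfolding entry by (simp add: sum_distrib_left sum_distrib_right mult_ac)
  qed
  have "(\<Lambda> (linv g (u, 0)) *v v) $ k =
      (\<Sum>l<n. \<Sum>m<n. u $ e l * v $ e m * \<Lambda> (linv g (axis (e l) 1, 0)) $ k $ e m)"
    unfolding one[of u v] by (subst sum.swap) (simp add: mult_ac)
  then show ?thesis
    by (simp add: one levi_entry_def right_diff_distrib sum_subtractf)
qed

lemma annihilator_apply:
  fixes g :: "'e::euclidean_space \<Rightarrow> (real^'d) \<times> (real^2)"
  assumes A: "diff_atlas A" and c: "c \<in> A" "q \<in> chart_dom c" and g: "linear g" "bij g"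
    and \<alpha>: "\<alpha> \<in> annihilator A q (graph_plane A c g q 0)"
  shows "\<alpha> (tangent_vec A c q (linv g (u, s))) =
    \<alpha> (tangent_vec A c q (linv g (0, axis 1 1))) * s $ 1 + \<alpha> (tangent_vec A c q (linv g (0, axis 2 1))) * s $ 2"
proof -
  have hom: "\<alpha> \<in> Hom_on (tangent_space A q) UNIV" and zero: "\<And>v. v \<in> graph_plane A c g q 0 \<Longrightarrow> \<alpha> v = 0"
    using \<alpha> unfolding annihilator_def by auto
  have van: "\<alpha> (tangent_vec A c q w) = 0" if "w \<in> graph_set g 0" for w
    by (rule zero) (use that in \<open>simp add: graph_plane_def\<close>)
  obtain p where "\<forall>w. \<alpha> (tangent_vec A c q w) = p \<bullet> (snd (g w) - 0 *v fst (g w))"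
    using vanishing_on_graph[OF Hom_on_tangent_vec_linear[OF A c hom] g van] by blast
  then have "\<alpha> (tangent_vec A c q (linv g (u, s))) = p \<bullet> s" for u s
    by (simp add: bij_inv_apply(1)[OF g(2)])
  moreover have "p \<bullet> s = p $ 1 * s $ 1 + p $ 2 * s $ 2" for s
    by (simp add: inner_vec_def sum_2)
  ultimately show ?thesis by (simp add: axis_def)
qed

text \<open>A change of the basis of the plane multiplies the Pfaffian by a constant and a change of the basis of
  the annihilator substitutes linearly, so the number of roots may be read off from the standard bases.\<close>

lemma pencil_has_root_count:
  fixes g :: "'e::euclidean_space \<Rightarrow> (real^'d) \<times> (real^2)" and A :: "('a, 'e) chart set"
  assumes M: "smooth_manifold T A" and c: "c \<in> A" "q \<in> chart_dom c" "c = chart_at A q" and g: "linear g" "bij g"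
    and sec: "local_section T A (gr_atlas T A :: (_, 'e \<times> (real^'d^2)) chart set) X fst U f" and q: "q \<in> U"
    and fq: "f q = (q, graph_plane A c g q 0)" and e: "bij_betw e {..<2 * N} (UNIV :: 'd set)"
    and p: "ordered_basis 2 p (annihilator A q (snd (f q)))" and b: "ordered_basis (2 * N) b (snd (f q))"
    and cnt: "has_root_count k (pencil_pfaffian T A N (\<lambda>q. snd (f q)) q p b)"
  defines "\<omega> \<equiv> levi_entry g e (frechet_derivative (section_coord (gr_chart T A c g) c f) (at (chart_map c q)))"
  shows "has_root_count k (\<lambda>\<mu> \<nu>. pfaffian N (\<lambda>i j. \<mu> * \<omega> 1 i j + \<nu> * \<omega> 2 i j))"
proof -
  note A = A_diff[OF M] and top = chart_dom_subset[OF M]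
  let ?\<Lambda> = "frechet_derivative (section_coord (gr_chart T A c g) c f) (at (chart_map c q))"
  let ?tv = "tangent_vec A c q"
  have dom: "f q \<in> chart_dom (gr_chart T A c g)"
    unfolding fq gr_chart_dom_iff[OF A top c(1) g] using c(2) by blast
  have \<Lambda>: "linear ?\<Lambda>" using section_in_chart(2)[OF M c(1,2) g sec q dom] has_derivative_linear by blast
  define C where "C m k = p m (?tv (linv g (0, axis k 1)))" for m :: nat and k :: 2
  have pm: "p m \<in> annihilator A q (graph_plane A c g q 0)" if "m < 2" for m
    using ordered_basis_in[OF p that] fq by simp
  have p_apply: "p m (?tv (linv g (u, s))) = C m 1 * s $ 1 + C m 2 * s $ 2" if "m < 2" for m u s
    unfolding C_def by (rule annihilator_apply[OF A c(1,2) g pm[OF that]])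
  have "\<exists>u. b i = ?tv (linv g (u, 0))" if "i < 2 * N" for i
  proof -
    have "b i \<in> ?tv ` graph_set g 0" using ordered_basis_in[OF b that] fq by (simp add: graph_plane_def)
    then show ?thesis unfolding graph_set_eq_range[OF g(2)] by auto
  qed
  then obtain B where B: "\<And>i. i < 2 * N \<Longrightarrow> b i = ?tv (linv g (B i, 0))" by metis
  have levi: "dual_levi T A (\<lambda>q. snd (f q)) q (p m) (b i) (b j) =
      (\<Sum>l<2 * N. \<Sum>l'<2 * N. B i $ e l * B j $ e l' * (C m 1 * \<omega> 1 l l' + C m 2 * \<omega> 2 l l'))"
    if "m < 2" "i < 2 * N" "j < 2 * N" for m i j
  proof -
    have "dual_levi T A (\<lambda>q. snd (f q)) q (p m) (b i) (b j) =
        p m (?tv (linv g (0, ?\<Lambda> (linv g (B j, 0)) *v B i - ?\<Lambda> (linv g (B i, 0)) *v B j)))"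
      unfolding B[OF that(2)] B[OF that(3)] by (rule dual_levi_formula[OF M c g sec q fq pm[OF that(1)]])
    also have "\<dots> = C m 1 * (\<Sum>l<2 * N. \<Sum>l'<2 * N. B i $ e l * B j $ e l' * \<omega> 1 l l')
        + C m 2 * (\<Sum>l<2 * N. \<Sum>l'<2 * N. B i $ e l * B j $ e l' * \<omega> 2 l l')"
      unfolding p_apply[OF that(1)] levi_entry_bilinear[OF g \<Lambda> e] \<omega>_def ..
    also have "\<dots> = (\<Sum>l<2 * N. \<Sum>l'<2 * N. B i $ e l * B j $ e l' * (C m 1 * \<omega> 1 l l' + C m 2 * \<omega> 2 l l'))"
      by (simp add: sum_distrib_left sum.distrib distrib_left mult_ac)
    finally show ?thesis .
  qed
  define d where "d = det_fn (2 * N) (\<lambda>l i. B i $ e l)"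
  have pf: "pencil_pfaffian T A N (\<lambda>q. snd (f q)) q p b \<mu> \<nu> =
      d * pfaffian N (\<lambda>i j. (C 0 1 * \<mu> + C 1 1 * \<nu>) * \<omega> 1 i j + (C 0 2 * \<mu> + C 1 2 * \<nu>) * \<omega> 2 i j)" for \<mu> \<nu>
    unfolding pencil_pfaffian_def d_def
  proof (rule pfaffian_congruence)
    fix i j assume ij: "i < 2 * N" "j < 2 * N"
    show "\<mu> * dual_levi T A (\<lambda>q. snd (f q)) q (p 0) (b i) (b j) + \<nu> * dual_levi T A (\<lambda>q. snd (f q)) q (p 1) (b i) (b j) =
        (\<Sum>k<2 * N. \<Sum>l<2 * N. B i $ e k * B j $ e l *
          ((C 0 1 * \<mu> + C 1 1 * \<nu>) * \<omega> 1 k l + (C 0 2 * \<mu> + C 1 2 * \<nu>) * \<omega> 2 k l))"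
      using levi[OF _ ij, of 0] levi[OF _ ij, of 1]
      by (simp add: sum_distrib_left sum.distrib[symmetric] algebra_simps)
  qed
  have "C 0 1 * C 1 2 \<noteq> C 1 1 * C 0 2"
  proof
    assume sing: "C 0 1 * C 1 2 = C 1 1 * C 0 2"
    have vanish: "x = 0 \<and> y = 0" if "x * C 0 1 + y * C 1 1 = 0" "x * C 0 2 + y * C 1 2 = 0" for x y
    proof (rule ordered_basis_2_independent[OF p])
      show "x *\<^sub>R p 0 + y *\<^sub>R p 1 = 0"
      proof
        fix v show "(x *\<^sub>R p 0 + y *\<^sub>R p 1) v = (0 :: (('a, 'e) tvec \<Rightarrow> real)) v"
        proof (cases "v \<in> tangent_space A q")
          case True
          have v: "v = ?tv (linv g (fst (g (v c)), snd (g (v c))))"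
            using tangent_vec_of[OF c(1,2) True] by (simp add: bij_inv_apply(2)[OF g(2)])
          have "x * (C 0 1 * s + C 0 2 * t) + y * (C 1 1 * s + C 1 2 * t) =
              s * (x * C 0 1 + y * C 1 1) + t * (x * C 0 2 + y * C 1 2)" for s t
            by (simp add: algebra_simps)
          then show ?thesis
            using p_apply[of 0] p_apply[of 1] that by (subst v, subst v) simp
        next
          case False
          have "p m v = 0" if "m < 2" for m
            using pm[OF that] Hom_onD(3)[OF _ False, of "p m"] unfolding annihilator_def by blast
          then show ?thesis by simp
        qed
      qed
    qed
    have "C 1 2 = 0 \<and> - C 0 2 = 0" "C 1 1 = 0 \<and> - C 0 1 = 0"
      using vanish[of "C 1 2" "- C 0 2"] vanish[of "C 1 1" "- C 0 1"] sing by (simp_all add: algebra_simps)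
    then show False using vanish[of 1 0] by simp
  qed
  then show ?thesis
    using has_root_count_linear_change[where P = "\<lambda>\<mu> \<nu>. pfaffian N (\<lambda>i j. \<mu> * \<omega> 1 i j + \<nu> * \<omega> 2 i j)",
        OF pf _ cnt] by blast
qed

section \<open>Failure of ampleness\<close>

text \<open>If an affine function without zeros on \<open>S\<close> is positive at a point of \<open>S\<close>, it is positive on the convex
  hull of the component of that point; so this hull misses every point of \<open>P\<close> where it vanishes.\<close>

lemma component_hull_misses_zero:
  fixes S P :: "'v::{real_vector, topological_space} set" and \<Phi> :: "'v \<Rightarrow> real"
  assumes cont: "continuous_on UNIV \<Phi>"
    and affine: "\<And>x y t. \<Phi> ((1 - t) *\<^sub>R x + t *\<^sub>R y) = (1 - t) * \<Phi> x + t * \<Phi> y"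
    and nz: "\<And>x. x \<in> S \<Longrightarrow> \<Phi> x \<noteq> 0" and x: "x \<in> S" "\<Phi> x > 0" and y: "y \<in> P" "\<Phi> y = 0"
  shows "\<exists>C\<in>components S. convex hull C \<noteq> P"
proof
  let ?C = "connected_component_set S x"
  show "?C \<in> components S" using x(1) by (rule componentsI)
  have sub: "?C \<subseteq> S" by (rule connected_component_subset)
  have "connected (\<Phi> ` ?C)"
    by (rule connected_continuous_image[OF continuous_on_subset[OF cont] connected_connected_component]) simp
  then have iv: "is_interval (\<Phi> ` ?C)" by (simp add: is_interval_connected_1)
  have xC: "x \<in> ?C" using x(1) by simp
  have "?C \<subseteq> {z. \<Phi> z > 0}"
  proof
    fix z assume z: "z \<in> ?C"
    show "z \<in> {z. \<Phi> z > 0}"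
    proof (rule ccontr)
      assume "z \<notin> {z. \<Phi> z > 0}"
      then have "0 \<in> \<Phi> ` ?C"
        using z xC x(2) by (intro mem_is_interval_1_I[OF iv imageI[OF z] imageI[OF xC]]) simp_all
      then show False using nz sub by auto
    qed
  qed
  moreover have "convex {z. \<Phi> z > 0}"
  proof (rule convexI)
    fix u v :: 'v and s t :: real
    assume uv: "u \<in> {z. \<Phi> z > 0}" "v \<in> {z. \<Phi> z > 0}" and st: "0 \<le> s" "0 \<le> t" "s + t = 1"
    have "s = 1 - t" using st(3) by simp
    then have "\<Phi> (s *\<^sub>R u + t *\<^sub>R v) = s * \<Phi> u + t * \<Phi> v" by (simp only: affine)
    moreover have "s * \<Phi> u + t * \<Phi> v > 0"
    proof (cases "t = 0")
      case True
      then show ?thesis using uv(1) st(3) by simp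
    next
      case False
      then have "t * \<Phi> v > 0" using uv(2) st(2) by simp
      moreover have "s * \<Phi> u \<ge> 0" using uv(1) st(1) by simp
      ultimately show ?thesis by simp
    qed
    ultimately show "s *\<^sub>R u + t *\<^sub>R v \<in> {z. \<Phi> z > 0}" by simp
  qed
  ultimately have "convex hull ?C \<subseteq> {z. \<Phi> z > 0}" by (rule hull_minimal)
  then show "convex hull ?C \<noteq> P" using y by auto
qed

theorem mainTheorem6:
  fixes T :: "'a topology"
    and A :: "('a, 'e::euclidean_space) chart set"
    and \<Gamma> :: "('a, 'e) gr_point
               \<Rightarrow> (('a, 'e) gr_point, 'e \<times> (real^'d^2)) tvec
               \<Rightarrow> (('a, 'e) gr_point, 'e \<times> (real^'d^2)) tvec"
    and N k :: nat
  assumes "N \<ge> 2"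
    and "smooth_manifold T A" and "topspace T \<noteq> {}"
    and "DIM('e) = 2 * N + 2"
    and "CARD('d::finite) = 2 * N"
    and "k \<le> N" and "k mod 2 = N mod 2"
    and "is_connection A (gr_atlas T A) (gr_bundle T A (2 * N)) fst \<Gamma>"
  shows "\<not> ample A (gr_atlas T A) (gr_bundle T A (2 * N)) fst \<Gamma> (pfaffian_root_relation T A N k)"
proof -
  note M = assms(2) and conn = assms(8)
  note At = A_diff[OF M] and top = chart_dom_subset[OF M]
  let ?B = "gr_atlas T A :: (_, 'e \<times> (real^'d^2)) chart set"
  let ?X = "gr_bundle T A (2 * N)"
  obtain q where q: "q \<in> topspace T" using assms(3) by blast
  obtain c0 where "c0 \<in> A" "q \<in> chart_dom c0" using q M unfolding smooth_manifold_def by blast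
  then have ca: "chart_at A q \<in> A \<and> q \<in> chart_dom (chart_at A q)" by (rule chart_at_in)
  define c where "c = chart_at A q"
  have c: "c \<in> A" "q \<in> chart_dom c" "c = chart_at A q" using ca by (simp_all add: c_def)
  have "DIM('e) = DIM((real^'d) \<times> (real^2))" using assms(4,5) by simp
  then obtain g :: "'e \<Rightarrow> (real^'d) \<times> (real^2)" where g: "linear g" "bij g" using exists_linear_bij by blast
  note lg = linear_inv_bij[OF g] and gi = bij_inv_apply(1)[OF g(2)]
  obtain e where e: "bij_betw e {..<2 * N} (UNIV :: 'd set)"
    using ex_bij_betw_nat_finite[of "UNIV :: 'd set"] assms(5) by (auto simp: atLeast0LessThan)
  define e' where "e' = inv_into {..<2 * N} e"
  have e'e: "e' (e i) = i" if "i < 2 * N" for i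
    unfolding e'_def using bij_betw_inv_into_left[OF e] that by simp
  have e_inj: "e i = e j \<longleftrightarrow> i = j" if "i < 2 * N" "j < 2 * N" for i j using e'e that by metis
  have N0: "0 < 2 * N" "N < 2 * N" using assms(1) by simp_all
  let ?tv = "tangent_vec A c q"
  note tvl = tangent_vec_linear[OF At c(1,2)] and tvi = tangent_vec_inj[OF At c(1,2)]
    and tvs = tangent_vec_self[OF At c(1,2)] and tvT = tangent_vec_in[OF At c(1,2)]
  define D where "D = graph_plane A c g q 0"
  define x where "x = (q, D)"
  define C where "C = gr_chart T A c g"
  have CB: "C \<in> ?B" unfolding gr_atlas_def C_def using c(1) g by blast
  have xX: "x \<in> ?X"
    unfolding x_def D_def using graph_plane_in_gr_bundle[OF At top c(1,2) g, of 0] assms(5) by simp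
  have xC: "x \<in> chart_dom C"
    unfolding x_def D_def C_def gr_chart_dom_iff[OF At top c(1) g] using c(2) by blast
  note Bd = gr_atlas_diff[OF M]
  have Tx_sub: "subspace (tangent_space ?B x)" by (rule tangent_space_subspace[OF Bd CB xC])
  have Tq_sub: "subspace (tangent_space A q)" by (rule tangent_space_subspace[OF At c(1,2)])
  define b where "b i = ?tv (linv g (axis (e i) 1, 0))" for i
  have bc: "b i c = linv g (axis (e i) 1, 0)" for i unfolding b_def by (rule tvs)
  have b_basis: "ordered_basis (2 * N) b D"
  proof -
    have lin: "linear (\<lambda>u. ?tv (linv g (u, 0)))"
    proof (rule linearI)
      show "?tv (linv g (u + v, 0)) = ?tv (linv g (u, 0)) + ?tv (linv g (v, 0))" for u v
        using linear_add[OF lg, of "(u, 0)" "(v, 0)"] linear_add[OF tvl] by simp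
      show "?tv (linv g (r *\<^sub>R v, 0)) = r *\<^sub>R ?tv (linv g (v, 0))" for r v
        using linear_cmul[OF lg, of r "(v, 0)"] linear_cmul[OF tvl] by simp
    qed
    have inj: "inj (\<lambda>u. ?tv (linv g (u, 0)))"
    proof (rule injI)
      fix u v assume "?tv (linv g (u, 0)) = ?tv (linv g (v, 0))"
      then have "g (linv g (u, 0)) = g (linv g (v, 0))" using tvi by (simp add: inj_eq)
      then show "u = v" by (simp add: gi)
    qed
    have "D = range (\<lambda>u. ?tv (linv g (u, 0)))"
      unfolding D_def graph_plane_def graph_set_eq_range[OF g(2)] by (simp add: image_image)
    then show ?thesis using ordered_basis_image[OF lin inj e] by (simp add: b_def[abs_def])
  qed
  define pf where "pf s v = (if v \<in> tangent_space A q then s \<bullet> snd (g (v c)) else 0)" for s :: "real^2" and v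
  define \<epsilon> where "\<epsilon> i = (if i = 0 then 1 else 2 :: 2)" for i :: nat
  define p where "p i = pf (axis (\<epsilon> i) 1)" for i
  have p_tv: "p i (?tv w) = snd (g w) $ \<epsilon> i" for i w
    unfolding p_def pf_def by (simp add: tvT tvs inner_axis inner_commute)
  have p_basis: "ordered_basis 2 p (annihilator A q D)"
  proof -
    have lin: "linear pf" by (rule linearI) (auto simp: pf_def fun_eq_iff inner_add_left)
    have inj: "inj pf"
    proof (rule injI)
      fix s t assume "pf s = pf t"
      then have "pf s (?tv (linv g (0, s - t))) = pf t (?tv (linv g (0, s - t)))" by simp
      then have "(s - t) \<bullet> (s - t) = 0" by (simp add: pf_def tvT tvs gi inner_diff_left)
      then show "s = t" by simp
    qed
    have "range pf = annihilator A q D"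
    proof (intro equalityI subsetI)
      fix \<alpha> assume "\<alpha> \<in> range pf"
      then obtain s where s: "\<alpha> = pf s" by blast
      show "\<alpha> \<in> annihilator A q D"
        unfolding annihilator_def Hom_on_def lin_on_def s
        using subspace_add[OF Tq_sub] subspace_scale[OF Tq_sub] linear_add[OF g(1)] linear_cmul[OF g(1)]
        by (auto simp: pf_def inner_add_right D_def graph_plane_def tvs)
    next
      fix \<alpha> assume \<alpha>: "\<alpha> \<in> annihilator A q D"
      then have hom: "\<alpha> \<in> Hom_on (tangent_space A q) UNIV" and zero: "\<And>v. v \<in> D \<Longrightarrow> \<alpha> v = 0"
        unfolding annihilator_def by auto
      have van: "\<alpha> (?tv w) = 0" if "w \<in> graph_set g 0" for w
        by (rule zero) (use that in \<open>simp add: D_def graph_plane_def\<close>)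
      obtain s where s: "\<forall>w. \<alpha> (?tv w) = s \<bullet> (snd (g w) - 0 *v fst (g w))"
        using vanishing_on_graph[OF Hom_on_tangent_vec_linear[OF At c(1,2) hom] g van] by blast
      have "\<alpha> v = pf s v" for v
      proof (cases "v \<in> tangent_space A q")
        case True
        then show ?thesis using s[rule_format, of "v c"] tangent_vec_of[OF c(1,2) True] by (simp add: pf_def)
      next
        case False
        then show ?thesis using Hom_onD(3)[OF hom False] by (simp add: pf_def)
      qed
      then show "\<alpha> \<in> range pf" by (intro range_eqI[where x = s] ext)
    qed
    moreover have "{..<2} = {0, 1::nat}" by auto
    then have "bij_betw \<epsilon> {..<2} (UNIV :: 2 set)"
      by (auto simp: bij_betw_def \<epsilon>_def UNIV_2)
    ultimately show ?thesis using ordered_basis_image[OF lin inj] by (simp add: p_def[abs_def])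
  qed
  obtain U V where UV: "\<forall>i j. U j i = - U i j \<and> V j i = - V i j" and U1: "U 0 N = 1"
    and simple: "exactly_simple_real_roots N k (\<lambda>\<mu> \<nu>. pfaffian N (\<lambda>i j. \<mu> * U i j + \<nu> * V i j))"
    and bad: "\<forall>U' V'. (\<forall>i<2 * N. \<forall>j<2 * N. U' j i = - U' i j \<and> V' j i = - V' i j) \<longrightarrow>
       (\<forall>i j. 1 \<le> i \<and> i < 2 * N \<and> 1 \<le> j \<and> j < 2 * N \<longrightarrow> U' i j = U i j \<and> V' i j = V i j) \<longrightarrow>
       U' 0 N = 0 \<longrightarrow> \<not> has_root_count k (\<lambda>\<mu> \<nu>. pfaffian N (\<lambda>i j. \<mu> * U' i j + \<nu> * V' i j))"
    using obstructing_pencil[OF assms(1,6,7)] by (elim exE conjE) (rule that)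
  define \<omega> where "\<omega> \<kappa> = (if \<kappa> = (1::2) then U else V)" for \<kappa>
  have \<omega>_skew: "\<omega> \<kappa> j i = - \<omega> \<kappa> i j" for \<kappa> i j
  proof (cases "\<kappa> = 1")
    case True
    show ?thesis unfolding \<omega>_def if_P[OF True] using UV by blast
  next
    case False
    show ?thesis unfolding \<omega>_def if_not_P[OF False] using UV by blast
  qed
  \<comment> \<open>The factor \<open>- 1 / 2\<close> makes the antisymmetrisation of \<open>\<Lambda>0\<close> equal to the prescribed forms \<open>\<omega>\<close>.\<close>
  define \<Lambda>0 :: "'e \<Rightarrow> real^'d^2" where
    "\<Lambda>0 w = (\<chi> \<kappa> j. - (1 / 2) * (\<Sum>i\<in>UNIV. fst (g w) $ i * \<omega> \<kappa> (e' i) (e' j)))" for w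
  have \<Lambda>0_lin: "linear \<Lambda>0"
  proof (rule linearI)
    show "\<Lambda>0 (x + y) = \<Lambda>0 x + \<Lambda>0 y" for x y
      by (simp add: \<Lambda>0_def linear_add[OF g(1)] Finite_Cartesian_Product.vec_eq_iff distrib_right sum.distrib add_divide_distrib)
    show "\<Lambda>0 (r *\<^sub>R x) = r *\<^sub>R \<Lambda>0 x" for r x
      by (simp add: \<Lambda>0_def linear_cmul[OF g(1)] Finite_Cartesian_Product.vec_eq_iff sum_distrib_left mult.assoc)
  qed
  have \<Lambda>0_b: "\<Lambda>0 (linv g (axis (e i) 1, 0)) $ \<kappa> $ e j = - (1 / 2) * \<omega> \<kappa> i j" if "i < 2 * N" "j < 2 * N" for i j \<kappa>
  proof -
    have "(\<Sum>l\<in>UNIV. axis (e i) 1 $ l * \<omega> \<kappa> (e' l) (e' (e j))) = (\<Sum>l\<in>UNIV. if l = e i then \<omega> \<kappa> (e' l) (e' (e j)) else 0)"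
      by (rule sum.cong) (simp_all add: axis_def)
    then show ?thesis using that by (simp add: \<Lambda>0_def gi sum.delta e'e)
  qed
  have entry0: "levi_entry g e \<Lambda>0 \<kappa> i j = \<omega> \<kappa> i j" if "i < 2 * N" "j < 2 * N" for i j \<kappa>
    using \<omega>_skew[of \<kappa> j i] by (simp add: levi_entry_def \<Lambda>0_b[OF that] \<Lambda>0_b[OF that(2,1)])
  define f0 where "f0 = affine_section A c g q \<Lambda>0"
  have sec: "local_section T A ?B ?X fst (chart_dom c) (affine_section A c g q \<Lambda>)"
    and sec_q: "affine_section A c g q \<Lambda> q = x"
    and sec_\<Lambda>: "frechet_derivative (section_coord C c (affine_section A c g q \<Lambda>)) (at (chart_map c q)) = \<Lambda>"
    if "linear \<Lambda>" for \<Lambda>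
    using affine_section[OF M c(1,2) g that] assms(5) unfolding x_def D_def C_def by simp_all
  define L0 where "L0 = differential A ?B f0 q"
  have f0q: "f0 q = x" unfolding f0_def by (rule sec_q[OF \<Lambda>0_lin])
  have in_rel: "(x, L0) \<in> pfaffian_root_relation T A N k"
  proof -
    have jet: "(x, L0) = jet1 A ?B f0 q" by (simp add: jet1_def f0q L0_def)
    have levi: "dual_levi T A (\<lambda>q. snd (f0 q)) q (p m) (b i) (b j) = \<omega> (\<epsilon> m) i j"
      if "m < 2" "i < 2 * N" "j < 2 * N" for m i j
    proof -
      have pm: "p m \<in> annihilator A q (graph_plane A c g q 0)"
        using ordered_basis_in[OF p_basis that(1)] by (simp add: D_def)
      have "dual_levi T A (\<lambda>q. snd (f0 q)) q (p m) (b i) (b j) =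
          p m (?tv (linv g (0, \<Lambda>0 (linv g (axis (e j) 1, 0)) *v axis (e i) 1 - \<Lambda>0 (linv g (axis (e i) 1, 0)) *v axis (e j) 1)))"
        using dual_levi_formula[OF M c g sec[OF \<Lambda>0_lin] c(2) sec_q[OF \<Lambda>0_lin, unfolded x_def D_def] pm,
            of "axis (e i) 1" "axis (e j) 1"] sec_\<Lambda>[OF \<Lambda>0_lin]
        unfolding b_def f0_def C_def by simp
      also have "\<dots> = levi_entry g e \<Lambda>0 (\<epsilon> m) i j"
        by (simp add: p_tv gi levi_entry_def matrix_vector_mult_basis column_def)
      finally show ?thesis using entry0[OF that(2,3)] by simp
    qed
    have pf_eq: "pencil_pfaffian T A N (\<lambda>q. snd (f0 q)) q p b \<mu> \<nu> = pfaffian N (\<lambda>i j. \<mu> * U i j + \<nu> * V i j)" for \<mu> \<nu>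
    proof -
      have "pencil_pfaffian T A N (\<lambda>q. snd (f0 q)) q p b \<mu> \<nu> =
          det_fn (2 * N) (\<lambda>i j. if i = j then 1 else 0) * pfaffian N (\<lambda>i j. \<mu> * U i j + \<nu> * V i j)"
        unfolding pencil_pfaffian_def
      proof (rule pfaffian_congruence)
        fix i j assume ij: "i < 2 * N" "j < 2 * N"
        have delta: "(\<Sum>l<2 * N. (if l = j then 1 else 0) * F l) = F j" if "j < 2 * N" for j and F :: "nat \<Rightarrow> real"
        proof -
          have "(\<Sum>l<2 * N. (if l = j then 1 else 0) * F l) = (\<Sum>l<2 * N. if l = j then F l else 0)"
            by (rule sum.cong) simp_all
          then show ?thesis using that by (simp add: sum.delta)
        qed
        have "\<mu> * U i j + \<nu> * V i j =
            (\<Sum>k'<2 * N. \<Sum>l<2 * N. (if k' = i then 1 else 0) * (if l = j then 1 else 0) * (\<mu> * U k' l + \<nu> * V k' l))"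
          by (simp only: mult.assoc sum_distrib_left[symmetric] delta[OF ij(1)] delta[OF ij(2)])
        then show "\<mu> * dual_levi T A (\<lambda>q. snd (f0 q)) q (p 0) (b i) (b j) +
            \<nu> * dual_levi T A (\<lambda>q. snd (f0 q)) q (p 1) (b i) (b j) =
            (\<Sum>k'<2 * N. \<Sum>l<2 * N. (if k' = i then 1 else 0) * (if l = j then 1 else 0) * (\<mu> * U k' l + \<nu> * V k' l))"
          using levi[OF _ ij, of 0] levi[OF _ ij, of 1] by (simp add: \<epsilon>_def \<omega>_def)
      qed
      moreover have "det_fn (2 * N) (\<lambda>i j. if i = j then 1 else 0) = 1"
      proof -
        have "mat (2 * N) (2 * N) (\<lambda>(i, j). if i = j then 1 else 0) = (1\<^sub>m (2 * N) :: real mat)"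
          by (rule eq_matI) auto
        then show ?thesis by simp
      qed
      ultimately show ?thesis by simp
    qed
    have "pencil_pfaffian T A N (\<lambda>q. snd (f0 q)) q p b = (\<lambda>\<mu> \<nu>. pfaffian N (\<lambda>i j. \<mu> * U i j + \<nu> * V i j))"
      by (intro ext pf_eq)
    then have "exactly_simple_real_roots N k (pencil_pfaffian T A N (\<lambda>q. snd (f0 q)) q p b)"
      using simple by (simp only:)
    moreover have "local_section T A ?B ?X fst (chart_dom c) f0" unfolding f0_def by (rule sec[OF \<Lambda>0_lin])
    moreover have "snd (f0 q) = D" by (simp add: f0q x_def)
    ultimately show ?thesis
      unfolding pfaffian_root_relation_def mem_Collect_eq using jet c(2) p_basis b_basis by metis
  qed
  define \<V> where "\<V> = vertical_space A ?B fst x"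
  have \<Gamma>_lin: "lin_on (tangent_space ?B x) (\<Gamma> x)" and \<Gamma>_img: "\<And>v. v \<in> tangent_space ?B x \<Longrightarrow> \<Gamma> x v \<in> \<V>"
    and \<Gamma>_vert: "\<And>v. v \<in> \<V> \<Longrightarrow> \<Gamma> x v = v"
    using conn xX unfolding is_connection_def \<V>_def by blast+
  have \<Gamma>_add: "\<Gamma> x (u + v) = \<Gamma> x u + \<Gamma> x v" if "u \<in> tangent_space ?B x" "v \<in> tangent_space ?B x" for u v
    using \<Gamma>_lin that unfolding lin_on_def by blast
  have \<Gamma>_scale: "\<Gamma> x (r *\<^sub>R v) = r *\<^sub>R \<Gamma> x v" if "v \<in> tangent_space ?B x" for r v
    using \<Gamma>_lin that unfolding lin_on_def by blast
  have \<Gamma>_0: "\<Gamma> x 0 = 0" using \<Gamma>_scale[OF subspace_0[OF Tx_sub], of 0] by simp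
  define sect where "sect f \<longleftrightarrow> f q = x \<and> (\<exists>U. q \<in> U \<and> local_section T A ?B ?X fst U f)" for f
  define \<Lambda>' where "\<Lambda>' f = frechet_derivative (section_coord C c f) (at (chart_map c q))" for f :: "'a \<Rightarrow> ('a, 'e) gr_point"
  have jetT: "differential A ?B f q v \<in> tangent_space ?B x"
    and jetC: "differential A ?B f q v C = (v c, \<Lambda>' f (v c))"
    if f: "sect f" and v: "v \<in> tangent_space A q" for f v
  proof -
    obtain U where U: "q \<in> U" "local_section T A ?B ?X fst U f" and fq: "f q = x" using f unfolding sect_def by blast
    have dom: "f q \<in> chart_dom (gr_chart T A c g)" using xC fq by (simp add: C_def)
    show "differential A ?B f q v \<in> tangent_space ?B x"
      using section_differential(1)[OF M c(1,2) g U(2,1) dom v] fq by simp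
    show "differential A ?B f q v C = (v c, \<Lambda>' f (v c))"
      using section_differential(2)[OF M c(1,2) g U(2,1) dom v] by (simp add: C_def \<Lambda>'_def)
  qed
  have \<Lambda>'_lin: "linear (\<Lambda>' f)" if f: "sect f" for f
  proof -
    obtain U where U: "q \<in> U" "local_section T A ?B ?X fst U f" and fq: "f q = x" using f unfolding sect_def by blast
    have dom: "f q \<in> chart_dom (gr_chart T A c g)" using xC fq by (simp add: C_def)
    show ?thesis
      using section_in_chart(2)[OF M c(1,2) g U(2,1) dom] has_derivative_linear unfolding \<Lambda>'_def C_def by blast
  qed
  have jet_out: "differential A ?B f q v = 0" if "v \<notin> tangent_space A q" for f v
    using that by (simp add: differential_def)
  have jet_eqI: "u = v" if "u \<in> tangent_space ?B x" "v \<in> tangent_space ?B x" "u C = v C" for u v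
    by (rule tangent_space_eqI[OF CB xC that])
  have jet_add: "differential A ?B f q (u + v) = differential A ?B f q u + differential A ?B f q v"
    if f: "sect f" and uv: "u \<in> tangent_space A q" "v \<in> tangent_space A q" for f u v
    using jetC[OF f subspace_add[OF Tq_sub uv]] jetC[OF f uv(1)] jetC[OF f uv(2)] linear_add[OF \<Lambda>'_lin[OF f]]
    by (intro jet_eqI subspace_add[OF Tx_sub] jetT f uv subspace_add[OF Tq_sub]) simp
  have jet_scale: "differential A ?B f q (r *\<^sub>R v) = r *\<^sub>R differential A ?B f q v"
    if f: "sect f" and v: "v \<in> tangent_space A q" for f r v
    using jetC[OF f subspace_scale[OF Tq_sub v, of r]] jetC[OF f v] linear_cmul[OF \<Lambda>'_lin[OF f]]
    by (intro jet_eqI subspace_scale[OF Tx_sub] jetT f v subspace_scale[OF Tq_sub]) simp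
  have jet_vert: "\<Gamma> x (differential A ?B f q v) - \<Gamma> x (differential A ?B f' q v) =
      differential A ?B f q v - differential A ?B f' q v"
    if f: "sect f" "sect f'" and v: "v \<in> tangent_space A q" for f f' v
  proof -
    let ?u = "differential A ?B f q v" and ?u' = "differential A ?B f' q v"
    have T: "?u \<in> tangent_space ?B x" "?u' \<in> tangent_space ?B x" using jetT f v by blast+
    have diff: "?u - ?u' \<in> tangent_space ?B x" by (rule subspace_diff[OF Tx_sub T])
    have "?u - ?u' \<in> \<V>"
      unfolding \<V>_def x_def
    proof (rule vertical_iff[OF M c(1,2) g])
      show "(q, D) \<in> chart_dom (gr_chart T A c g)" using xC by (simp add: x_def C_def)
      show "?u - ?u' \<in> tangent_space ?B (q, D)" using diff by (simp add: x_def)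
      show "fst ((?u - ?u') (gr_chart T A c g)) = 0"
        using jetC[OF f(1) v] jetC[OF f(2) v] by (simp add: C_def)
    qed
    then have "\<Gamma> x (?u - ?u') = ?u - ?u'" by (rule \<Gamma>_vert)
    then show ?thesis using \<Gamma>_add[OF diff T(2)] by simp
  qed
  have f0: "sect f0" and \<Lambda>'0: "\<Lambda>' f0 = \<Lambda>0"
    using f0q sec[OF \<Lambda>0_lin] c(2) sec_\<Lambda>[OF \<Lambda>0_lin] unfolding sect_def f0_def \<Lambda>'_def by blast+
  \<comment> \<open>The vector \<open>b 0\<close> of the plane is transversal to \<open>\<tau>\<close>, so exactly the first row of the pencil stays free.\<close>
  define \<tau> where "\<tau> = ?tv ` {w. fst (g w) $ e 0 = 0}"
  define l where "l v = (if v \<in> \<tau> then \<Gamma> x (L0 v) else 0)" for v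
  have \<tau>_hyp: "hyperplane_of (tangent_space A q) \<tau>"
    unfolding \<tau>_def tangent_vec_image[OF At c(1,2), symmetric]
  proof (rule hyperplane_of_image[OF tvl tvi])
    show "linear (\<lambda>w. fst (g w) $ e 0)"
      by (rule linearI) (simp_all add: linear_add[OF g(1)] linear_cmul[OF g(1)])
    show "fst (g (linv g (axis (e 0) 1, 0))) $ e 0 \<noteq> 0" by (simp add: gi)
  qed
  then have \<tau>_sub: "subspace \<tau>" and \<tau>_T: "\<tau> \<subseteq> tangent_space A q" unfolding hyperplane_of_def by auto
  have \<Gamma>jet_hom: "\<Gamma> x \<circ> differential A ?B f q \<in> Hom_on (tangent_space A q) \<V>" if f: "sect f" for f
    unfolding Hom_on_def lin_on_def
    using jet_add[OF f] jet_scale[OF f] jetT[OF f] jet_out \<Gamma>_add \<Gamma>_scale \<Gamma>_img \<Gamma>_0 by auto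
  have l_hom: "l \<in> Hom_on \<tau> \<V>"
  proof -
    note hom0 = \<Gamma>jet_hom[OF f0]
    have lv: "l v = (\<Gamma> x \<circ> differential A ?B f0 q) v" if "v \<in> \<tau>" for v
      using that by (simp add: l_def L0_def)
    have "l (u + v) = l u + l v" if uv: "u \<in> \<tau>" "v \<in> \<tau>" for u v
      unfolding lv[OF uv(1)] lv[OF uv(2)] lv[OF subspace_add[OF \<tau>_sub uv]]
      by (rule Hom_onD(1)[OF hom0]) (use uv \<tau>_T in blast)+
    moreover have "l (r *\<^sub>R v) = r *\<^sub>R l v" if v: "v \<in> \<tau>" for r v
      unfolding lv[OF v] lv[OF subspace_scale[OF \<tau>_sub v]]
      by (rule Hom_onD(2)[OF hom0]) (use v \<tau>_T in blast)
    moreover have "l v \<in> \<V>" if v: "v \<in> \<tau>" for v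
      unfolding lv[OF v] by (rule Hom_onD(4)[OF hom0]) (use v \<tau>_T in blast)
    moreover have "l v = 0" if "v \<notin> \<tau>" for v using that by (simp add: l_def)
    ultimately show ?thesis unfolding Hom_on_def lin_on_def by blast
  qed
  define P where "P = principal_subspace (tangent_space A q) \<V> \<tau> l"
  define S where "S = relation_fibre \<Gamma> (pfaffian_root_relation T A N k) x \<inter> P"
  have in_P: "\<Gamma> x \<circ> differential A ?B f q \<in> P \<longleftrightarrow> (\<forall>w. fst (g w) $ e 0 = 0 \<longrightarrow> \<Lambda>' f w = \<Lambda>0 w)"
    if f: "sect f" for f
  proof -
    have "\<Gamma> x (differential A ?B f q v) = l v \<longleftrightarrow> \<Lambda>' f (v c) = \<Lambda>0 (v c)" if v: "v \<in> \<tau>" for v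
    proof -
      have vT: "v \<in> tangent_space A q" using v \<tau>_T by blast
      have "\<Gamma> x (differential A ?B f q v) = l v \<longleftrightarrow> \<Gamma> x (differential A ?B f q v) - \<Gamma> x (differential A ?B f0 q v) = 0"
        using v by (simp add: l_def L0_def)
      also have "\<dots> \<longleftrightarrow> differential A ?B f q v = differential A ?B f0 q v"
        unfolding jet_vert[OF f f0 vT] by simp
      also have "\<dots> \<longleftrightarrow> differential A ?B f q v C = differential A ?B f0 q v C"
        using jet_eqI[OF jetT[OF f vT] jetT[OF f0 vT]] by auto
      also have "\<dots> \<longleftrightarrow> \<Lambda>' f (v c) = \<Lambda>0 (v c)"
        by (simp add: jetC[OF f vT] jetC[OF f0 vT] \<Lambda>'0)
      finally show ?thesis .
    qed
    then have "(\<forall>v\<in>\<tau>. \<Gamma> x (differential A ?B f q v) = l v) \<longleftrightarrow> (\<forall>v\<in>\<tau>. \<Lambda>' f (v c) = \<Lambda>0 (v c))" by blast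
    also have "\<dots> \<longleftrightarrow> (\<forall>w. fst (g w) $ e 0 = 0 \<longrightarrow> \<Lambda>' f w = \<Lambda>0 w)" by (auto simp: \<tau>_def tvs)
    finally show ?thesis unfolding P_def principal_subspace_def using \<Gamma>jet_hom[OF f] by simp
  qed
  \<comment> \<open>This is the entry \<open>(0, N)\<close> of the first form of the pencil. Two jets over \<open>x\<close> differ by a vertical vector, which the connection fixes; the terms with \<open>L0\<close> use this to recover a jet from its image under the connection.\<close>
  define \<Phi> where "\<Phi> m = \<Lambda>0 (linv g (axis (e N) 1, 0)) $ 1 $ e 0 - snd (L0 (b 0) C) $ 1 $ e N
      + snd (\<Gamma> x (L0 (b 0)) C) $ 1 $ e N - snd (m (b 0) C) $ 1 $ e N"
    for m :: "('a, 'e) tvec \<Rightarrow> (('a, 'e) gr_point, 'e \<times> (real^'d^2)) tvec"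
  have b0T: "b 0 \<in> tangent_space A q" unfolding b_def by (rule tvT)
  have \<Phi>_jet: "\<Phi> (\<Gamma> x \<circ> differential A ?B f q) =
      \<Lambda>0 (linv g (axis (e N) 1, 0)) $ 1 $ e 0 - \<Lambda>' f (linv g (axis (e 0) 1, 0)) $ 1 $ e N" if f: "sect f" for f
  proof -
    have "\<Gamma> x (differential A ?B f q (b 0)) = \<Gamma> x (L0 (b 0)) + (differential A ?B f q (b 0) - L0 (b 0))"
      using jet_vert[OF f f0 b0T] unfolding L0_def by (simp add: algebra_simps)
    then show ?thesis using jetC[OF f b0T] by (simp add: \<Phi>_def bc)
  qed
  have \<Phi>_cont: "continuous_on UNIV \<Phi>"
  proof -
    have "linear (\<lambda>w :: 'e \<times> (real^'d^2). snd w $ 1 $ e N)" by (rule linearI) simp_all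
    then have lin: "continuous_on UNIV (\<lambda>w :: 'e \<times> (real^'d^2). snd w $ 1 $ e N)"
      by (intro linear_continuous_on) (simp add: linear_conv_bounded_linear)
    have 1: "continuous_on UNIV (\<lambda>m. m (b 0) :: (('a, 'e) gr_point, 'e \<times> (real^'d^2)) tvec)"
      by (rule continuous_on_product_coordinates)
    have 2: "continuous_on UNIV (\<lambda>u :: (('a, 'e) gr_point, 'e \<times> (real^'d^2)) tvec. u C)"
      by (rule continuous_on_product_coordinates)
    have "continuous_on UNIV (\<lambda>m. snd ((m (b 0) :: (('a, 'e) gr_point, 'e \<times> (real^'d^2)) tvec) C) $ 1 $ e N)"
      by (rule continuous_on_compose2[OF lin continuous_on_compose2[OF 2 1]]) auto
    then show ?thesis unfolding \<Phi>_def by (intro continuous_on_diff continuous_on_const)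
  qed
  have \<Phi>_affine: "\<Phi> ((1 - t) *\<^sub>R m + t *\<^sub>R m') = (1 - t) * \<Phi> m + t * \<Phi> m'" for m m' t
    by (simp add: \<Phi>_def algebra_simps)
  have \<Phi>_nz: "\<Phi> m \<noteq> 0" if mS: "m \<in> S" for m
  proof -
    obtain L where L: "m = \<Gamma> x \<circ> L" "(x, L) \<in> pfaffian_root_relation T A N k" and mP: "m \<in> P"
      using mS unfolding S_def relation_fibre_def by blast
    obtain f q' W p' b' where f: "(x, L) = jet1 A ?B f q'" "q' \<in> W" "local_section T A ?B ?X fst W f"
      and bases: "ordered_basis 2 p' (annihilator A q' (snd (f q')))" "ordered_basis (2 * N) b' (snd (f q'))"
        "exactly_simple_real_roots N k (pencil_pfaffian T A N (\<lambda>q. snd (f q)) q' p' b')"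
      using L(2) unfolding pfaffian_root_relation_def mem_Collect_eq by blast
    have fq': "f q' = x" "L = differential A ?B f q'" using f(1) by (simp_all add: jet1_def)
    have "fst (f q') = q'" using f(2,3) unfolding local_section_def by blast
    then have qq: "q' = q" using fq'(1) by (simp add: x_def)
    have sf: "sect f" unfolding sect_def using fq'(1) f(2,3) unfolding qq by blast
    have m: "m = \<Gamma> x \<circ> differential A ?B f q" using L(1) fq'(2) qq by simp
    have agree: "\<Lambda>' f w = \<Lambda>0 w" if "fst (g w) $ e 0 = 0" for w
      using mP that unfolding m in_P[OF sf] by blast
    define \<omega>' where "\<omega>' = levi_entry g e (\<Lambda>' f)"
    have cnt: "has_root_count k (\<lambda>\<mu> \<nu>. pfaffian N (\<lambda>i j. \<mu> * \<omega>' 1 i j + \<nu> * \<omega>' 2 i j))"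
      unfolding \<omega>'_def \<Lambda>'_def C_def
      by (rule pencil_has_root_count[OF M c g f(3) f(2)[unfolded qq] _ e bases(1,2)[unfolded qq]
            has_root_count_if_simple[OF bases(3)[unfolded qq]]])
        (use fq'(1) qq in \<open>simp add: x_def D_def\<close>)
    have agree_b: "\<Lambda>' f (linv g (axis (e i) 1, 0)) = \<Lambda>0 (linv g (axis (e i) 1, 0))" if "1 \<le> i" "i < 2 * N" for i
      using e_inj[OF that(2) N0(1)] that by (intro agree) (simp add: gi axis_def)
    have same: "\<omega>' \<kappa> i j = \<omega> \<kappa> i j" if "1 \<le> i" "i < 2 * N" "1 \<le> j" "j < 2 * N" for \<kappa> i j
      using entry0[OF that(2,4)] unfolding \<omega>'_def levi_entry_def agree_b[OF that(1,2)] agree_b[OF that(3,4)] .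
    have skew': "\<omega>' \<kappa> j i = - \<omega>' \<kappa> i j" for \<kappa> i j by (simp add: \<omega>'_def levi_entry_def)
    have "\<omega>' 1 0 N \<noteq> 0"
    proof
      assume zero: "\<omega>' 1 0 N = 0"
      have 1: "\<forall>i<2 * N. \<forall>j<2 * N. \<omega>' 1 j i = - \<omega>' 1 i j \<and> \<omega>' 2 j i = - \<omega>' 2 i j"
        by (intro allI impI conjI skew')
      have 2: "\<forall>i j. 1 \<le> i \<and> i < 2 * N \<and> 1 \<le> j \<and> j < 2 * N \<longrightarrow> \<omega>' 1 i j = U i j \<and> \<omega>' 2 i j = V i j" 
        using same by (simp add: \<omega>_def)
      show False using bad[rule_format, OF 1[rule_format] 2[rule_format] zero] cnt by blast
    qed
    moreover have "\<omega>' 1 0 N = \<Phi> m"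
      unfolding m \<Phi>_jet[OF sf] using agree_b[of N] assms(1) N0 by (simp add: \<omega>'_def levi_entry_def)
    ultimately show ?thesis by simp
  qed
  have L0S: "\<Gamma> x \<circ> L0 \<in> S"
    unfolding S_def relation_fibre_def using in_rel in_P[OF f0] \<Lambda>'0 unfolding L0_def by auto
  have \<Phi>_L0: "\<Phi> (\<Gamma> x \<circ> L0) = 1"
    using \<Phi>_jet[OF f0] entry0[OF N0, of 1] U1 by (simp add: L0_def \<Lambda>'0 levi_entry_def \<omega>_def)
  \<comment> \<open>Changing the derivative along \<open>b 0\<close> only, by just enough to cancel the entry, gives the point of the principal subspace outside the half-space.\<close>
  define E :: "real^'d^2" where "E = (\<chi> \<kappa> j. if \<kappa> = 1 \<and> j = e N then 1 else 0)"
  define \<Lambda>1 where "\<Lambda>1 w = \<Lambda>0 w + (fst (g w) $ e 0) *\<^sub>R E" for w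
  have \<Lambda>1_lin: "linear \<Lambda>1"
    by (rule linearI) (simp_all add: \<Lambda>1_def linear_add[OF \<Lambda>0_lin] linear_cmul[OF \<Lambda>0_lin] linear_add[OF g(1)]
        linear_cmul[OF g(1)] algebra_simps)
  define f1 where "f1 = affine_section A c g q \<Lambda>1"
  have f1: "sect f1" and \<Lambda>'1: "\<Lambda>' f1 = \<Lambda>1"
    using sec_q[OF \<Lambda>1_lin] sec[OF \<Lambda>1_lin] c(2) sec_\<Lambda>[OF \<Lambda>1_lin] unfolding sect_def f1_def \<Lambda>'_def by blast+
  have L1P: "\<Gamma> x \<circ> differential A ?B f1 q \<in> P"
    unfolding in_P[OF f1] \<Lambda>'1 by (simp add: \<Lambda>1_def)
  have \<Phi>_L1: "\<Phi> (\<Gamma> x \<circ> differential A ?B f1 q) = 0"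
    using \<Phi>_jet[OF f1] \<Phi>_jet[OF f0] \<Phi>_L0 by (simp add: L0_def \<Lambda>'0 \<Lambda>'1 \<Lambda>1_def gi E_def)
  have "\<exists>K\<in>components S. convex hull K \<noteq> P"
    by (rule component_hull_misses_zero[where \<Phi> = \<Phi>, OF \<Phi>_cont \<Phi>_affine \<Phi>_nz L0S _ L1P \<Phi>_L1]) (simp_all add: \<Phi>_L0)
  moreover have "S \<noteq> {}" using L0S by blast
  moreover have "fst x = q" by (simp add: x_def)
  ultimately show ?thesis
    unfolding ample_def Let_def using xX \<tau>_hyp l_hom unfolding S_def P_def \<V>_def by metis
qed

end
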